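(* Let $k$ be an algebraically closed field of characteristic zero, $R = k[x_1,x_2,x_3,x_4]$, and let $F_1,F_2,F_3,F_4 \in R$ be a regular sequence of forms, all of the same degree $d$. Let $I_1 = \langle F_1,F_2\rangle$, $I_2 = \langle F_3,F_4\rangle$, $I_C = I_1 \cap I_2$, and let $C$ be the curve in $\mathbb{P}^3 = \mathrm{Proj}(R)$ defined by $I_C$. Then: (a) $I_C$ is saturated and $C = C_1 \cup C_2$, where $C_1$ and $C_2$ are the disjoint complete intersections in $\mathbb{P}^3$ defined by $I_1$ and $I_2$ respectively. (b) $I_C = I_1 \cdot I_2$. (c) The minimal free resolution of $I_C$ is obtained as the tensor product of the Koszul resolutions of $I_1$ and $I_2$. Hence, in particular, the Hilbert function of $C$ is completely determined. (d) For the Hartshorne-Rao module $M(C) = \bigoplus_{t \in \mathbb{Z}} H^1(\mathcal{I}_C(t))$ there is an isomorphism of graded $R$-modules \[ M(C) \cong A = R/\langle F_1,F_2,F_3,F_4\rangle . \] In particular, the minimal free resolution of $M(C)$ is given by the Koszul resolution (on $F_1,F_2,F_3,F_4$).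
   Context: $\mathcal{I}_C$ is the ideal sheaf of $C$ in $\mathbb{P}^3$. The Koszul resolution of $I_1$ is $0 \to R(-2d) \to R(-d)^2 \to I_1 \to 0$ (given by $F_1,F_2$), and similarly for $I_2$ with $F_3,F_4$. In (c), "completely determined" means that it depends only on $d$. *)

theory Defs
  imports
    "HOL-Library.Poly_Mapping"
    "HOL-Library.Numeral_Type"
    "HOL-Computational_Algebra.Fraction_Field"
    "HOL-Algebra.Ideal_Product"
    "HOL-Algebra.QuotRing"
    "HOL-Algebra.Embedded_Algebras"
    "HOL-Algebra.Product_Groups"
    "HOL-Algebra.Algebraic_Closure_Type"
    "HOL-Analysis.Abstract_Topology"
begin

section \<open>The graded polynomial ring in four variables\<close>

type_synonym 'k poly4 = "(4 \<Rightarrow>\<^sub>0 nat) \<Rightarrow>\<^sub>0 'k"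

abbreviation polyring :: "'k::field poly4 ring"
  where "polyring \<equiv> ring_of_type_algebra"

definition pconst :: "'k::field \<Rightarrow> 'k poly4"
  where "pconst a = Poly_Mapping.single 0 a"

definition pvar :: "4 \<Rightarrow> 'k::field poly4"
  where "pvar i = Poly_Mapping.single (Poly_Mapping.single i 1) 1"

definition mdeg :: "(4 \<Rightarrow>\<^sub>0 nat) \<Rightarrow> nat"
  where "mdeg m = (\<Sum>i\<in>UNIV. Poly_Mapping.lookup m i)"

text \<open>The graded piece \<open>R\<^sub>t\<close>; it contains \<open>0\<close> for every \<open>t\<close> and nothing else for \<open>t < 0\<close>.\<close>
definition forms :: "int \<Rightarrow> 'k::field poly4 set"
  where "forms t = {f. \<forall>m\<in>Poly_Mapping.keys f. int (mdeg m) = t}"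

definition hcomp :: "int \<Rightarrow> 'k::field poly4 \<Rightarrow> 'k poly4"
  where "hcomp t f = (\<Sum>m\<in>{m \<in> Poly_Mapping.keys f. int (mdeg m) = t}.
            Poly_Mapping.single m (Poly_Mapping.lookup f m))"

definition homogeneous_ideal :: "'k::field poly4 set \<Rightarrow> bool"
  where "homogeneous_ideal I \<longleftrightarrow> ideal I polyring \<and> (\<forall>f\<in>I. \<forall>t. hcomp t f \<in> I)"

definition irrelevant_ideal :: "'k::field poly4 set"
  where "irrelevant_ideal = Idl\<^bsub>polyring\<^esub> (range pvar)"

definition regular_sequence :: "('a, 'm) ring_scheme \<Rightarrow> 'a list \<Rightarrow> bool"
  where "regular_sequence R fs \<longleftrightarrow>
    set fs \<subseteq> carrier R \<and> Idl\<^bsub>R\<^esub> (set fs) \<noteq> carrier R \<and>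
    (\<forall>i<length fs. \<forall>r\<in>carrier R.
       r \<otimes>\<^bsub>R\<^esub> fs ! i \<in> Idl\<^bsub>R\<^esub> (set (take i fs)) \<longrightarrow> r \<in> Idl\<^bsub>R\<^esub> (set (take i fs)))"

definition ideal_power :: "('a, 'm) ring_scheme \<Rightarrow> 'a set \<Rightarrow> nat \<Rightarrow> 'a set"
  where "ideal_power R J n = ((\<lambda>K. J \<cdot>\<^bsub>R\<^esub> K) ^^ n) (carrier R)"

definition saturation :: "'k::field poly4 set \<Rightarrow> 'k poly4 set"
  where "saturation I = {f. \<exists>n. \<forall>g\<in>ideal_power polyring irrelevant_ideal n. g * f \<in> I}"

definition saturated :: "'k::field poly4 set \<Rightarrow> bool"
  where "saturated I \<longleftrightarrow> saturation I = I"


section \<open>Closed subschemes of projective three-space\<close>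

definition proj3 :: "'k::field poly4 set set"
  where "proj3 = {P. primeideal P polyring \<and> homogeneous_ideal P \<and> \<not> irrelevant_ideal \<subseteq> P}"

definition zariski :: "'k::field poly4 set topology"
  where "zariski = topology_generated_by {{P \<in> proj3. f \<notin> P} |f. \<exists>n. f \<in> forms n}"

type_synonym 'k sheaf_section = "'k poly4 set \<Rightarrow> 'k poly4 fract"
type_synonym 'k sheaf = "'k poly4 set set \<Rightarrow> 'k sheaf_section set"

text \<open>
  The sheaf associated with the graded module \<open>I(t)\<close>, for a homogeneous ideal \<open>I\<close>: a section over
  an open set \<open>U\<close> is a function on \<open>U\<close> with values in the stalks that is locally a quotient of
  degree \<open>t\<close> of an element of \<open>I\<close> by a form. As \<open>R\<close> is a domain and \<open>I \<subseteq> R\<close>, all the stalks are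
  subgroups of the fraction field of \<open>R\<close>. Sections are extended by \<open>0\<close> outside \<open>U\<close>.
\<close>
definition associated_sheaf :: "'k::field poly4 set \<Rightarrow> int \<Rightarrow> 'k sheaf"
  where "associated_sheaf I t U = {s. (\<forall>P. P \<notin> U \<longrightarrow> s P = 0) \<and>
    (\<forall>P\<in>U. \<exists>V. openin zariski V \<and> P \<in> V \<and> V \<subseteq> U \<and>
      (\<exists>n a f. a \<in> I \<and> a \<in> forms (n + t) \<and> f \<in> forms n \<and>
         (\<forall>Q\<in>V. f \<notin> Q \<and> s Q = Fract a f)))}"

abbreviation twisting_sheaf :: "int \<Rightarrow> 'k::field sheaf"  (\<open>\<O>\<close>)
  where "\<O> t \<equiv> associated_sheaf UNIV t"

text \<open>A closed subscheme is represented by its ideal sheaf.\<close>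
definition subscheme_of :: "'k::field poly4 set \<Rightarrow> 'k sheaf"
  where "subscheme_of I = associated_sheaf I 0"

text \<open>The scheme-theoretic union: its ideal sheaf is the intersection of the two ideal sheaves.\<close>
definition scheme_union :: "'k::field sheaf \<Rightarrow> 'k sheaf \<Rightarrow> 'k sheaf"
  where "scheme_union Z W U = Z U \<inter> W U"

text \<open>The points at which the stalk of the ideal sheaf is a proper ideal.\<close>
definition scheme_support :: "'k::field sheaf \<Rightarrow> 'k poly4 set set"
  where "scheme_support Z = {P \<in> proj3. \<forall>U. openin zariski U \<and> P \<in> U \<longrightarrow>
           (\<lambda>Q. if Q \<in> U then 1 else 0) \<notin> Z U}"

text \<open>
  The twist \<open>\<I>\<^sub>Z(t)\<close>. Since \<open>\<O>(t)\<close> is invertible, \<open>\<I>\<^sub>Z \<otimes> \<O>(t)\<close> is the subsheaf \<open>\<I>\<^sub>Z \<cdot> \<O>(t)\<close> of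
  \<open>\<O>(t)\<close>, whose sections are locally a single product.
\<close>
definition twist :: "'k::field sheaf \<Rightarrow> int \<Rightarrow> 'k sheaf"
  where "twist Z t U = {s. (\<forall>P. P \<notin> U \<longrightarrow> s P = 0) \<and>
    (\<forall>P\<in>U. \<exists>V. openin zariski V \<and> P \<in> V \<and> V \<subseteq> U \<and>
      (\<exists>g\<in>Z V. \<exists>h\<in>\<O> t V. \<forall>Q\<in>V. s Q = g Q * h Q))}"

text \<open>
  The saturated homogeneous ideal \<open>I\<^sub>Z = \<Oplus>\<^sub>t H\<^sup>0(\<I>\<^sub>Z(t))\<close>, as a subset of
  \<open>R = \<Oplus>\<^sub>t H\<^sup>0(\<O>(t))\<close>.
\<close>
definition total_ideal :: "'k::field sheaf \<Rightarrow> 'k poly4 set"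
  where "total_ideal Z =
    {f. \<forall>t. (\<lambda>P. if P \<in> proj3 then Fract (hcomp t f) 1 else 0) \<in> twist Z t proj3}"

definition complete_intersection :: "nat \<Rightarrow> 'k::field sheaf \<Rightarrow> bool"
  where "complete_intersection c Z \<longleftrightarrow>
    (\<exists>fs. length fs = c \<and> (\<forall>f\<in>set fs. \<exists>n. f \<in> forms n) \<and> regular_sequence polyring fs \<and>
          total_ideal Z = Idl\<^bsub>polyring\<^esub> (set fs))"

text \<open>\<open>t \<mapsto> dim\<^sub>k (R/I\<^sub>Z)\<^sub>t\<close>\<close>
definition hilbert_function :: "'k::field sheaf \<Rightarrow> int \<Rightarrow> nat"
  where "hilbert_function Z t =
    ring.dim (polyring Quot total_ideal Z)
      ((\<lambda>a. total_ideal Z +>\<^bsub>polyring\<^esub> pconst a) ` UNIV)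
      ((\<lambda>f. total_ideal Z +>\<^bsub>polyring\<^esub> f) ` forms t)"


section \<open>The first cohomology group\<close>

text \<open>
  \<open>H\<^sup>1(T, F)\<close> as the direct limit, over all open covers of \<open>T\<close>, of the first Cech cohomology groups;
  on every topological space this agrees with the derived functor cohomology in degree one. It
  suffices to take covers \<open>N\<close> indexed by the points of \<open>T\<close>, with \<open>x \<in> N x\<close>: they refine all other
  covers, and among them a cover refines another one if it is contained in it pointwise. The sheaf
  \<open>F\<close> consists of functions vanishing outside the open set in question. As in the homology library,
  the abelian group is written multiplicatively.
\<close>

type_synonym ('p, 'v) cochain = "('p \<Rightarrow> 'p set) \<times> ('p \<Rightarrow> 'p \<Rightarrow> 'p \<Rightarrow> 'v)"

definition point_cover :: "'p topology \<Rightarrow> ('p \<Rightarrow> 'p set) \<Rightarrow> bool"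
  where "point_cover T N \<longleftrightarrow> (\<forall>x\<in>topspace T. openin T (N x) \<and> x \<in> N x)"

definition cech_cocycles ::
  "'p topology \<Rightarrow> ('p set \<Rightarrow> ('p \<Rightarrow> 'v::ab_group_add) set) \<Rightarrow> ('p, 'v) cochain set"
  where "cech_cocycles T F = {(N, g). point_cover T N \<and>
    (\<forall>x\<in>topspace T. \<forall>y\<in>topspace T. g x y \<in> F (N x \<inter> N y)) \<and>
    (\<forall>x\<in>topspace T. \<forall>y\<in>topspace T. \<forall>z\<in>topspace T. \<forall>q\<in>N x \<inter> N y \<inter> N z.
       g x y q + g y z q = g x z q)}"

text \<open>Two cocycles agree in the limit iff they differ by a coboundary on a common refinement.\<close>
definition cohomologous ::
  "'p topology \<Rightarrow> ('p set \<Rightarrow> ('p \<Rightarrow> 'v::ab_group_add) set) \<Rightarrow>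
     (('p, 'v) cochain \<times> ('p, 'v) cochain) set"
  where "cohomologous T F = {((N, g), (N', h)).
    (N, g) \<in> cech_cocycles T F \<and> (N', h) \<in> cech_cocycles T F \<and>
    (\<exists>N'' c. point_cover T N'' \<and>
       (\<forall>x\<in>topspace T. N'' x \<subseteq> N x \<inter> N' x \<and> c x \<in> F (N'' x)) \<and>
       (\<forall>x\<in>topspace T. \<forall>y\<in>topspace T. \<forall>q\<in>N'' x \<inter> N'' y.
          g x y q - h x y q = c y q - c x q))}"

fun cochain_add :: "('p, 'v::ab_group_add) cochain \<Rightarrow> ('p, 'v) cochain \<Rightarrow> ('p, 'v) cochain"
  where "cochain_add (N, g) (N', h) =
    (\<lambda>x. N x \<inter> N' x,
     \<lambda>x y q. if q \<in> N x \<inter> N' x \<inter> (N y \<inter> N' y) then g x y q + h x y q else 0)"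

definition H1 ::
  "'p topology \<Rightarrow> ('p set \<Rightarrow> ('p \<Rightarrow> 'v::ab_group_add) set) \<Rightarrow> ('p, 'v) cochain set monoid"
  where "H1 T F = \<lparr>
    carrier = cech_cocycles T F // cohomologous T F,
    monoid.mult = (\<lambda>\<alpha> \<beta>. \<Union>a\<in>\<alpha>. \<Union>b\<in>\<beta>. cohomologous T F `` {cochain_add a b}),
    one = cohomologous T F `` {(\<lambda>_. topspace T, \<lambda>_ _ _. 0)} \<rparr>"

text \<open>The map into \<open>H\<^sup>1(T, G)\<close> induced by multiplication \<open>F \<rightarrow> G\<close> with \<open>v\<close>.\<close>
definition H1_scale ::
  "'p topology \<Rightarrow> ('p set \<Rightarrow> ('p \<Rightarrow> 'v::comm_ring) set) \<Rightarrow> 'v \<Rightarrow>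
     ('p, 'v) cochain set \<Rightarrow> ('p, 'v) cochain set"
  where "H1_scale T G v \<alpha> =
    (\<Union>(N, g)\<in>\<alpha>. cohomologous T G `` {(N, \<lambda>x y q. v * g x y q)})"


section \<open>Graded modules\<close>

text \<open>The fields \<open>mult\<close> and \<open>one\<close>, inherited from the record of modules, play no role.\<close>
record ('a, 'm) graded_module = "('a, 'm) module" +
  piece :: "int \<Rightarrow> 'm set"

definition graded_iso ::
  "('k::field poly4, 'm) graded_module \<Rightarrow> ('k poly4, 'n) graded_module \<Rightarrow> ('m \<Rightarrow> 'n) set"
  where "graded_iso M N = {\<phi>. \<phi> \<in> iso (add_monoid M) (add_monoid N) \<and>
    (\<forall>r. \<forall>x\<in>carrier M. \<phi> (r \<odot>\<^bsub>M\<^esub> x) = r \<odot>\<^bsub>N\<^esub> \<phi> x) \<and>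
    (\<forall>t. \<phi> ` piece M t = piece N t)}"

definition ideal_module :: "'k::field poly4 set \<Rightarrow> ('k poly4, 'k poly4) graded_module"
  where "ideal_module I = \<lparr>carrier = I, monoid.mult = (*), one = 1, ring.zero = 0,
    add = (+), module.smult = (*), piece = (\<lambda>t. I \<inter> forms t)\<rparr>"

definition quotient_module :: "'k::field poly4 set \<Rightarrow> ('k poly4, 'k poly4 set) graded_module"
  where "quotient_module I = \<lparr>carrier = carrier (polyring Quot I),
    monoid.mult = monoid.mult (polyring Quot I), one = one (polyring Quot I),
    ring.zero = ring.zero (polyring Quot I), add = add (polyring Quot I),
    module.smult = (\<lambda>r c. (I +>\<^bsub>polyring\<^esub> r) \<otimes>\<^bsub>polyring Quot I\<^esub> c),
    piece = (\<lambda>t. (\<lambda>f. I +>\<^bsub>polyring\<^esub> f) ` forms t)\<rparr>"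

text \<open>
  The Hartshorne-Rao module \<open>\<Oplus>\<^sub>t H\<^sup>1(\<I>\<^sub>Z(t))\<close>. A form \<open>r\<close> of degree \<open>e\<close> acts through the maps
  \<open>H\<^sup>1(\<I>\<^sub>Z(t - e)) \<rightarrow> H\<^sup>1(\<I>\<^sub>Z(t))\<close> induced by multiplication with \<open>r\<close>, and an arbitrary polynomial
  through the sum of its homogeneous components.
\<close>
definition rao_module ::
  "'k::field sheaf \<Rightarrow>
     ('k poly4, int \<Rightarrow> ('k poly4 set, 'k poly4 fract) cochain set) graded_module"
  where "rao_module Z =
    (let H = (\<lambda>t. H1 zariski (twist Z t)); S = sum_group UNIV H in
     \<lparr>carrier = carrier S, monoid.mult = (\<lambda>u v. u), one = one S, ring.zero = one S,
      add = monoid.mult S,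
      module.smult = (\<lambda>r u t. \<Otimes>\<^bsub>H t\<^esub>e\<in>{e. hcomp e r \<noteq> 0}.
         H1_scale zariski (twist Z t) (Fract (hcomp e r) 1) (u (t - e))),
      piece = (\<lambda>t. {u \<in> carrier S. \<forall>s. s \<noteq> t \<longrightarrow> u s = \<one>\<^bsub>H s\<^esub>})\<rparr>)"


section \<open>Graded free complexes and resolutions\<close>

text \<open>
  A complex of graded free modules \<open>\<dots> \<rightarrow> F\<^sub>1 \<rightarrow> F\<^sub>0 \<rightarrow> 0\<close> with chosen homogeneous bases: a basis
  element \<open>b\<close> generates a summand \<open>R(- shift b)\<close> of \<open>F\<^sub>n\<close> with \<open>n = hdeg b\<close>, and \<open>diff b c\<close> is the
  coefficient of \<open>c\<close> in the image of \<open>b\<close>. Only the values on \<open>basis\<close> matter.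
\<close>
record ('b, 'r) based_complex =
  basis :: "'b set"
  hdeg :: "'b \<Rightarrow> nat"
  shift :: "'b \<Rightarrow> int"
  diff :: "'b \<Rightarrow> 'b \<Rightarrow> 'r"

definition free_chains :: "('b, 'r::comm_ring_1) based_complex \<Rightarrow> nat \<Rightarrow> ('b \<Rightarrow> 'r) set"
  where "free_chains C n = {v. \<forall>b. v b \<noteq> 0 \<longrightarrow> b \<in> basis C \<and> hdeg C b = n}"

definition differential :: "('b, 'r::comm_ring_1) based_complex \<Rightarrow> ('b \<Rightarrow> 'r) \<Rightarrow> ('b \<Rightarrow> 'r)"
  where "differential C v = (\<lambda>c. if c \<in> basis C then \<Sum>b\<in>basis C. v b * diff C b c else 0)"

text \<open>Finitely generated, with differentials that are homogeneous of degree \<open>0\<close>.\<close>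
definition graded_free :: "('b, 'k::field poly4) based_complex \<Rightarrow> bool"
  where "graded_free C \<longleftrightarrow> finite (basis C) \<and>
    (\<forall>b\<in>basis C. \<forall>c\<in>basis C.
       diff C b c \<in> forms (shift C b - shift C c) \<and>
       (hdeg C b \<noteq> Suc (hdeg C c) \<longrightarrow> diff C b c = 0))"

text \<open>The map \<open>F\<^sub>0 \<rightarrow> M\<close> given by its values \<open>\<epsilon>\<close> on the basis of \<open>F\<^sub>0\<close>.\<close>
definition augmentation ::
  "('b, 'k::field poly4) based_complex \<Rightarrow> ('b \<Rightarrow> 'm) \<Rightarrow> ('k poly4, 'm) graded_module \<Rightarrow>
     ('b \<Rightarrow> 'k poly4) \<Rightarrow> 'm"
  where "augmentation C \<epsilon> M v = (\<Oplus>\<^bsub>M\<^esub>b\<in>{b \<in> basis C. hdeg C b = 0}. v b \<odot>\<^bsub>M\<^esub> \<epsilon> b)"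

definition graded_free_resolution ::
  "('b, 'k::field poly4) based_complex \<Rightarrow> ('b \<Rightarrow> 'm) \<Rightarrow> ('k poly4, 'm) graded_module \<Rightarrow> bool"
  where "graded_free_resolution C \<epsilon> M \<longleftrightarrow> graded_free C \<and>
    (\<forall>b\<in>basis C. hdeg C b = 0 \<longrightarrow> \<epsilon> b \<in> piece M (shift C b)) \<and>
    augmentation C \<epsilon> M ` free_chains C 0 = carrier M \<and>
    {v \<in> free_chains C 0. augmentation C \<epsilon> M v = \<zero>\<^bsub>M\<^esub>} = differential C ` free_chains C 1 \<and>
    (\<forall>n\<ge>1. {v \<in> free_chains C n. differential C v = (\<lambda>_. 0)} =
            differential C ` free_chains C (Suc n))"

definition minimal_free_resolution ::
  "('b, 'k::field poly4) based_complex \<Rightarrow> ('b \<Rightarrow> 'm) \<Rightarrow> ('k poly4, 'm) graded_module \<Rightarrow> bool"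
  where "minimal_free_resolution C \<epsilon> M \<longleftrightarrow> graded_free_resolution C \<epsilon> M \<and>
    (\<forall>b\<in>basis C. \<forall>c\<in>basis C. diff C b c \<in> irrelevant_ideal)"

definition tensor_complex ::
  "('b, 'r::comm_ring_1) based_complex \<Rightarrow> ('c, 'r) based_complex \<Rightarrow> ('b \<times> 'c, 'r) based_complex"
  where "tensor_complex C D = \<lparr>
    basis = basis C \<times> basis D,
    hdeg = (\<lambda>(b, c). hdeg C b + hdeg D c),
    shift = (\<lambda>(b, c). shift C b + shift D c),
    diff = (\<lambda>(b, c) (b', c').
      (if c = c' then diff C b b' else 0) +
      (if b = b' then (- 1) ^ hdeg C b * diff D c c' else 0)) \<rparr>"

text \<open>
  The Koszul complex on a list of forms of degree \<open>d\<close>. The subset \<open>{i\<^sub>1 < \<dots> < i\<^sub>p}\<close> of the index set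
  stands for the basis element \<open>e\<^sub>i\<^sub>1 \<and> \<dots> \<and> e\<^sub>i\<^sub>p\<close>.
\<close>
definition koszul_complex :: "nat \<Rightarrow> 'r::comm_ring_1 list \<Rightarrow> (nat set, 'r) based_complex"
  where "koszul_complex d fs = \<lparr>
    basis = Pow {..<length fs},
    hdeg = card,
    shift = (\<lambda>S. int (card S * d)),
    diff = (\<lambda>S T. \<Sum>i\<in>S. if T = S - {i} then (- 1) ^ card {j \<in> S. j < i} * fs ! i else 0) \<rparr>"

text \<open>
  The Koszul resolution \<open>\<dots> \<rightarrow> R(-2d)\<^bsup>\<dots>\<^esup> \<rightarrow> R(-d)\<^sup>n \<rightarrow> I \<rightarrow> 0\<close> of the ideal \<open>I\<close> generated by the
  list: the Koszul complex without its term \<open>R\<close>, which is replaced by the augmentation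
  \<open>e\<^sub>i \<mapsto> fs ! i\<close> onto \<open>I\<close>.
\<close>
definition koszul_ideal_complex :: "nat \<Rightarrow> 'r::comm_ring_1 list \<Rightarrow> (nat set, 'r) based_complex"
  where "koszul_ideal_complex d fs = (koszul_complex d fs)
    \<lparr>basis := Pow {..<length fs} - {{}}, hdeg := (\<lambda>S. card S - 1)\<rparr>"

definition koszul_ideal_augmentation :: "'r list \<Rightarrow> nat set \<Rightarrow> 'r"
  where "koszul_ideal_augmentation fs S = fs ! the_elem S"

end

theory Submission
  imports Defs
begin

text \<open>
  Everything is reduced to statements about the regular sequence, which may be permuted because its
  members are forms of positive degree. Counting dimensions along the sequence determines the Hilbert
  functions and shows that \<open>R/(F\<^sub>1, F\<^sub>2, F\<^sub>3, F\<^sub>4)\<close> vanishes in high degrees, so that the two curves are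
  disjoint.

  As \<open>\<P>\<^sup>3\<close> is irreducible, a section of \<open>\<I>(t)\<close> over a nonempty open set is an element of the function
  field that lies in all the stalks, and a class in \<open>H\<^sup>1(\<I>(t))\<close> is a family of elements of the function
  field, one for every point, that is locally constant modulo the stalks; it is trivial if it is constant
  modulo the stalks. A Koszul argument with powers of the \<open>F\<^sub>i\<close> yields \<open>H\<^sup>1(\<I>\<^sub>1(t)) = H\<^sup>1(\<I>\<^sub>2(t)) = 0\<close>, and the
  Mayer-Vietoris sequence of \<open>\<I>\<^sub>1 \<inter> \<I>\<^sub>2\<close> with \<open>\<I>\<^sub>1 + \<I>\<^sub>2 = \<O>\<close> identifies \<open>H\<^sup>1(\<I>\<^sub>C(t))\<close> with the part
  of degree \<open>t\<close> of \<open>R/(I\<^sub>1 + I\<^sub>2)\<close>.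
\<close>

section \<open>Graded polynomials\<close>

text \<open>A single statement, \<open>power_mem_if_avoided\<close>, plays the part of the
  Nullstellensatz: an element of the irrelevant ideal has a power in every homogeneous ideal that is
  contained in no point avoiding this element. It is applied to ideals of denominators, generated by
  forms \<open>r\<close> such that multiplication by \<open>r\<close> makes a locally given object
  global; this yields numerators over basic open sets, quasi-compactness, and the annihilation of
  cohomology classes. The obstacle is \<open>H1\<close>, a limit over all covers. As points are
  homogeneous primes and not only closed points, the zero ideal is a point of every nonempty open
  set, and evaluation there replaces sections by their generic germs. Annihilation comes with an
  unknown exponent, so the Koszul argument has to run with powers of the forms, and regular
  sequences must survive both permutation and passage to powers. The resolution of the intersection,
  of ranks 4, 4, 1, is small enough for explicit syzygies; the Koszul complex on four forms is
  treated by induction on the list.\<close>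

lemma mdeg_add [simp]: "mdeg (m + n) = mdeg m + mdeg n"
  by (simp add: mdeg_def lookup_add sum.distrib)

lemma mdeg_zero [simp]: "mdeg 0 = 0"
  by (simp add: mdeg_def)

lemma mdeg_single [simp]: "mdeg (Poly_Mapping.single i n) = n"
  by (simp add: mdeg_def lookup_single when_def)

lemma forms_iff: "f \<in> forms t \<longleftrightarrow> (\<forall>m. Poly_Mapping.lookup f m \<noteq> 0 \<longrightarrow> int (mdeg m) = t)"
  by (auto simp: forms_def in_keys_iff)

lemma forms_zero [simp, intro]: "0 \<in> forms t"
  by (simp add: forms_iff)

lemma forms_add: "f \<in> forms t \<Longrightarrow> g \<in> forms t \<Longrightarrow> f + g \<in> forms t"
  unfolding forms_iff by (metis add.right_neutral lookup_add)

lemma forms_uminus: "f \<in> forms t \<Longrightarrow> - f \<in> forms t"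
  unfolding forms_iff by simp

lemma forms_diff: "f \<in> forms t \<Longrightarrow> g \<in> forms t \<Longrightarrow> f - g \<in> forms t"
  using forms_add[of f t "- g"] forms_uminus[of g t] by simp

lemma forms_sum: "(\<And>i. i \<in> S \<Longrightarrow> f i \<in> forms t) \<Longrightarrow> sum f S \<in> forms t"
  by (induction S rule: infinite_finite_induct) (auto intro: forms_add)

lemma forms_mult: "f \<in> forms s \<Longrightarrow> g \<in> forms t \<Longrightarrow> f * g \<in> forms (s + t)"
  using keys_mult[of f g] by (fastforce simp: forms_def)

lemma forms_one [simp, intro]: "1 \<in> forms 0"
  by (auto simp: forms_iff lookup_one when_def)

lemma forms_power: "f \<in> forms s \<Longrightarrow> f ^ n \<in> forms (int n * s)"
  by (induction n) (auto simp: algebra_simps dest: forms_mult)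

lemma forms_pvar [simp, intro]: "pvar i \<in> forms 1"
  by (auto simp: forms_iff pvar_def lookup_single when_def)

lemma forms_negative: "t < 0 \<Longrightarrow> f \<in> forms t \<Longrightarrow> f = 0"
  by (rule poly_mapping_eqI) (fastforce simp: forms_iff)

lemma lookup_hcomp:
  "Poly_Mapping.lookup (hcomp t f) m = (if int (mdeg m) = t then Poly_Mapping.lookup f m else 0)"
  by (auto simp: hcomp_def lookup_sum lookup_single when_def in_keys_iff)

lemma hcomp_add: "hcomp t (f + g) = hcomp t f + hcomp t g"
  by (rule poly_mapping_eqI) (simp add: lookup_hcomp lookup_add)

lemma hcomp_zero [simp]: "hcomp t 0 = 0"
  by (rule poly_mapping_eqI) (simp add: lookup_hcomp)

lemma hcomp_diff: "hcomp t (f - g) = hcomp t f - hcomp t g"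
  by (rule poly_mapping_eqI) (simp add: lookup_hcomp lookup_minus)

lemma hcomp_sum: "hcomp t (sum f S) = (\<Sum>i\<in>S. hcomp t (f i))"
  by (induction S rule: infinite_finite_induct) (auto simp: hcomp_add)

lemma hcomp_in_forms [simp, intro]: "hcomp t f \<in> forms t"
  by (simp add: forms_iff lookup_hcomp)

lemma hcomp_form: "f \<in> forms s \<Longrightarrow> hcomp t f = (if t = s then f else 0)"
  by (rule poly_mapping_eqI) (auto simp: lookup_hcomp forms_iff)

lemma hcomp_form_same [simp]: "f \<in> forms t \<Longrightarrow> hcomp t f = f"
  by (simp add: hcomp_form)

lemma finite_degrees [simp, intro]: "finite {t. hcomp t f \<noteq> 0}"
proof (rule finite_subset)
  show "{t. hcomp t f \<noteq> 0} \<subseteq> (\<lambda>m. int (mdeg m)) ` Poly_Mapping.keys f"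
  proof
    fix t assume "t \<in> {t. hcomp t f \<noteq> 0}"
    then obtain m where "Poly_Mapping.lookup (hcomp t f) m \<noteq> 0"
      by (metis mem_Collect_eq poly_mapping_eqI lookup_zero)
    then show "t \<in> (\<lambda>m. int (mdeg m)) ` Poly_Mapping.keys f"
      by (auto simp: lookup_hcomp in_keys_iff split: if_splits)
  qed
qed simp

lemma sum_hcomp: "(\<Sum>t | hcomp t f \<noteq> 0. hcomp t f) = f"
proof (rule poly_mapping_eqI)
  fix m
  have "Poly_Mapping.lookup (\<Sum>t | hcomp t f \<noteq> 0. hcomp t f) m =
      (\<Sum>t | hcomp t f \<noteq> 0. if t = int (mdeg m) then Poly_Mapping.lookup f m else 0)"
    unfolding lookup_sum by (rule sum.cong) (auto simp: lookup_hcomp)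
  also have "\<dots> = Poly_Mapping.lookup f m"
  proof (cases "Poly_Mapping.lookup f m = 0")
    case False
    then have "Poly_Mapping.lookup (hcomp (int (mdeg m)) f) m \<noteq> 0"
      by (simp add: lookup_hcomp)
    then have "hcomp (int (mdeg m)) f \<noteq> 0" by auto
    then show ?thesis by (simp add: sum.delta)
  qed simp
  finally show "Poly_Mapping.lookup (\<Sum>t | hcomp t f \<noteq> 0. hcomp t f) m = Poly_Mapping.lookup f m" .
qed

lemma hcomp_eqI: "(\<And>t. hcomp t f = hcomp t g) \<Longrightarrow> f = g"
  by (subst (1 2) sum_hcomp[symmetric]) simp

lemma hcomp_mult_form:
  assumes "f \<in> forms s"
  shows "hcomp t (f * g) = f * hcomp (t - s) g"
proof -
  have "f * g = (\<Sum>e | hcomp e g \<noteq> 0. f * hcomp e g)"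
    by (metis sum_hcomp sum_distrib_left)
  then have "hcomp t (f * g) = (\<Sum>e | hcomp e g \<noteq> 0. hcomp t (f * hcomp e g))"
    by (simp add: hcomp_sum)
  also have "\<dots> = (\<Sum>e | hcomp e g \<noteq> 0. if e = t - s then f * hcomp (t - s) g else 0)"
    by (intro sum.cong) (auto simp: hcomp_form[OF forms_mult[OF assms hcomp_in_forms]])
  also have "\<dots> = f * hcomp (t - s) g"
    by (auto simp: sum.delta)
  finally show ?thesis .
qed

lemma hcomp_mult_form_right:
  "g \<in> forms s \<Longrightarrow> hcomp t (f * g) = hcomp (t - s) f * g"
  by (metis hcomp_mult_form mult.commute)

lemma hcomp_mult: "hcomp t (f * g) = (\<Sum>e | hcomp e f \<noteq> 0. hcomp e f * hcomp (t - e) g)"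
proof -
  have "hcomp t (f * g) = hcomp t (\<Sum>e | hcomp e f \<noteq> 0. hcomp e f * g)"
    by (metis sum_hcomp sum_distrib_right)
  then show ?thesis
    by (simp add: hcomp_sum hcomp_mult_form[OF hcomp_in_forms])
qed

section \<open>Ideals as submodules of the ring, and homogeneous ideals\<close>

interpretation rmod: Modules.module "(*) :: 'a::comm_ring_1 \<Rightarrow> 'a \<Rightarrow> 'a"
  by standard (auto simp: algebra_simps)

declare rmod.scale_scale [simp del] \<comment> \<open>diverges together with associativity\<close>

lemma polyring_simps [simp]:
  "carrier ring_of_type_algebra = UNIV"
  "x \<otimes>\<^bsub>ring_of_type_algebra\<^esub> y = x * y"
  "x \<oplus>\<^bsub>ring_of_type_algebra\<^esub> y = x + y"
  "\<one>\<^bsub>ring_of_type_algebra\<^esub> = 1"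
  "\<zero>\<^bsub>ring_of_type_algebra\<^esub> = 0"
  by (simp_all add: ring_of_type_algebra_def)

lemma a_inv_type_algebra [simp]: "\<ominus>\<^bsub>ring_of_type_algebra\<^esub> (x :: 'a::comm_ring_1) = - x"
proof -
  interpret cring "ring_of_type_algebra :: 'a ring" ..
  show ?thesis
    by (rule minus_equality) auto
qed

lemma ideal_iff_subspace:
  "ideal I (ring_of_type_algebra :: 'a::comm_ring_1 ring) \<longleftrightarrow> rmod.subspace I"
proof
  interpret cring "ring_of_type_algebra :: 'a ring" ..
  assume "ideal I (ring_of_type_algebra :: 'a ring)"
  then interpret ideal I "ring_of_type_algebra :: 'a ring" .
  show "rmod.subspace I"
    using I_l_closed a_closed zero_closed by (auto simp: rmod.subspace_def)
next
  interpret cring "ring_of_type_algebra :: 'a ring" ..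
  assume I: "rmod.subspace I"
  show "ideal I (ring_of_type_algebra :: 'a ring)"
  proof (rule idealI)
    show "subgroup I (add_monoid (ring_of_type_algebra :: 'a ring))"
      using I rmod.subspace_neg[OF I]
      by (auto simp: subgroup_def rmod.subspace_def
          a_inv_type_algebra[unfolded a_inv_def, simplified])
    show "ring (ring_of_type_algebra :: 'a ring)" by (rule ring_axioms)
  qed (use rmod.subspace_scale[OF I] in \<open>simp_all add: mult.commute\<close>)
qed

text \<open>Both sides are the intersection of all ideals containing \<open>S\<close>. From here on
  ideals are spans: the description of \<open>span (insert f S)\<close> by
  \<open>x - k * f \<in> span S\<close> is what the computations with regular sequences rest
  on.\<close>

lemma Idl_eq_span: "Idl\<^bsub>ring_of_type_algebra\<^esub> S = rmod.span (S :: 'a::comm_ring_1 set)"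
  unfolding genideal_def ideal_iff_subspace rmod.span_def hull_def ..

definition homogeneous :: "'k::field poly4 set \<Rightarrow> bool"
  where "homogeneous I \<longleftrightarrow> rmod.subspace I \<and> (\<forall>f\<in>I. \<forall>t. hcomp t f \<in> I)"

lemma homogeneous_ideal_iff: "homogeneous_ideal I \<longleftrightarrow> homogeneous I"
  by (simp add: homogeneous_ideal_def homogeneous_def ideal_iff_subspace)

lemma homogeneous_subspace: "homogeneous I \<Longrightarrow> rmod.subspace I"
  and homogeneous_hcomp: "homogeneous I \<Longrightarrow> f \<in> I \<Longrightarrow> hcomp t f \<in> I"
  by (auto simp: homogeneous_def)

lemma homogeneous_memI:
  assumes "homogeneous I" "\<And>t. hcomp t f \<in> I"
  shows "f \<in> I"
  by (metis sum_hcomp assms homogeneous_subspace rmod.subspace_sum)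

lemma homogeneous_zero: "homogeneous {0}"
  by (simp add: homogeneous_def)

lemma homogeneous_Int: "homogeneous I \<Longrightarrow> homogeneous J \<Longrightarrow> homogeneous (I \<inter> J)"
  by (simp add: homogeneous_def rmod.subspace_inter)

lemma homogeneous_span_insert:
  assumes "homogeneous (rmod.span S)" "f \<in> forms s"
  shows "homogeneous (rmod.span (insert f S))"
  unfolding homogeneous_def
proof (intro conjI ballI allI)
  fix g t assume "g \<in> rmod.span (insert f S)"
  then obtain k where "g - k * f \<in> rmod.span S" by (auto simp: rmod.span_insert)
  then have "hcomp t (g - k * f) \<in> rmod.span S" by (rule homogeneous_hcomp[OF assms(1)])
  then show "hcomp t g \<in> rmod.span (insert f S)"
    by (auto simp: rmod.span_insert hcomp_diff hcomp_mult_form_right[OF assms(2)])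
qed simp

lemma homogeneous_span_forms:
  assumes "\<forall>f\<in>S. \<exists>s. f \<in> forms s"
  shows "homogeneous (rmod.span S)"
  unfolding homogeneous_def
proof (intro conjI ballI allI)
  fix g t assume "g \<in> rmod.span S"
  then show "hcomp t g \<in> rmod.span S"
  proof (induction rule: rmod.span_induct_alt)
    case (step c x y)
    then obtain s where "x \<in> forms s" using assms by blast
    then show ?case
      using step by (simp add: hcomp_add hcomp_mult_form_right
        rmod.span_add rmod.span_scale rmod.span_base)
  qed (simp add: rmod.span_zero)
qed simp

lemma irrelevant_ideal_eq: "irrelevant_ideal = rmod.span (range pvar)"
  by (simp add: irrelevant_ideal_def Idl_eq_span)

lemma irrelevant_subset_iff:
  "rmod.subspace P \<Longrightarrow> irrelevant_ideal \<subseteq> P \<longleftrightarrow> (\<forall>i. pvar i \<in> P)"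
  unfolding irrelevant_ideal_eq
  using rmod.span_minimal[of "range pvar" P] rmod.span_superset[of "range pvar"] by blast

lemma single_in_irrelevant:
  assumes "m \<noteq> 0"
  shows "Poly_Mapping.single m c \<in> irrelevant_ideal"
proof -
  obtain i where i: "Poly_Mapping.lookup m i \<noteq> 0"
    using assms by (metis poly_mapping_eqI lookup_zero)
  then have "m = m - Poly_Mapping.single i 1 + Poly_Mapping.single i 1"
    by (intro poly_mapping_eqI) (auto simp: lookup_add lookup_minus lookup_single when_def)
  then have "Poly_Mapping.single m c = Poly_Mapping.single (m - Poly_Mapping.single i 1) c * pvar i"
    by (simp add: pvar_def mult_single)
  then show ?thesis
    unfolding irrelevant_ideal_eq by (auto intro: rmod.span_scale rmod.span_base)
qed

lemma form_in_irrelevant: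
  assumes "f \<in> forms t" "t > 0"
  shows "f \<in> irrelevant_ideal"
proof -
  have "f = (\<Sum>m\<in>Poly_Mapping.keys f. Poly_Mapping.single m (Poly_Mapping.lookup f m))"
    by (rule poly_mapping_eqI) (auto simp: lookup_sum lookup_single when_def in_keys_iff)
  also have "\<dots> \<in> irrelevant_ideal"
    unfolding irrelevant_ideal_eq
  proof (rule rmod.span_sum)
    fix m assume "m \<in> Poly_Mapping.keys f"
    then have "m \<noteq> 0" using assms by (auto simp: forms_def)
    then show "Poly_Mapping.single m (Poly_Mapping.lookup f m) \<in> rmod.span (range pvar)"
      using single_in_irrelevant irrelevant_ideal_eq by blast
  qed
  finally show ?thesis .
qed

lemma form_degree_zero: "f \<in> forms 0 \<Longrightarrow> f = pconst (Poly_Mapping.lookup f 0)"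
proof (rule poly_mapping_eqI)
  fix m assume "f \<in> forms 0"
  moreover have "mdeg m = 0 \<Longrightarrow> m = 0"
    by (rule poly_mapping_eqI) (auto simp: mdeg_def)
  ultimately show "Poly_Mapping.lookup f m = Poly_Mapping.lookup (pconst (Poly_Mapping.lookup f 0)) m"
    by (auto simp: forms_iff pconst_def lookup_single when_def)
qed

section \<open>Points of projective space\<close>

text \<open>Properness of the prime ideal is carried by the last conjunct, a missing
  variable.\<close>

lemma proj3_iff:
  "P \<in> proj3 \<longleftrightarrow> homogeneous P \<and> (\<forall>a b. a * b \<in> P \<longrightarrow> a \<in> P \<or> b \<in> P) \<and> (\<exists>i. pvar i \<notin> P)"
proof -
  interpret cring "ring_of_type_algebra :: 'a poly4 ring" ..
  show ?thesis
    unfolding proj3_def homogeneous_ideal_iff primeideal_def primeideal_axioms_def ideal_iff_subspace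
    using irrelevant_subset_iff[OF homogeneous_subspace, of P] cring_axioms by (auto simp: homogeneous_def)
qed

lemma proj3_homogeneous: "P \<in> proj3 \<Longrightarrow> homogeneous P"
  and proj3_prime: "P \<in> proj3 \<Longrightarrow> a * b \<in> P \<Longrightarrow> a \<in> P \<or> b \<in> P"
  and proj3_var: "P \<in> proj3 \<Longrightarrow> \<exists>i. pvar i \<notin> P"
  by (auto simp: proj3_iff)

lemma proj3_mult_iff: "P \<in> proj3 \<Longrightarrow> a * b \<in> P \<longleftrightarrow> a \<in> P \<or> b \<in> P"
  using proj3_prime rmod.subspace_scale[OF homogeneous_subspace[OF proj3_homogeneous]]
  by (metis mult.commute)

lemma proj3_zero: "P \<in> proj3 \<Longrightarrow> 0 \<in> P"
  by (simp add: proj3_homogeneous homogeneous_subspace rmod.subspace_0)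

lemma proj3_one: "P \<in> proj3 \<Longrightarrow> 1 \<notin> P"
  by (metis proj3_homogeneous homogeneous_subspace mult.right_neutral proj3_var rmod.subspace_scale)

lemma proj3_power_iff: "P \<in> proj3 \<Longrightarrow> a ^ n \<in> P \<longleftrightarrow> n > 0 \<and> a \<in> P"
  by (induction n) (auto simp: proj3_mult_iff proj3_one)

lemma pvar_nonzero [simp]: "pvar i \<noteq> (0 :: 'a::field poly4)"
proof
  assume "pvar i = (0 :: 'a poly4)"
  then have "Poly_Mapping.lookup (pvar i :: 'a poly4) (Poly_Mapping.single i 1) = 0" by simp
  then show False by (simp add: pvar_def)
qed

text \<open>The generic point of projective space.\<close>

lemma zero_in_proj3: "{0} \<in> proj3"
  by (auto simp: proj3_iff homogeneous_zero)

text \<open>Puts \<open>x * y\<close> into every ideal that contains \<open>x - k * a\<close>,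
  \<open>y - l * b\<close> and \<open>a * b\<close>; in the application \<open>x\<close> and
  \<open>y\<close> are powers of \<open>F\<close>.\<close>

lemma product_of_differences:
  fixes x y a b k l :: "'a::comm_ring_1"
  shows "x * y = y * (x - k * a) + k * a * (y - l * b) + k * l * (a * b)"
  by (simp add: algebra_simps)

text \<open>A homogeneous ideal that is maximal among those avoiding the powers of \<open>F\<close> is prime.\<close>

lemma power_mem_if_avoided:
  assumes J: "homogeneous J" and F: "F \<in> irrelevant_ideal"
    and avoid: "\<And>P. P \<in> proj3 \<Longrightarrow> F \<notin> P \<Longrightarrow> \<not> J \<subseteq> P"
  shows "\<exists>N. F ^ N \<in> J"
proof (rule ccontr)
  assume no: "\<nexists>N. F ^ N \<in> J"
  define \<K> where "\<K> = {K. homogeneous K \<and> J \<subseteq> K \<and> (\<forall>N. F ^ N \<notin> K)}"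
  have "\<exists>M\<in>\<K>. \<forall>L2\<in>\<K>. M \<subseteq> L2 \<longrightarrow> L2 = M"
  proof (rule subset_Zorn_nonempty)
    show "\<K> \<noteq> {}" using no J by (auto simp: \<K>_def)
  next
    fix \<C> assume \<C>: "\<C> \<noteq> {}" "subset.chain \<K> \<C>"
    then have sub: "\<C> \<subseteq> \<K>" and lin: "\<And>L L2. L \<in> \<C> \<Longrightarrow> L2 \<in> \<C> \<Longrightarrow> L \<subseteq> L2 \<or> L2 \<subseteq> L"
      by (auto simp: subset_chain_def)
    have hom: "homogeneous L" if "L \<in> \<C>" for L using sub that by (auto simp: \<K>_def)
    have "rmod.subspace (\<Union>\<C>)"
    proof (rule rmod.subspaceI)
      show "0 \<in> \<Union>\<C>"
        using \<C>(1) hom rmod.subspace_0[OF homogeneous_subspace] by blast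
      show "x + y \<in> \<Union>\<C>" if xy: "x \<in> \<Union>\<C>" "y \<in> \<Union>\<C>" for x y
      proof -
        obtain L where "L \<in> \<C>" "x \<in> L" "y \<in> L" using xy lin by blast
        then show ?thesis using hom rmod.subspace_add[OF homogeneous_subspace] by blast
      qed
      show "c * x \<in> \<Union>\<C>" if "x \<in> \<Union>\<C>" for x c
        using that hom rmod.subspace_scale[OF homogeneous_subspace] by blast
    qed
    then have "homogeneous (\<Union>\<C>)"
      using homogeneous_hcomp[OF hom] by (auto simp: homogeneous_def)
    moreover have "J \<subseteq> \<Union>\<C>" using \<C>(1) sub unfolding \<K>_def by fast
    moreover have "\<forall>N. F ^ N \<notin> \<Union>\<C>"
    proof (intro allI notI)
      fix N assume "F ^ N \<in> \<Union>\<C>"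
      then obtain L where "L \<in> \<C>" "F ^ N \<in> L" by (rule UnionE)
      then show False using sub unfolding \<K>_def by blast
    qed
    ultimately show "\<Union>\<C> \<in> \<K>" unfolding \<K>_def mem_Collect_eq by (intro conjI)
  qed
  then obtain M where MK: "M \<in> \<K>" and maxK: "\<And>L. L \<in> \<K> \<Longrightarrow> M \<subseteq> L \<Longrightarrow> L = M" by metis
  have M: "homogeneous M" "J \<subseteq> M" "\<And>N. F ^ N \<notin> M"
    using MK by (simp_all add: \<K>_def)
  have max: "L = M" if "homogeneous L" "M \<subseteq> L" "\<forall>N. F ^ N \<notin> L" for L
    using maxK[of L] that M(2) by (simp add: \<K>_def)
  note sM = homogeneous_subspace[OF M(1)]
  \<comment> \<open>Adjoining \<open>a\<close> enlarges \<open>M\<close>, so by maximality a power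
    of \<open>F\<close> falls into the larger ideal. That \<open>a\<close> is a form keeps this
    ideal homogeneous.\<close>
  have ext: "\<exists>N k. F ^ N - k * a \<in> M" if a: "a \<in> forms s" "a \<notin> M" for a s
  proof -
    have "homogeneous (rmod.span (insert a M))"
      using M(1) a(1) sM by (intro homogeneous_span_insert) (simp add: rmod.span_eq_iff[THEN iffD2])
    moreover have "M \<subseteq> rmod.span (insert a M)" "a \<in> rmod.span (insert a M)"
      by (auto intro: rmod.span_base)
    ultimately obtain N where "F ^ N \<in> rmod.span (insert a M)"
      using max a(2) by blast
    then show ?thesis using sM by (auto simp: rmod.span_insert rmod.span_eq_iff[THEN iffD2])
  qed
  have prime_forms: "a \<in> M \<or> b \<in> M" if ab: "a \<in> forms s" "b \<in> forms t" "a * b \<in> M" for a b s t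
  proof (rule ccontr)
    assume "\<not> (a \<in> M \<or> b \<in> M)"
    then have "a \<notin> M" "b \<notin> M" by auto
    then obtain m k n l where kl: "F ^ m - k * a \<in> M" "F ^ n - l * b \<in> M"
      using ext[OF ab(1)] ext[OF ab(2)] by blast
    have "F ^ (m + n) = F ^ n * (F ^ m - k * a) + k * a * (F ^ n - l * b) + k * l * (a * b)"
      unfolding power_add by (rule product_of_differences)
    moreover have "\<dots> \<in> M"
      by (intro rmod.subspace_add[OF sM] rmod.subspace_scale[OF sM] kl ab)
    ultimately show False using M(3) by metis
  qed
  \<comment> \<open>For a homogeneous ideal primality may be tested on forms: of the components of
    \<open>a\<close> and of \<open>b\<close> outside \<open>M\<close> take those of highest degree,
    \<open>s\<close> and \<open>t\<close>. In the component of \<open>a * b\<close> of degree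
    \<open>s + t\<close> all other products lie in \<open>M\<close>, hence so does this one.\<close>
  have prime: "a \<in> M \<or> b \<in> M" if ab: "a * b \<in> M" for a b
  proof (rule ccontr)
    assume n: "\<not> (a \<in> M \<or> b \<in> M)"
    have zM: "0 \<in> M" using sM by (rule rmod.subspace_0)
    have fin: "finite {e. hcomp e c \<notin> M}" for c
      by (rule finite_subset[OF _ finite_degrees[of c]]) (use zM in auto)
    have ne: "{e. hcomp e c \<notin> M} \<noteq> {}" if "c \<notin> M" for c
      using homogeneous_memI[OF M(1)] that by blast
    define s where "s = Max {e. hcomp e a \<notin> M}"
    define t where "t = Max {e. hcomp e b \<notin> M}"
    have s: "hcomp s a \<notin> M" "\<And>e. e > s \<Longrightarrow> hcomp e a \<in> M"
      using Max_in[OF fin ne, of a] Max_ge[OF fin, of _ a] n unfolding s_def by fastforce+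
    have t: "hcomp t b \<notin> M" "\<And>e. e > t \<Longrightarrow> hcomp e b \<in> M"
      using Max_in[OF fin ne, of b] Max_ge[OF fin, of _ b] n unfolding t_def by fastforce+
    have s0: "s \<in> {e. hcomp e a \<noteq> 0}" using s(1) zM by auto
    define r where "r = (\<Sum>e\<in>{e. hcomp e a \<noteq> 0} - {s}. hcomp e a * hcomp (s + t - e) b)"
    have "hcomp (s + t) (a * b) \<in> M" using M(1) ab by (rule homogeneous_hcomp)
    moreover have "hcomp (s + t) (a * b) = hcomp s a * hcomp t b + r"
      unfolding hcomp_mult r_def by (subst sum.remove[OF finite_degrees s0]) simp
    moreover have "r \<in> M"
      unfolding r_def
    proof (rule rmod.subspace_sum[OF sM])
      fix e assume "e \<in> {e. hcomp e a \<noteq> 0} - {s}"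
      then consider "e > s" | "s + t - e > t" by force
      then show "hcomp e a * hcomp (s + t - e) b \<in> M"
        by cases (metis s(2) t(2) sM rmod.subspace_scale mult.commute)+
    qed
    ultimately have "hcomp s a * hcomp t b \<in> M"
      using rmod.subspace_diff[OF sM, of "hcomp s a * hcomp t b + r" r] by simp
    then show False using prime_forms[OF hcomp_in_forms hcomp_in_forms] s(1) t(1) by blast
  qed
  have "F \<notin> M" using M(3)[of 1] by simp
  then have "\<not> irrelevant_ideal \<subseteq> M" using F by blast
  then have "M \<in> proj3"
    using M(1) prime irrelevant_subset_iff[OF sM] by (auto simp: proj3_iff)
  then show False using avoid \<open>F \<notin> M\<close> M(2) by blast
qed

section \<open>Regular sequences of forms\<close>

text \<open>For an ideal \<open>J\<close>: \<open>r\<close> is a nonzerodivisor on R/J. The zero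
  ring is not excluded, so that the zeroth power of a generator may occur below.\<close>

definition nzd :: "'a::comm_ring_1 \<Rightarrow> 'a set \<Rightarrow> bool"
  where "nzd r J \<longleftrightarrow> (\<forall>s. r * s \<in> J \<longrightarrow> s \<in> J)"

lemma nzdD: "nzd r J \<Longrightarrow> r * s \<in> J \<Longrightarrow> s \<in> J"
  by (simp add: nzd_def)

lemma nzd_mult: "nzd r J \<Longrightarrow> nzd s J \<Longrightarrow> nzd (r * s) J"
  unfolding nzd_def mult.assoc by blast

lemma nzd_power: "nzd r J \<Longrightarrow> nzd (r ^ n) J"
proof (induction n)
  case (Suc n)
  then show ?case unfolding power_Suc by (intro nzd_mult)
qed (simp add: nzd_def)

lemma nzd_UNIV [simp]: "nzd r UNIV"
  by (simp add: nzd_def)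

lemma mem_span_pair: "x \<in> rmod.span {a, b} \<longleftrightarrow> (\<exists>p q. x = p * a + q * b)"
  by (auto simp: rmod.span_insert algebra_simps eq_diff_eq)

text \<open>Modulo \<open>S\<close> there is an exact sequence 0 -> R/x^n -> R/x^(n+1) -> R/x -> 0
  whose first map is multiplication by \<open>x\<close>. As \<open>y\<close> is a nonzerodivisor on
  both outer terms, it is one on the middle term; the proof is this diagram chase.\<close>

lemma nzd_span_insert_power:
  assumes x: "nzd x (rmod.span S)" and y: "nzd y (rmod.span (insert x S))"
  shows "nzd y (rmod.span (insert (x ^ n) S))"
proof (induction n)
  case 0
  have "rmod.span (insert (x ^ 0) S) = UNIV"
    by (auto simp: rmod.span_insert intro: exI[where x = "_"])
      (metis diff_self rmod.span_zero)
  then show ?case by simp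
next
  case (Suc n)
  show ?case
    unfolding nzd_def
  proof (intro allI impI)
    fix s assume "y * s \<in> rmod.span (insert (x ^ Suc n) S)"
    then obtain u where u: "y * s - u * x ^ Suc n \<in> rmod.span S" by (auto simp: rmod.span_insert)
    then have "y * s - (u * x ^ n) * x \<in> rmod.span S" by (simp add: ac_simps)
    then have "y * s \<in> rmod.span (insert x S)" unfolding rmod.span_insert by blast
    then have "s \<in> rmod.span (insert x S)" by (rule nzdD[OF y])
    then obtain k where k: "s - k * x \<in> rmod.span S" by (auto simp: rmod.span_insert)
    have "x * (y * k - u * x ^ n) = (y * s - u * x ^ Suc n) - y * (s - k * x)"
      by (simp add: algebra_simps)
    then have "x * (y * k - u * x ^ n) \<in> rmod.span S"
      using rmod.span_diff[OF u rmod.span_scale[OF k, of y]] by simp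
    then have "y * k - u * x ^ n \<in> rmod.span S" by (rule nzdD[OF x])
    then have "y * k \<in> rmod.span (insert (x ^ n) S)" unfolding rmod.span_insert by blast
    then have "k \<in> rmod.span (insert (x ^ n) S)" by (rule nzdD[OF Suc])
    then obtain l where l: "k - l * x ^ n \<in> rmod.span S" by (auto simp: rmod.span_insert)
    have "s - l * x ^ Suc n = (s - k * x) + x * (k - l * x ^ n)" by (simp add: algebra_simps)
    then have "s - l * x ^ Suc n \<in> rmod.span S"
      using k l by (simp only: rmod.span_add rmod.span_scale)
    then show "s \<in> rmod.span (insert (x ^ Suc n) S)"
      unfolding rmod.span_insert by blast
  qed
qed

text \<open>A relation \<open>x * s = u * y\<close> modulo \<open>S\<close> is trivial: as
  \<open>y\<close> is a nonzerodivisor modulo \<open>x\<close>, \<open>u\<close> is a multiple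
  \<open>k * x\<close>, and cancelling \<open>x\<close> leaves \<open>s = k * y\<close>. This is one
  half of the exchange of neighbours in a regular sequence; \<open>nzd_drop\<close> is the half that
  rests on the grading.\<close>

lemma nzd_swap:
  assumes x: "nzd x (rmod.span S)" and y: "nzd y (rmod.span (insert x S))"
  shows "nzd x (rmod.span (insert y S))"
  unfolding nzd_def
proof (intro allI impI)
  fix s assume "x * s \<in> rmod.span (insert y S)"
  then obtain u where u: "x * s - u * y \<in> rmod.span S" by (auto simp: rmod.span_insert)
  then have "- (x * s - u * y) \<in> rmod.span S" by (rule rmod.span_neg)
  then have "y * u - s * x \<in> rmod.span S" by (simp add: ac_simps)
  then have "y * u \<in> rmod.span (insert x S)" by (auto simp: rmod.span_insert)
  then have "u \<in> rmod.span (insert x S)" by (rule nzdD[OF y])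
  then obtain k where k: "u - k * x \<in> rmod.span S" by (auto simp: rmod.span_insert)
  have "x * (s - k * y) = (x * s - u * y) + y * (u - k * x)" by (simp add: algebra_simps)
  then have "x * (s - k * y) \<in> rmod.span S"
    using rmod.span_add[OF u rmod.span_scale[OF k, of y]] by simp
  then have "s - k * y \<in> rmod.span S" by (rule nzdD[OF x])
  then show "s \<in> rmod.span (insert y S)" by (auto simp: rmod.span_insert)
qed

text \<open>
  The ideal \<open>K = {s. y * s \<in> J}\<close> satisfies \<open>K \<subseteq> J + x K\<close>, so \<open>K \<subseteq> J\<close> by the graded Nakayama lemma,
  that is, by induction on the degree.
\<close>

lemma nzd_drop:
  assumes hS: "homogeneous (rmod.span S)" and xd: "x \<in> forms d" "d > 0" and yd: "y \<in> forms e"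
    and x: "nzd x (rmod.span S)" and y: "nzd y (rmod.span (insert x S))"
  shows "nzd y (rmod.span S)"
proof -
  have key: "s \<in> rmod.span S" if "s \<in> forms (int n)" "y * s \<in> rmod.span S" for s n
    using that
  proof (induction n arbitrary: s rule: less_induct)
    case (less n)
    have "rmod.span S \<subseteq> rmod.span (insert x S)" by (rule rmod.span_mono) auto
    then have "s \<in> rmod.span (insert x S)" using less.prems(2) nzdD[OF y] by blast
    then obtain k0 where "s - k0 * x \<in> rmod.span S" by (auto simp: rmod.span_insert)
    \<comment> \<open>Passing to the component of degree \<open>n\<close> makes the cofactor a form
      of degree \<open>n - d\<close>, which is smaller as \<open>d > 0\<close>; the induction
      hypothesis then applies to it.\<close>
    then have "hcomp (int n) (s - k0 * x) \<in> rmod.span S" by (rule homogeneous_hcomp[OF hS])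
    then obtain k where k: "k \<in> forms (int n - d)" "s - k * x \<in> rmod.span S"
      using less.prems(1) by (auto simp: hcomp_diff hcomp_mult_form_right[OF xd(1)])
    have "x * (y * k) = y * s - y * (s - k * x)" by (simp add: algebra_simps)
    then have "x * (y * k) \<in> rmod.span S"
      using rmod.span_diff[OF less.prems(2) rmod.span_scale[OF k(2), of y]] by simp
    then have yk: "y * k \<in> rmod.span S" by (rule nzdD[OF x])
    have "k \<in> rmod.span S"
    proof (cases "int n - d < 0")
      case True
      then show ?thesis using forms_negative k(1) rmod.span_zero by blast
    next
      case False
      then show ?thesis using less.IH[of "nat (int n - d)" k] k(1) yk xd(2) by auto
    qed
    then show ?case
      using rmod.span_add[OF k(2) rmod.span_scale[of k S x]] by (simp add: mult.commute)
  qed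
  show ?thesis
    unfolding nzd_def
  proof (intro allI impI)
    fix s assume s: "y * s \<in> rmod.span S"
    show "s \<in> rmod.span S"
    proof (rule homogeneous_memI[OF hS])
      fix t
      have "hcomp (t + e) (y * s) \<in> rmod.span S" by (rule homogeneous_hcomp[OF hS s])
      then have "y * hcomp t s \<in> rmod.span S" by (simp add: hcomp_mult_form[OF yd])
      then show "hcomp t s \<in> rmod.span S"
        using key[of "hcomp t s" "nat t"] forms_negative[of t "hcomp t s"] rmod.span_zero
        by (cases "t < 0") auto
    qed
  qed
qed

text \<open>Exactness of the Koszul complex of \<open>x\<close>, \<open>y\<close> modulo
  \<open>S\<close> in the middle: up to \<open>S\<close>, the pair \<open>(a, b)\<close> is the
  multiple by \<open>c\<close> of the trivial syzygy \<open>(- y, x)\<close>.\<close>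

lemma syzygy:
  assumes x: "nzd x (rmod.span S)" and y: "nzd y (rmod.span (insert x S))"
    and ab: "x * a + y * b \<in> rmod.span S"
  obtains c where "b - x * c \<in> rmod.span S" "a + y * c \<in> rmod.span S"
proof -
  have "y * b - (- a) * x \<in> rmod.span S" using ab by (simp add: algebra_simps)
  then have "y * b \<in> rmod.span (insert x S)" unfolding rmod.span_insert by blast
  then have "b \<in> rmod.span (insert x S)" by (rule nzdD[OF y])
  then obtain c where c: "b - x * c \<in> rmod.span S" by (auto simp: rmod.span_insert mult.commute)
  have "x * (a + y * c) = (x * a + y * b) - y * (b - x * c)" by (simp add: algebra_simps)
  then have "x * (a + y * c) \<in> rmod.span S"
    using rmod.span_diff[OF ab rmod.span_scale[OF c, of y]] by simp
  then have "a + y * c \<in> rmod.span S" by (rule nzdD[OF x])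
  with c show thesis by (rule that)
qed

text \<open>A locale, so that every reordering of the sequence is a further interpretation of
  it.\<close>

locale regular_forms =
  fixes F1 F2 F3 F4 :: "'k::field poly4" and d :: nat
  assumes F_forms: "F1 \<in> forms (int d)" "F2 \<in> forms (int d)" "F3 \<in> forms (int d)" "F4 \<in> forms (int d)"
    and proper: "rmod.span {F1, F2, F3, F4} \<noteq> UNIV"
    and reg1: "nzd F1 (rmod.span {})" and reg2: "nzd F2 (rmod.span {F1})"
    and reg3: "nzd F3 (rmod.span {F1, F2})" and reg4: "nzd F4 (rmod.span {F1, F2, F3})"
begin

lemma F1_nonzero: "F1 \<noteq> 0"
  using nzdD[OF reg1, of 1] by auto

text \<open>In degree 0 the nonzero form \<open>F1\<close> would be a unit and the ideal not
  proper.\<close>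

lemma d_pos: "d > 0"
proof (rule ccontr)
  assume "\<not> d > 0"
  then have "F1 \<in> forms 0" using F_forms by simp
  then obtain c where c: "F1 = pconst c" using form_degree_zero by blast
  then have "c \<noteq> 0" using F1_nonzero by (auto simp: pconst_def)
  then have "pconst (inverse c) * F1 = 1" by (simp add: c pconst_def mult_single)
  moreover have "pconst (inverse c) * F1 \<in> rmod.span {F1, F2, F3, F4}"
    by (intro rmod.span_scale rmod.span_base) simp
  ultimately have "\<And>x. x * 1 \<in> rmod.span {F1, F2, F3, F4}"
    using rmod.span_scale by metis
  then show False using proper by auto
qed

text \<open>Adjacent transpositions generate all permutations. In each of the three,
  \<open>nzd_drop\<close> handles the element that moves forward, which is where
  \<open>d_pos\<close> enters, and \<open>nzd_swap\<close> the one that moves back.\<close>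

lemma regular_forms_swap12: "regular_forms F2 F1 F3 F4 d"
proof
  show "nzd F2 (rmod.span {})"
    using nzd_drop[OF _ F_forms(1) _ F_forms(2) reg1 reg2] d_pos homogeneous_zero by simp
  show "nzd F1 (rmod.span {F2})" using nzd_swap[OF reg1 reg2] .
qed (use F_forms proper reg3 reg4 in \<open>simp_all add: insert_commute\<close>)

lemma homogeneous_spans:
  "homogeneous (rmod.span {F1})" "homogeneous (rmod.span {F1, F2})"
  "homogeneous (rmod.span {F3, F4})" "homogeneous (rmod.span {F1, F2, F3, F4})"
  using F_forms by (auto intro!: homogeneous_span_forms)

lemma regular_forms_swap23: "regular_forms F1 F3 F2 F4 d"
proof
  have r3: "nzd F3 (rmod.span {F2, F1})" using reg3 by (simp add: insert_commute)
  show "nzd F3 (rmod.span {F1})"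
    using nzd_drop[OF _ F_forms(2) _ F_forms(3) reg2 r3] d_pos homogeneous_spans by simp
  show "nzd F2 (rmod.span {F1, F3})" using nzd_swap[OF reg2 r3] by (simp add: insert_commute)
qed (use F_forms proper reg1 reg4 in \<open>simp_all add: insert_commute\<close>)

lemma regular_forms_swap34: "regular_forms F1 F2 F4 F3 d"
proof
  have r4: "nzd F4 (rmod.span {F3, F1, F2})" using reg4 by (simp add: insert_commute)
  show "nzd F4 (rmod.span {F1, F2})"
    using nzd_drop[OF _ F_forms(3) _ F_forms(4) reg3 r4] d_pos homogeneous_spans by simp
  show "nzd F3 (rmod.span {F1, F2, F4})" using nzd_swap[OF reg3 r4] by (simp add: insert_commute)
qed (use F_forms proper reg1 reg2 in \<open>simp_all add: insert_commute\<close>)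

text \<open>The product of the transpositions 23, 12, 34, 23. It transfers every statement about the
  first curve to the second.\<close>

lemma regular_forms_exchange: "regular_forms F3 F4 F1 F2 d"
  using regular_forms_swap23 regular_forms.regular_forms_swap12 regular_forms.regular_forms_swap34
    regular_forms.regular_forms_swap23 by blast

end

lemma regular_forms_iff_regular_sequence:
  fixes F1 F2 F3 F4 :: "'k::field poly4"
  shows "regular_forms F1 F2 F3 F4 d \<longleftrightarrow>
    {F1, F2, F3, F4} \<subseteq> forms (int d) \<and> regular_sequence polyring [F1, F2, F3, F4]"
  unfolding regular_forms_def regular_sequence_def nzd_def Idl_eq_span
  by (auto simp: All_less_Suc numeral_eq_Suc insert_commute mult.commute)

section \<open>Intersection, product and saturation of the two ideals\<close>

context regular_forms begin

lemma regular_pair: "regular_sequence polyring [F1, F2]"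
proof -
  have "rmod.span {F1, F2} \<subseteq> rmod.span {F1, F2, F3, F4}" by (rule rmod.span_mono) auto
  then show ?thesis
    using proper reg1 reg2 unfolding regular_sequence_def nzd_def Idl_eq_span
    by (auto simp: All_less_Suc numeral_eq_Suc mult.commute)
qed

lemma F_irrelevant:
  "F1 \<in> irrelevant_ideal" "F2 \<in> irrelevant_ideal" "F3 \<in> irrelevant_ideal" "F4 \<in> irrelevant_ideal"
  using F_forms d_pos by (auto intro: form_in_irrelevant)

text \<open>The vanishing of Tor_1(R/I_1, R/I_2) in elementary form. If
  \<open>F1 * a + F2 * b\<close> lies in the second ideal, then \<open>(a, b)\<close> is a syzygy of
  \<open>F1\<close>, \<open>F2\<close> modulo that ideal, hence a multiple of the trivial one up to
  elements of the ideal. The trivial syzygy drops out of the sum, and what remains are coefficients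
  in \<open>span {F3, F4}\<close>.\<close>

lemma inter_eq_products:
  "rmod.span {F1, F2} \<inter> rmod.span {F3, F4} = rmod.span {F1 * F3, F1 * F4, F2 * F3, F2 * F4}"
proof
  show "rmod.span {F1 * F3, F1 * F4, F2 * F3, F2 * F4} \<subseteq> rmod.span {F1, F2} \<inter> rmod.span {F3, F4}"
  proof (rule rmod.span_minimal)
    show "{F1 * F3, F1 * F4, F2 * F3, F2 * F4} \<subseteq> rmod.span {F1, F2} \<inter> rmod.span {F3, F4}"
      using rmod.span_scale[OF rmod.span_base, of F1 "{F1, F2}" F3]
        rmod.span_scale[OF rmod.span_base, of F2 "{F1, F2}" F3]
        rmod.span_scale[OF rmod.span_base, of F1 "{F1, F2}" F4]
        rmod.span_scale[OF rmod.span_base, of F2 "{F1, F2}" F4]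
      by (auto simp: mult.commute[of F3] mult.commute[of F4] intro: rmod.span_scale rmod.span_base)
  qed (simp add: rmod.subspace_inter)
next
  interpret x: regular_forms F3 F4 F1 F2 d by (rule regular_forms_exchange)
  let ?P = "rmod.span {F1 * F3, F1 * F4, F2 * F3, F2 * F4}"
  show "rmod.span {F1, F2} \<inter> rmod.span {F3, F4} \<subseteq> ?P"
  proof
    fix f assume "f \<in> rmod.span {F1, F2} \<inter> rmod.span {F3, F4}"
    then obtain a b where f: "f = F1 * a + F2 * b" "F1 * a + F2 * b \<in> rmod.span {F3, F4}"
      by (auto simp: mem_span_pair mult.commute)
    have r2: "nzd F2 (rmod.span {F1, F3, F4})" using x.reg4 by (simp add: insert_commute)
    obtain c where "b - F1 * c \<in> rmod.span {F3, F4}" "a + F2 * c \<in> rmod.span {F3, F4}"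
      by (rule syzygy[OF x.reg3 r2 f(2)])
    then obtain p q r s where pq: "b - F1 * c = p * F3 + q * F4" "a + F2 * c = r * F3 + s * F4"
      by (auto simp: mem_span_pair)
    have "f = F1 * (a + F2 * c) + F2 * (b - F1 * c)" by (simp add: f algebra_simps)
    also have "\<dots> = r * (F1 * F3) + s * (F1 * F4) + p * (F2 * F3) + q * (F2 * F4)"
      by (simp add: pq algebra_simps)
    finally show "f \<in> ?P"
      by (simp only:) (intro rmod.span_add; rule rmod.span_scale, rule rmod.span_base, simp)
  qed
qed

lemma inter_eq_ideal_prod:
  "rmod.span {F1, F2} \<inter> rmod.span {F3, F4} = rmod.span {F1, F2} \<cdot>\<^bsub>polyring\<^esub> rmod.span {F3, F4}"
proof -
  interpret cring "ring_of_type_algebra :: 'k poly4 ring" ..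
  have I: "ideal (rmod.span {F1, F2}) polyring" "ideal (rmod.span {F3, F4}) polyring"
    by (simp_all add: ideal_iff_subspace)
  have "rmod.span {F1 * F3, F1 * F4, F2 * F3, F2 * F4} \<subseteq> rmod.span {F1, F2} \<cdot>\<^bsub>polyring\<^esub> rmod.span {F3, F4}"
  proof (rule rmod.span_minimal)
    show "rmod.subspace (rmod.span {F1, F2} \<cdot>\<^bsub>polyring\<^esub> rmod.span {F3, F4})"
      using ideal_prod_is_ideal[OF I] by (simp add: ideal_iff_subspace)
    have "f * g \<in> rmod.span {F1, F2} \<cdot>\<^bsub>polyring\<^esub> rmod.span {F3, F4}"
      if "f \<in> {F1, F2}" "g \<in> {F3, F4}" for f g
      using ideal_prod.prod[OF rmod.span_base[OF that(1)] rmod.span_base[OF that(2)], of polyring] by simp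
    then show "{F1 * F3, F1 * F4, F2 * F3, F2 * F4} \<subseteq> rmod.span {F1, F2} \<cdot>\<^bsub>polyring\<^esub> rmod.span {F3, F4}"
      by simp
  qed
  moreover have "rmod.span {F1, F2} \<cdot>\<^bsub>polyring\<^esub> rmod.span {F3, F4} \<subseteq> rmod.span {F1, F2} \<inter> rmod.span {F3, F4}"
    using ideal_prod_inter[OF I] .
  ultimately show ?thesis unfolding inter_eq_products by auto
qed

lemma mem_of_power_mult:
  assumes "F3 ^ n * f \<in> rmod.span {F1, F2}"
  shows "f \<in> rmod.span {F1, F2}"
  using nzdD[OF nzd_power[OF reg3] assms] .

end

lemma power_in_ideal_power:
  assumes "f \<in> J"
  shows "f ^ n \<in> ideal_power polyring J n"
proof (induction n)
  case (Suc n)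
  then show ?case
    using ideal_prod.prod[OF assms Suc, of polyring] by (simp add: ideal_power_def)
qed (simp add: ideal_power_def)

context regular_forms begin

text \<open>\<open>F3\<close> lies in the irrelevant ideal and is a nonzerodivisor modulo the first
  ideal, so whatever a power of the irrelevant ideal multiplies into the first ideal already lies in
  it; \<open>F1\<close> does the same for the second.\<close>

lemma saturated_intersection: "saturated (rmod.span {F1, F2} \<inter> rmod.span {F3, F4})"
  unfolding saturated_def
proof
  interpret x: regular_forms F3 F4 F1 F2 d by (rule regular_forms_exchange)
  show "saturation (rmod.span {F1, F2} \<inter> rmod.span {F3, F4}) \<subseteq> rmod.span {F1, F2} \<inter> rmod.span {F3, F4}"
    unfolding saturation_def
    using mem_of_power_mult x.mem_of_power_mult power_in_ideal_power F_irrelevant by blast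
  show "rmod.span {F1, F2} \<inter> rmod.span {F3, F4} \<subseteq> saturation (rmod.span {F1, F2} \<inter> rmod.span {F3, F4})"
    unfolding saturation_def by (auto intro!: exI[of _ 0] rmod.span_scale)
qed

end

section \<open>Exactness of Koszul complexes\<close>

text \<open>The differential of a cochain that need not be homogeneous or supported on subsets of the index set.\<close>

definition koszul_diff :: "'a::comm_ring_1 list \<Rightarrow> (nat set \<Rightarrow> 'a) \<Rightarrow> nat set \<Rightarrow> 'a"
  where "koszul_diff fs v T =
    (\<Sum>i | i < length fs \<and> i \<notin> T. (- 1) ^ card {j \<in> T. j < i} * fs ! i * v (insert i T))"

text \<open>Only sets with one element more than \<open>T\<close> enter, so that cochains may be
  altered freely in all other degrees.\<close>

lemma koszul_diff_cong:
  assumes "T \<subseteq> {..<length fs}"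
    and "\<And>S. S \<subseteq> {..<length fs} \<Longrightarrow> card S = Suc (card T) \<Longrightarrow> u S = v S"
  shows "koszul_diff fs u T = koszul_diff fs v T"
  unfolding koszul_diff_def
proof (rule sum.cong)
  fix i assume i: "i \<in> {i. i < length fs \<and> i \<notin> T}"
  have "finite T" using assms(1) finite_subset by blast
  then have "u (insert i T) = v (insert i T)" using i assms by (intro assms(2)) auto
  then show "(- 1) ^ card {j \<in> T. j < i} * fs ! i * u (insert i T) =
    (- 1) ^ card {j \<in> T. j < i} * fs ! i * v (insert i T)" by simp
qed simp

lemma koszul_diff_add: "koszul_diff fs (\<lambda>S. u S + v S) T = koszul_diff fs u T + koszul_diff fs v T"
  by (simp add: koszul_diff_def sum.distrib distrib_left)

lemma koszul_diff_scale: "koszul_diff fs (\<lambda>S. c * v S) T = c * koszul_diff fs v T"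
  by (simp add: koszul_diff_def sum_distrib_left ac_simps)

lemma koszul_diff_zero [simp]: "koszul_diff fs (\<lambda>S. 0) T = 0"
  by (simp add: koszul_diff_def)

text \<open>Together with \<open>koszul_diff_snoc_insert\<close> this says that the Koszul complex
  of \<open>fs @ [f]\<close> is the mapping cone of multiplication by \<open>f\<close> on that of
  \<open>fs\<close>: a cochain splits into its values on sets without and with the new index. The
  new index exceeds all others, whence the sign \<open>(- 1) ^ card T\<close> here and unchanged
  signs there.\<close>

lemma koszul_diff_snoc:
  assumes T: "T \<subseteq> {..<length fs}"
  shows "koszul_diff (fs @ [f]) v T =
    koszul_diff fs v T + (- 1) ^ card T * f * v (insert (length fs) T)"
proof -
  have "{i. i < length (fs @ [f]) \<and> i \<notin> T} = insert (length fs) {i. i < length fs \<and> i \<notin> T}"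
    using T by auto
  moreover have "{j \<in> T. j < length fs} = T" using T by auto
  ultimately show ?thesis
    unfolding koszul_diff_def by (simp add: nth_append)
qed

lemma koszul_diff_snoc_insert:
  assumes T: "T \<subseteq> {..<length fs}"
  shows "koszul_diff (fs @ [f]) v (insert (length fs) T) =
    koszul_diff fs (\<lambda>S. v (insert (length fs) S)) T"
  unfolding koszul_diff_def
proof (rule sum.cong)
  show "{i. i < length (fs @ [f]) \<and> i \<notin> insert (length fs) T} = {i. i < length fs \<and> i \<notin> T}"
    by auto
next
  fix i assume i: "i \<in> {i. i < length fs \<and> i \<notin> T}"
  then have "{j \<in> insert (length fs) T. j < i} = {j \<in> T. j < i}" by auto
  then show "(- 1) ^ card {j \<in> insert (length fs) T. j < i} * (fs @ [f]) ! i * v (insert i (insert (length fs) T)) =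
    (- 1) ^ card {j \<in> T. j < i} * fs ! i * v (insert (length fs) (insert i T))"
    using i by (simp add: nth_append insert_commute)
qed

lemma subset_lessThan_Suc_cases:
  assumes "T \<subseteq> {..<Suc n}"
  obtains "T \<subseteq> {..<n}" | T' where "T' \<subseteq> {..<n}" "T = insert n T'" "card T = Suc (card T')"
proof (cases "n \<in> T")
  case True
  have "finite T" using assms finite_subset by blast
  then have "T - {n} \<subseteq> {..<n}" "T = insert n (T - {n})" "card T = Suc (card (T - {n}))"
    using True assms card_Suc_Diff1[of T n] by (auto simp: lessThan_Suc)
  then show ?thesis by (rule that(2))
next
  case False
  then show ?thesis using that(1) assms by (auto simp: lessThan_Suc)
qed

text \<open>In the cone the two mixed terms carry the signs of \<open>card T\<close> and of
  \<open>card T + 1\<close>, and cancel.\<close>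

lemma koszul_diff_square: "T \<subseteq> {..<length fs} \<Longrightarrow> koszul_diff fs (koszul_diff fs v) T = 0"
proof (induction fs arbitrary: T v rule: rev_induct)
  case Nil
  then show ?case by (simp add: koszul_diff_def)
next
  case (snoc f fs)
  let ?n = "length fs"
  from snoc.prems have "T \<subseteq> {..<Suc ?n}" by simp
  then show ?case
  proof (cases rule: subset_lessThan_Suc_cases)
    case 1
    let ?w = "koszul_diff fs (\<lambda>S. v (insert ?n S)) T"
    have "koszul_diff fs (koszul_diff (fs @ [f]) v) T =
        koszul_diff fs (\<lambda>S. koszul_diff fs v S + (- 1) ^ Suc (card T) * f * v (insert ?n S)) T"
      by (rule koszul_diff_cong) (use 1 in \<open>auto simp: koszul_diff_snoc\<close>)
    also have "\<dots> = (- 1) ^ Suc (card T) * f * ?w"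
      using snoc.IH[OF 1] by (simp add: koszul_diff_add koszul_diff_scale del: power_Suc)
    finally show ?thesis
      by (simp add: koszul_diff_snoc[OF 1] koszul_diff_snoc_insert[OF 1])
  next
    case (2 T')
    have "koszul_diff fs (\<lambda>S. koszul_diff (fs @ [f]) v (insert ?n S)) T' =
        koszul_diff fs (koszul_diff fs (\<lambda>S. v (insert ?n S))) T'"
      by (rule koszul_diff_cong) (use 2 in \<open>auto simp: koszul_diff_snoc_insert\<close>)
    then show ?thesis
      using snoc.IH[OF 2(1)] by (simp add: 2(2) koszul_diff_snoc_insert[OF 2(1)])
  qed
qed

lemma koszul_diff_empty_range:
  "x \<in> rmod.span (set fs) \<longleftrightarrow> (\<exists>w. koszul_diff fs w {} = x)"
proof (induction fs arbitrary: x rule: rev_induct)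
  case Nil
  then show ?case by (auto simp: koszul_diff_def)
next
  case (snoc f fs)
  let ?n = "length fs"
  have "x \<in> rmod.span (set (fs @ [f])) \<longleftrightarrow> (\<exists>k w. koszul_diff fs w {} = x - k * f)"
    using snoc.IH by (simp add: rmod.span_insert)
  also have "\<dots> \<longleftrightarrow> (\<exists>w. koszul_diff (fs @ [f]) w {} = x)"
  proof safe
    fix k w assume w: "koszul_diff fs w {} = x - k * f"
    have "koszul_diff fs (w({?n} := k)) {} = koszul_diff fs w {}"
      by (rule koszul_diff_cong) auto
    then have "koszul_diff (fs @ [f]) (w({?n} := k)) {} = x"
      by (simp add: koszul_diff_snoc w mult.commute)
    then show "\<exists>w. koszul_diff (fs @ [f]) w {} = x" by blast
  next
    fix w
    have "koszul_diff fs w {} = koszul_diff (fs @ [f]) w {} - w {?n} * f"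
      by (simp add: koszul_diff_snoc mult.commute)
    then show "\<exists>k u. koszul_diff fs u {} = koszul_diff (fs @ [f]) w {} - k * f" by blast
  qed
  finally show ?case .
qed

text \<open>The long exact sequence of the cone, made explicit: the part \<open>v1\<close> of
  \<open>v\<close> on sets with the new index is a cycle for \<open>fs\<close> and bounds some
  \<open>w1\<close>; corrected by the multiple \<open>f * w1\<close>, the other part becomes a cycle
  for \<open>fs\<close> as well and bounds some \<open>w0\<close>.\<close>

lemma koszul_diff_exact:
  assumes "\<forall>i<length fs. nzd (fs ! i) (rmod.span (set (take i fs)))"
    and "\<And>T. T \<subseteq> {..<length fs} \<Longrightarrow> card T = p \<Longrightarrow> koszul_diff fs v T = 0"
  shows "\<exists>w. \<forall>T. T \<subseteq> {..<length fs} \<longrightarrow> card T = Suc p \<longrightarrow> koszul_diff fs w T = v T"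
  using assms
proof (induction fs arbitrary: p v rule: rev_induct)
  case Nil
  then show ?case by simp
next
  case (snoc f fs)
  let ?n = "length fs"
  have reg: "\<forall>i<length fs. nzd (fs ! i) (rmod.span (set (take i fs)))"
  proof (intro allI impI)
    fix i assume "i < ?n"
    then show "nzd (fs ! i) (rmod.span (set (take i fs)))"
      using snoc.prems(1)[rule_format, of i] by (simp add: nth_append)
  qed
  have f: "nzd f (rmod.span (set fs))" using snoc.prems(1)[rule_format, of ?n] by simp
  define v1 where "v1 = (\<lambda>S. v (insert ?n S))"
  have low: "koszul_diff fs v T + (- 1) ^ p * f * v1 T = 0" if "T \<subseteq> {..<?n}" "card T = p" for T
    using snoc.prems(2)[of T] that koszul_diff_snoc[OF that(1), of f v] by (auto simp: v1_def lessThan_Suc)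
  have high: "koszul_diff fs v1 T = 0" if "T \<subseteq> {..<?n}" "Suc (card T) = p" for T
  proof -
    have "finite T" "?n \<notin> T" using that(1) finite_subset by auto
    then have "koszul_diff (fs @ [f]) v (insert ?n T) = 0"
      using that by (intro snoc.prems(2)) (auto simp: lessThan_Suc)
    then show ?thesis by (simp add: v1_def koszul_diff_snoc_insert[OF that(1)])
  qed
  have "\<exists>w1. \<forall>T. T \<subseteq> {..<?n} \<longrightarrow> card T = p \<longrightarrow> koszul_diff fs w1 T = v1 T"
  proof (cases p)
    case 0
    \<comment> \<open>In the bottom degree \<open>v1\<close> is a single ring element that
      \<open>f\<close> multiplies into the ideal of \<open>fs\<close>; it is here that
      \<open>f\<close> must be a nonzerodivisor.\<close>
    have "f * (- v1 {}) = koszul_diff fs v {}"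
      using low[of "{}"] 0 by (simp add: neg_eq_iff_add_eq_0 add.commute)
    then have "f * (- v1 {}) \<in> rmod.span (set fs)" unfolding koszul_diff_empty_range by metis
    then have "- v1 {} \<in> rmod.span (set fs)" by (rule nzdD[OF f])
    then have "v1 {} \<in> rmod.span (set fs)" using rmod.span_neg by fastforce
    then obtain w1 where "koszul_diff fs w1 {} = v1 {}" unfolding koszul_diff_empty_range by blast
    then have "\<forall>T. T \<subseteq> {..<?n} \<longrightarrow> card T = p \<longrightarrow> koszul_diff fs w1 T = v1 T"
      using 0 finite_subset[of _ "{..<?n}"] by auto
    then show ?thesis by blast
  next
    case (Suc q)
    then show ?thesis using snoc.IH[OF reg, of q v1] high by simp
  qed
  then obtain w1 where w1: "\<And>T. T \<subseteq> {..<?n} \<Longrightarrow> card T = p \<Longrightarrow> koszul_diff fs w1 T = v1 T"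
    by blast
  have "koszul_diff fs (\<lambda>S. v S + (- 1) ^ p * f * w1 S) T = 0" if "T \<subseteq> {..<?n}" "card T = p" for T
    using low[OF that] w1[OF that] by (simp add: koszul_diff_add koszul_diff_scale)
  from snoc.IH[OF reg this] obtain w0 where w0: "\<And>T. T \<subseteq> {..<?n} \<Longrightarrow> card T = Suc p \<Longrightarrow>
      koszul_diff fs w0 T = v T + (- 1) ^ p * f * w1 T"
    by blast
  \<comment> \<open>The two primitives are glued along the splitting by the new index.\<close>
  define w where "w = (\<lambda>S. if ?n \<in> S then w1 (S - {?n}) else w0 S)"
  have w_low: "koszul_diff fs w T = koszul_diff fs w0 T" if "T \<subseteq> {..<?n}" for T
    using that by (intro koszul_diff_cong) (auto simp: w_def)
  have w_high: "koszul_diff fs (\<lambda>S. w (insert ?n S)) T = koszul_diff fs w1 T" if "T \<subseteq> {..<?n}" for T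
    using that
  proof (rule koszul_diff_cong)
    fix S assume "S \<subseteq> {..<?n}"
    then have "insert ?n S - {?n} = S" by auto
    then show "w (insert ?n S) = w1 S" by (simp add: w_def)
  qed
  have "koszul_diff (fs @ [f]) w T = v T" if T: "T \<subseteq> {..<length (fs @ [f])}" "card T = Suc p" for T
  proof -
    from T(1) have "T \<subseteq> {..<Suc ?n}" by simp
    then show ?thesis
    proof (cases rule: subset_lessThan_Suc_cases)
      case 1
      then have "insert ?n T - {?n} = T" by auto
      then have "w (insert ?n T) = w1 T" by (simp add: w_def)
      then show ?thesis
        using w0[OF 1 T(2)] by (simp add: koszul_diff_snoc[OF 1] w_low[OF 1] T(2))
    next
      case (2 T')
      then show ?thesis
        using w1[OF 2(1)] T(2) by (simp add: koszul_diff_snoc_insert[OF 2(1)] w_high[OF 2(1)] v1_def)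
    qed
  qed
  then show ?case by blast
qed

text \<open>The complex sums over the sets from which an index is removed,
  \<open>koszul_diff\<close> over the indices inserted into \<open>T\<close>; exchanging the two
  sums passes from one to the other.\<close>

lemma differential_koszul_complex:
  "differential (koszul_complex d fs) v =
    (\<lambda>T. if T \<subseteq> {..<length fs} then koszul_diff fs v T else 0)"
proof
  fix T
  let ?N = "{..<length fs}"
  show "differential (koszul_complex d fs) v T = (if T \<subseteq> ?N then koszul_diff fs v T else 0)"
  proof (cases "T \<subseteq> ?N")
    case True
    have term_eq: "(\<Sum>S\<in>Pow ?N. if i \<in> S \<and> T = S - {i} then v S * ((- 1) ^ card {j \<in> S. j < i} * fs ! i) else 0) =
        (if i \<notin> T then (- 1) ^ card {j \<in> T. j < i} * fs ! i * v (insert i T) else 0)" if "i \<in> ?N" for i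
    proof -
      have iff: "i \<in> S \<and> T = S - {i} \<longleftrightarrow> i \<notin> T \<and> S = insert i T" for S by auto
      have "{j \<in> insert i T. j < i} = {j \<in> T. j < i}" by auto
      moreover have "insert i T \<in> Pow ?N" using that True by auto
      ultimately show ?thesis
        unfolding iff by (cases "i \<in> T") (simp_all add: sum.delta ac_simps)
    qed
    have "differential (koszul_complex d fs) v T =
        (\<Sum>S\<in>Pow ?N. \<Sum>i\<in>S. if T = S - {i} then v S * ((- 1) ^ card {j \<in> S. j < i} * fs ! i) else 0)"
      using True by (simp add: differential_def koszul_complex_def sum_distrib_left if_distrib cong: if_cong)
    also have "\<dots> = (\<Sum>S\<in>Pow ?N. \<Sum>i\<in>?N. if i \<in> S \<and> T = S - {i} then v S * ((- 1) ^ card {j \<in> S. j < i} * fs ! i) else 0)"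
      by (intro sum.cong refl sum.mono_neutral_cong_left) auto
    also have "\<dots> = (\<Sum>i\<in>?N. \<Sum>S\<in>Pow ?N. if i \<in> S \<and> T = S - {i} then v S * ((- 1) ^ card {j \<in> S. j < i} * fs ! i) else 0)"
      by (rule sum.swap)
    also have "\<dots> = (\<Sum>i\<in>?N. if i \<notin> T then (- 1) ^ card {j \<in> T. j < i} * fs ! i * v (insert i T) else 0)"
      by (intro sum.cong refl term_eq)
    also have "\<dots> = koszul_diff fs v T"
      unfolding koszul_diff_def by (simp add: sum.If_cases) (rule sum.cong, auto)
    finally show ?thesis using True by simp
  qed (simp add: differential_def koszul_complex_def)
qed

lemma mem_free_chains_koszul:
  "v \<in> free_chains (koszul_complex d fs) n \<longleftrightarrow> (\<forall>T. v T \<noteq> 0 \<longrightarrow> T \<subseteq> {..<length fs} \<and> card T = n)"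
  by (simp add: free_chains_def koszul_complex_def)

lemma koszul_complex_exact:
  assumes "\<forall>i<length fs. nzd (fs ! i) (rmod.span (set (take i fs)))"
  shows "{v \<in> free_chains (koszul_complex d fs) (Suc p). differential (koszul_complex d fs) v = (\<lambda>_. 0)} =
    differential (koszul_complex d fs) ` free_chains (koszul_complex d fs) (Suc (Suc p))"
proof safe
  fix v assume v: "v \<in> free_chains (koszul_complex d fs) (Suc p)"
    "differential (koszul_complex d fs) v = (\<lambda>_. 0)"
  have "koszul_diff fs v T = 0" if "T \<subseteq> {..<length fs}" for T
    using fun_cong[OF v(2), of T] that by (simp add: differential_koszul_complex)
  from koszul_diff_exact[OF assms this] obtain w where
    w: "\<And>T. T \<subseteq> {..<length fs} \<Longrightarrow> card T = Suc p \<Longrightarrow> koszul_diff fs w T = v T" by blast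
  \<comment> \<open>The values of \<open>w\<close> in other degrees are arbitrary; cutting them off
    makes it a chain of the required degree.\<close>
  define u where "u = (\<lambda>S. if S \<subseteq> {..<length fs} \<and> card S = Suc (Suc p) then w S else 0)"
  have "u \<in> free_chains (koszul_complex d fs) (Suc (Suc p))"
    by (auto simp: mem_free_chains_koszul u_def)
  moreover have "v = differential (koszul_complex d fs) u"
  proof
    fix T
    consider "\<not> T \<subseteq> {..<length fs}" | "T \<subseteq> {..<length fs}" "card T = Suc p"
      | "T \<subseteq> {..<length fs}" "card T \<noteq> Suc p" by blast
    then show "v T = differential (koszul_complex d fs) u T"
    proof cases
      case 1
      then show ?thesis
        using v(1) by (auto simp: differential_koszul_complex mem_free_chains_koszul)
    next
      case 2
      then have "koszul_diff fs u T = koszul_diff fs w T"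
        by (intro koszul_diff_cong) (auto simp: u_def)
      then show ?thesis using 2 w by (simp add: differential_koszul_complex)
    next
      case 3
      then have "koszul_diff fs u T = koszul_diff fs (\<lambda>_. 0) T"
        by (intro koszul_diff_cong) (auto simp: u_def)
      then show ?thesis
        using 3 v(1) by (auto simp: differential_koszul_complex mem_free_chains_koszul)
    qed
  qed
  ultimately show "v \<in> differential (koszul_complex d fs) ` free_chains (koszul_complex d fs) (Suc (Suc p))"
    by blast
next
  fix w assume w: "w \<in> free_chains (koszul_complex d fs) (Suc (Suc p))"
  let ?v = "differential (koszul_complex d fs) w"
  have "koszul_diff fs w T = 0" if "T \<subseteq> {..<length fs}" "card T \<noteq> Suc p" for T
  proof -
    have "koszul_diff fs w T = koszul_diff fs (\<lambda>_. 0) T"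
      by (rule koszul_diff_cong) (use w that in \<open>auto simp: mem_free_chains_koszul\<close>)
    then show ?thesis by simp
  qed
  then show "?v \<in> free_chains (koszul_complex d fs) (Suc p)"
    by (auto simp: mem_free_chains_koszul differential_koszul_complex split: if_splits)
  show "differential (koszul_complex d fs) ?v = (\<lambda>_. 0)"
  proof
    fix T
    show "differential (koszul_complex d fs) ?v T = 0"
    proof (cases "T \<subseteq> {..<length fs}")
      case True
      have "koszul_diff fs ?v T = koszul_diff fs (koszul_diff fs w) T"
        using True by (intro koszul_diff_cong) (auto simp: differential_koszul_complex)
      then show ?thesis
        using True koszul_diff_square by (simp add: differential_koszul_complex)
    qed (simp add: differential_koszul_complex)
  qed
qed

lemma koszul_complex_boundaries:
  "differential (koszul_complex d fs) ` free_chains (koszul_complex d fs) 1 =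
    {v \<in> free_chains (koszul_complex d fs) 0. v {} \<in> rmod.span (set fs)}"
proof safe
  fix w assume w: "w \<in> free_chains (koszul_complex d fs) 1"
  let ?v = "differential (koszul_complex d fs) w"
  have "koszul_diff fs w T = 0" if "T \<subseteq> {..<length fs}" "card T \<noteq> 0" for T
  proof -
    have "koszul_diff fs w T = koszul_diff fs (\<lambda>_. 0) T"
      by (rule koszul_diff_cong) (use w that in \<open>auto simp: mem_free_chains_koszul\<close>)
    then show ?thesis by simp
  qed
  then show "?v \<in> free_chains (koszul_complex d fs) 0"
    by (auto simp: mem_free_chains_koszul differential_koszul_complex split: if_splits)
  show "?v {} \<in> rmod.span (set fs)"
    unfolding koszul_diff_empty_range by (auto simp: differential_koszul_complex)
next
  fix v assume v: "v \<in> free_chains (koszul_complex d fs) 0" "v {} \<in> rmod.span (set fs)"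
  then obtain w where w: "koszul_diff fs w {} = v {}" unfolding koszul_diff_empty_range by blast
  define u where "u = (\<lambda>S. if S \<subseteq> {..<length fs} \<and> card S = 1 then w S else 0)"
  have "u \<in> free_chains (koszul_complex d fs) 1"
    by (auto simp: mem_free_chains_koszul u_def)
  moreover have "v = differential (koszul_complex d fs) u"
  proof
    fix T
    consider "\<not> T \<subseteq> {..<length fs}" | "T = {}" | "T \<subseteq> {..<length fs}" "card T \<noteq> 0"
      using finite_subset[of T "{..<length fs}"] by auto
    then show "v T = differential (koszul_complex d fs) u T"
    proof cases
      case 1
      then show ?thesis
        using v(1) by (auto simp: differential_koszul_complex mem_free_chains_koszul)
    next
      case 2
      then have "koszul_diff fs u T = koszul_diff fs w T"
        by (intro koszul_diff_cong) (auto simp: u_def)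
      then show ?thesis using 2 w by (simp add: differential_koszul_complex)
    next
      case 3
      then have "koszul_diff fs u T = koszul_diff fs (\<lambda>_. 0) T"
        by (intro koszul_diff_cong) (auto simp: u_def)
      then show ?thesis
        using 3 v(1) by (auto simp: differential_koszul_complex mem_free_chains_koszul)
    qed
  qed
  ultimately show "v \<in> differential (koszul_complex d fs) ` free_chains (koszul_complex d fs) 1"
    by blast
qed

section \<open>Hilbert functions\<close>

lemma pconst_simps:
  "pconst 0 = 0" "pconst 1 = 1" "pconst a + pconst b = pconst (a + b)"
  "pconst a * pconst b = pconst (a * b)" "- pconst a = pconst (- a)"
  by (simp_all add: pconst_def single_add mult_single single_uminus)

lemma pconst_eq_0_iff [simp]: "pconst a = 0 \<longleftrightarrow> a = 0"
  by (metis pconst_def lookup_single_eq lookup_zero single_zero)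

lemma subfield_pconst: "subfield (range pconst) (polyring :: 'k::field poly4 ring)"
proof -
  interpret cring "polyring :: 'k poly4 ring" ..
  show ?thesis
  proof (rule subfieldI)
    show "subcring (range pconst) (polyring :: 'k poly4 ring)"
      by (intro subcringI' subringI) (auto simp: pconst_simps intro: range_eqI[of 1 pconst 1])
    show "Units (polyring \<lparr>carrier := range pconst\<rparr>) = range pconst - {\<zero>\<^bsub>polyring :: 'k poly4 ring\<^esub>}"
    proof (intro equalityI subsetI)
      fix x assume "x \<in> Units ((polyring :: 'k poly4 ring) \<lparr>carrier := range pconst\<rparr>)"
      then show "x \<in> range pconst - {\<zero>\<^bsub>polyring :: 'k poly4 ring\<^esub>}"
        by (auto simp: Units_def)
    next
      fix x assume "x \<in> range pconst - {\<zero>\<^bsub>polyring :: 'k poly4 ring\<^esub>}"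
      then obtain a where a: "x = pconst a" "a \<noteq> 0" by (auto simp: pconst_simps)
      then have "pconst (inverse a) * x = 1" "x * pconst (inverse a) = 1"
        by (simp_all add: pconst_simps)
      then show "x \<in> Units ((polyring :: 'k poly4 ring) \<lparr>carrier := range pconst\<rparr>)"
        using a(1) by (auto simp: Units_def)
    qed
  qed
qed

definition has_dim :: "nat \<Rightarrow> 'k::field poly4 set \<Rightarrow> bool"
  where "has_dim n V \<longleftrightarrow> ring.dimension polyring n (range pconst) V"

lemma has_dim_zero: "has_dim 0 {0 :: 'k::field poly4}"
proof -
  interpret cring "polyring :: 'k poly4 ring" ..
  show ?thesis unfolding has_dim_def using dimension.zero_dim by simp
qed

lemma has_dim_extend:
  fixes v :: "'k::field poly4"
  assumes "has_dim n V" "v \<notin> V"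
  shows "has_dim (Suc n) {pconst c * v + w | c w. w \<in> V}"
proof -
  interpret cring "polyring :: 'k poly4 ring" ..
  have "line_extension (range pconst) v V = {pconst c * v + w | c w. w \<in> V}"
    unfolding set_eq_iff line_extension_mem_iff polyring_simps by blast
  then show ?thesis
    using dimension.Suc_dim[of v V n "range pconst"] assms unfolding has_dim_def by simp
qed

lemma has_dim_induct [consumes 1, case_names zero extend]:
  fixes V :: "'k::field poly4 set"
  assumes "has_dim n V" "P 0 {0}"
    and "\<And>n v V. has_dim n V \<Longrightarrow> v \<notin> V \<Longrightarrow> P n V \<Longrightarrow> P (Suc n) {pconst c * v + w | c w. w \<in> V}"
  shows "P n V"
proof -
  interpret cring "polyring :: 'k poly4 ring" ..
  have le: "line_extension (range pconst) v V = {pconst c * v + w | c w. w \<in> V}" for v V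
    unfolding set_eq_iff line_extension_mem_iff polyring_simps by blast
  have "P n V" if "dimension n K V" "K = range pconst" for n K and V :: "'k poly4 set"
    using that
  proof (induction rule: dimension.induct)
    case (zero_dim K)
    then show ?case using assms(2) by simp
  next
    case (Suc_dim v E n K)
    then show ?case using assms(3)[of n E v] unfolding has_dim_def by (simp add: le)
  qed
  then show ?thesis using assms(1) unfolding has_dim_def by simp
qed

lemma has_dim_unique: "has_dim m V \<Longrightarrow> has_dim n (V :: 'k::field poly4 set) \<Longrightarrow> m = n"
proof -
  interpret cring "polyring :: 'k poly4 ring" ..
  show "has_dim m V \<Longrightarrow> has_dim n V \<Longrightarrow> m = n"
    unfolding has_dim_def using dimension_is_inj[OF subfield_pconst] by blast
qed

lemma has_dim_mono:
  fixes V W :: "'k::field poly4 set"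
  assumes "has_dim m V" "has_dim n W" "V \<subseteq> W"
  shows "m \<le> n" and "m = n \<Longrightarrow> V = W"
proof -
  interpret cring "polyring :: 'k poly4 ring" ..
  obtain Us where Us: "set Us \<subseteq> carrier polyring" "independent (range pconst) Us"
      "length Us = m" "Span (range pconst) Us = V"
    using exists_base[OF subfield_pconst] assms(1) unfolding has_dim_def by metis
  have "set Us \<subseteq> W" using Span_base_incl[OF subfield_pconst Us(1)] Us(4) assms(3) by blast
  then show "m \<le> n" "m = n \<Longrightarrow> V = W"
    using independent_length_le_dimension[OF subfield_pconst assms(2)[unfolded has_dim_def] Us(2)]
      independent_length_eq_dimension[OF subfield_pconst assms(2)[unfolded has_dim_def] Us(2)] Us(3,4)
    by auto
qed

lemma has_dim_sum:
  fixes V W :: "'k::field poly4 set"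
  assumes "has_dim m V" "has_dim n W" "has_dim k (V \<inter> W)"
  shows "has_dim (m + n - k) {v + w | v w. v \<in> V \<and> w \<in> W}"
proof -
  interpret cring "polyring :: 'k poly4 ring" ..
  have "V <+>\<^bsub>polyring\<^esub> W = {v + w | v w. v \<in> V \<and> w \<in> W}"
    by (auto simp: set_add_def')
  then show ?thesis
    using dimension_sum_space[OF subfield_pconst, of m V n W k] assms unfolding has_dim_def by simp
qed

lemma has_dim_subspace:
  fixes J W :: "'k::field poly4 set"
  assumes "rmod.subspace J" "has_dim n W"
  shows "\<exists>m. has_dim m (J \<inter> W)"
proof -
  interpret cring "polyring :: 'k poly4 ring" ..
  have fin: "finite_dimension (range pconst) W"
    using assms(2) finite_dimensionI unfolding has_dim_def by blast
  have "subalgebra (range pconst) (J \<inter> W) polyring"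
    using subalgebra_inter[OF ideal_is_subalgebra finite_dimension_imp_subalgebra[OF subfield_pconst fin]]
      assms(1) by (simp add: ideal_iff_subspace)
  then have "finite_dimension (range pconst) (J \<inter> W)"
    using subalbegra_incl_imp_finite_dimension[OF subfield_pconst fin] by simp
  then show ?thesis unfolding has_dim_def finite_dimension_def .
qed

lemma has_dim_mult:
  fixes V :: "'k::field poly4 set"
  assumes "has_dim n V" "F \<noteq> 0"
  shows "has_dim n ((*) F ` V)"
  using assms(1)
proof (induction rule: has_dim_induct)
  case zero
  then show ?case using has_dim_zero by simp
next
  case (extend n v V)
  have "F * v \<notin> (*) F ` V" using extend.hyps(2) assms(2) by auto
  then have "has_dim (Suc n) {pconst c * (F * v) + w | c w. w \<in> (*) F ` V}"
    using has_dim_extend extend.IH by blast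
  moreover have "{pconst c * (F * v) + w | c w. w \<in> (*) F ` V} =
      (*) F ` {pconst c * v + w | c w. w \<in> V}" (is "?A = ?B")
  proof (intro equalityI subsetI)
    fix x assume "x \<in> ?A"
    then obtain c w where "w \<in> V" "x = pconst c * (F * v) + F * w" by blast
    then have "w \<in> V" "x = F * (pconst c * v + w)" by (simp_all add: algebra_simps)
    then show "x \<in> ?B" by blast
  next
    fix x assume "x \<in> ?B"
    then obtain c w where "w \<in> V" "x = F * (pconst c * v + w)" by blast
    then have "x = pconst c * (F * v) + F * w" by (simp add: algebra_simps)
    moreover have "F * w \<in> (*) F ` V" using \<open>w \<in> V\<close> by (rule imageI)
    ultimately show "x \<in> ?A" by blast
  qed
  ultimately show ?case by simp
qed

lemma has_dim_supported:
  assumes "finite M"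
  shows "has_dim (card M) {f :: 'k::field poly4. Poly_Mapping.keys f \<subseteq> M}"
  using assms
proof (induction M)
  case empty
  have "{f :: 'k poly4. Poly_Mapping.keys f \<subseteq> {}} = {0}" by auto
  then show ?case using has_dim_zero by simp
next
  case (insert m M)
  let ?V = "{f :: 'k poly4. Poly_Mapping.keys f \<subseteq> M}"
  let ?v = "Poly_Mapping.single m (1 :: 'k)"
  have "?v \<notin> ?V" using insert.hyps(2) by simp
  then have "has_dim (Suc (card M)) {pconst c * ?v + w | c w. w \<in> ?V}"
    using has_dim_extend insert.IH by blast
  moreover have "{pconst c * ?v + w | c w. w \<in> ?V} = {f. Poly_Mapping.keys f \<subseteq> insert m M}"
  proof (intro equalityI subsetI)
    fix f assume "f \<in> {pconst c * ?v + w | c w. w \<in> ?V}"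
    then obtain c w where "w \<in> ?V" "f = Poly_Mapping.single m c + w"
      by (auto simp: pconst_def mult_single)
    then show "f \<in> {f. Poly_Mapping.keys f \<subseteq> insert m M}"
      using Poly_Mapping.keys_add[of "Poly_Mapping.single m c" w] by (auto split: if_splits)
  next
    fix f :: "'k poly4" assume f: "f \<in> {f. Poly_Mapping.keys f \<subseteq> insert m M}"
    define w where "w = f - Poly_Mapping.single m (Poly_Mapping.lookup f m)"
    have "Poly_Mapping.lookup w m = 0" by (simp add: w_def lookup_minus)
    moreover have "Poly_Mapping.lookup w n = Poly_Mapping.lookup f n" if "n \<noteq> m" for n
      using that by (simp add: w_def lookup_minus lookup_single)
    ultimately have "Poly_Mapping.keys w \<subseteq> Poly_Mapping.keys f - {m}"
      by (metis DiffI in_keys_iff singletonD subsetI)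
    then have "w \<in> ?V" using f by auto
    moreover have "f = pconst (Poly_Mapping.lookup f m) * ?v + w"
      by (simp add: pconst_def mult_single w_def)
    ultimately show "f \<in> {pconst c * ?v + w | c w. w \<in> ?V}" by blast
  qed
  ultimately show ?case using insert.hyps by simp
qed

lemma UNIV_type4: "(UNIV :: 4 set) = {0, 1, 2, 3}"
proof -
  have "card {0, 1, 2, 3 :: 4} = CARD(4)" by simp
  then show ?thesis by (metis card_subset_eq finite subset_UNIV)
qed

lemma mdeg_type4:
  "mdeg m = Poly_Mapping.lookup m 0 + Poly_Mapping.lookup m 1 + Poly_Mapping.lookup m 2 + Poly_Mapping.lookup m 3"
  unfolding mdeg_def UNIV_type4 by simp

text \<open>Reduces the count of monomials to that of lists of four numbers with a given
  sum.\<close>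

lemma monomials_of_degree:
  "bij_betw (\<lambda>m. [Poly_Mapping.lookup m 0, Poly_Mapping.lookup m 1, Poly_Mapping.lookup m 2, Poly_Mapping.lookup m 3])
    {m. mdeg m = n} {l. length l = 4 \<and> sum_list l = n}"
  (is "bij_betw ?f ?A ?B")
proof (rule bij_betw_byWitness)
  let ?g = "\<lambda>l. Poly_Mapping.single 0 (l ! 0) + Poly_Mapping.single 1 (l ! 1) +
    Poly_Mapping.single 2 (l ! 2) + Poly_Mapping.single (3 :: 4) (l ! 3 :: nat)"
  show "\<forall>m\<in>?A. ?g (?f m) = m"
  proof
    fix m :: "4 \<Rightarrow>\<^sub>0 nat"
    show "?g (?f m) = m"
    proof (rule poly_mapping_eqI)
      fix i :: 4
      have "i \<in> {0, 1, 2, 3}" using UNIV_type4 by blast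
      then show "Poly_Mapping.lookup (?g (?f m)) i = Poly_Mapping.lookup m i"
        by (auto simp: lookup_add lookup_single)
    qed
  qed
  show "\<forall>l\<in>?B. ?f (?g l) = l"
  proof
    fix l :: "nat list" assume "l \<in> ?B"
    then obtain a b c e where "l = [a, b, c, e]"
      by (auto simp: numeral_eq_Suc length_Suc_conv)
    then show "?f (?g l) = l" by (simp add: lookup_add lookup_single)
  qed
  show "?f ` ?A \<subseteq> ?B" by (auto simp: mdeg_type4)
  show "?g ` ?B \<subseteq> ?A"
  proof
    fix m assume "m \<in> ?g ` ?B"
    then obtain l where "l \<in> ?B" "m = ?g l" by blast
    moreover from this obtain a b c e where "l = [a, b, c, e]"
      by (auto simp: numeral_eq_Suc length_Suc_conv)
    ultimately show "m \<in> ?A" by simp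
  qed
qed

definition hilb :: "int \<Rightarrow> nat"
  where "hilb t = (if t < 0 then 0 else (nat t + 3) choose 3)"

lemma has_dim_forms: "has_dim (hilb t) (forms t :: 'k::field poly4 set)"
proof (cases "t < 0")
  case True
  then have "(forms t :: 'k poly4 set) = {0}" using forms_negative by blast
  then show ?thesis using True has_dim_zero by (simp add: hilb_def)
next
  case False
  let ?M = "{m. mdeg m = nat t}"
  have "finite {l :: nat list. length l = 4 \<and> sum_list l = nat t}"
    by (rule finite_subset[OF _ finite_lists_length_eq[of "{..nat t}" 4]])
      (auto dest: member_le_sum_list)
  then have fin: "finite ?M" using bij_betw_finite[OF monomials_of_degree] by blast
  have "card ?M = (nat t + 4 - 1) choose nat t"
    using bij_betw_same_card[OF monomials_of_degree] card_length_sum_list by metis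
  also have "\<dots> = hilb t"
    using False binomial_symmetric[of "nat t" "nat t + 3"] by (simp add: hilb_def add.commute)
  finally have "card ?M = hilb t" .
  moreover have "{f :: 'k poly4. Poly_Mapping.keys f \<subseteq> ?M} = forms t"
    using False by (auto simp: forms_def)
  ultimately show ?thesis using has_dim_supported[OF fin] by metis
qed

text \<open>The zeros -1, -2, -3 of the cubic carry the binomial formula into negative degrees. The
  factor 6 keeps everything in the integers.\<close>

lemma hilb_cubic:
  assumes "t \<ge> - 3"
  shows "6 * int (hilb t) = (t + 1) * (t + 2) * (t + 3)"
proof (cases "t < 0")
  case True
  with assms have "t \<in> {-3, -2, -1}" by auto
  then show ?thesis by (auto simp: hilb_def)
next
  case False
  define n where "n = nat t"
  have n: "t = int n" using False by (simp add: n_def)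
  have "6 * ((n + 3) choose 3) = (n + 3) * (n + 2) * (n + 1)"
  proof -
    have e: "Suc 2 = 3" "Suc (n + 2) = n + 3" "Suc 1 = 2" "Suc (n + 1) = n + 2" by simp_all
    have a: "3 * ((n + 3) choose 3) = (n + 3) * ((n + 2) choose 2)"
      by (rule Suc_times_binomial[of 2 "n + 2", unfolded e])
    have b: "2 * ((n + 2) choose 2) = (n + 2) * (n + 1)"
      using Suc_times_binomial[of 1 "n + 1", unfolded e] by simp
    have "6 * ((n + 3) choose 3) = 2 * (3 * ((n + 3) choose 3))" by simp
    also have "\<dots> = (n + 3) * (2 * ((n + 2) choose 2))" unfolding a by (simp only: mult.left_commute)
    finally show ?thesis unfolding b by (simp only: mult.assoc)
  qed
  then have "int (6 * ((n + 3) choose 3)) = int ((n + 3) * (n + 2) * (n + 1))" by simp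
  then show ?thesis by (simp add: n hilb_def algebra_simps)
qed

text \<open>The dimension of \<open>(R/J)\<^sub>t\<close>.\<close>

definition codim :: "'k::field poly4 set \<Rightarrow> int \<Rightarrow> int"
  where "codim J t = int (hilb t) - int (THE n. has_dim n (J \<inter> forms t))"

lemma codimI: "has_dim n (J \<inter> forms t) \<Longrightarrow> codim J t = int (hilb t) - int n"
  unfolding codim_def using has_dim_unique by (metis the_equality)

lemma has_dim_codim:
  assumes "rmod.subspace J"
  obtains n where "has_dim n (J \<inter> forms t)" "codim J t = int (hilb t) - int n" "n \<le> hilb t"
proof -
  obtain n where n: "has_dim n (J \<inter> forms t)"
    using has_dim_subspace[OF assms has_dim_forms] by blast
  then have "n \<le> hilb t" using has_dim_mono(1)[OF n has_dim_forms] by blast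
  then show thesis using that n codimI by blast
qed

lemma codim_zero: "codim {0} t = int (hilb t)"
proof -
  have "has_dim 0 ({0} \<inter> forms t)" using has_dim_zero by simp
  from codimI[OF this] show ?thesis by simp
qed

text \<open>The numerical form of 0 -> (R/J)(-e) -> R/J -> R/(J, F) -> 0. In degree \<open>t\<close>
  the new ideal is the sum of \<open>J_t\<close> and \<open>F * R_(t-e)\<close>, and these meet in
  \<open>F * J_(t-e)\<close> because \<open>F\<close> is a nonzerodivisor modulo
  \<open>J\<close>.\<close>

lemma codim_insert:
  assumes S: "homogeneous (rmod.span S)" and F: "F \<in> forms e" "F \<noteq> 0" "nzd F (rmod.span S)"
  shows "codim (rmod.span (insert F S)) t = codim (rmod.span S) t - codim (rmod.span S) (t - e)"
proof -
  let ?J = "rmod.span S" and ?J' = "rmod.span (insert F S)"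
  obtain m where m: "has_dim m (?J \<inter> forms t)" "codim ?J t = int (hilb t) - int m" "m \<le> hilb t"
    using has_dim_codim[OF rmod.subspace_span] .
  obtain n where n: "has_dim n (?J \<inter> forms (t - e))"
      "codim ?J (t - e) = int (hilb (t - e)) - int n" "n \<le> hilb (t - e)"
    using has_dim_codim[OF rmod.subspace_span] .
  have inter: "(?J \<inter> forms t) \<inter> (*) F ` forms (t - e) = (*) F ` (?J \<inter> forms (t - e))"
  proof (intro equalityI subsetI)
    fix x assume "x \<in> (?J \<inter> forms t) \<inter> (*) F ` forms (t - e)"
    then show "x \<in> (*) F ` (?J \<inter> forms (t - e))" using nzdD[OF F(3)] by auto
  next
    fix x assume "x \<in> (*) F ` (?J \<inter> forms (t - e))"
    then show "x \<in> (?J \<inter> forms t) \<inter> (*) F ` forms (t - e)"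
      using forms_mult[OF F(1), of _ "t - e"] by (auto intro: rmod.span_scale)
  qed
  have sum: "{v + w | v w. v \<in> ?J \<inter> forms t \<and> w \<in> (*) F ` forms (t - e)} = ?J' \<inter> forms t"
  proof (intro equalityI subsetI)
    fix x assume "x \<in> {v + w | v w. v \<in> ?J \<inter> forms t \<and> w \<in> (*) F ` forms (t - e)}"
    then obtain v w where vw: "v \<in> ?J" "v \<in> forms t" "w \<in> forms (t - e)" "x = v + F * w" by blast
    have "x - w * F \<in> ?J" using vw(1) by (simp add: vw(4) mult.commute)
    moreover have "x \<in> forms t" using vw forms_mult[OF F(1) vw(3)] by (simp add: forms_add)
    ultimately show "x \<in> ?J' \<inter> forms t" unfolding rmod.span_insert by blast
  next
    fix x assume x: "x \<in> ?J' \<inter> forms t"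
    then obtain k where "x - k * F \<in> ?J" by (auto simp: rmod.span_insert)
    then have "hcomp t (x - k * F) \<in> ?J" by (rule homogeneous_hcomp[OF S])
    then have "x - F * hcomp (t - e) k \<in> ?J"
      using x unfolding hcomp_diff hcomp_mult_form_right[OF F(1)] by (simp add: mult.commute)
    moreover have "x - F * hcomp (t - e) k \<in> forms t"
      using x forms_mult[OF F(1) hcomp_in_forms, of "t - e" k] by (simp add: forms_diff)
    moreover have "x = (x - F * hcomp (t - e) k) + F * hcomp (t - e) k" by simp
    ultimately show "x \<in> {v + w | v w. v \<in> ?J \<inter> forms t \<and> w \<in> (*) F ` forms (t - e)}"
      using hcomp_in_forms by blast
  qed
  have "has_dim (m + hilb (t - e) - n) (?J' \<inter> forms t)"
    using has_dim_sum[OF m(1) has_dim_mult[OF has_dim_forms F(2), of "t - e"], of n]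
      has_dim_mult[OF n(1) F(2)] unfolding inter sum by blast
  from codimI[OF this] show ?thesis using m n by simp
qed

text \<open>By homogeneity the pieces of degree \<open>t\<close> of the two ideals add up to that of
  their sum, so the dimension formula for sum and intersection of subspaces applies.\<close>

lemma codim_inter:
  assumes S: "homogeneous (rmod.span S)" and T: "homogeneous (rmod.span T)"
  shows "codim (rmod.span S \<inter> rmod.span T) t =
    codim (rmod.span S) t + codim (rmod.span T) t - codim (rmod.span (S \<union> T)) t"
proof -
  let ?I = "rmod.span S" and ?J = "rmod.span T"
  obtain m where m: "has_dim m (?I \<inter> forms t)" "codim ?I t = int (hilb t) - int m"
    using has_dim_codim[OF rmod.subspace_span] .
  obtain n where n: "has_dim n (?J \<inter> forms t)" "codim ?J t = int (hilb t) - int n"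
    using has_dim_codim[OF rmod.subspace_span] .
  have "rmod.subspace (?I \<inter> ?J)" by (simp add: rmod.subspace_inter)
  then obtain k where k: "has_dim k (?I \<inter> ?J \<inter> forms t)" "codim (?I \<inter> ?J) t = int (hilb t) - int k"
    using has_dim_codim by blast
  have "k \<le> m" by (rule has_dim_mono(1)[OF k(1) m(1)]) auto
  have "(?I \<inter> forms t) \<inter> (?J \<inter> forms t) = ?I \<inter> ?J \<inter> forms t" by auto
  then have k': "has_dim k ((?I \<inter> forms t) \<inter> (?J \<inter> forms t))" using k(1) by simp
  have sum: "{v + w | v w. v \<in> ?I \<inter> forms t \<and> w \<in> ?J \<inter> forms t} = rmod.span (S \<union> T) \<inter> forms t"
    unfolding rmod.span_Un
  proof (intro equalityI subsetI)
    fix x assume "x \<in> {v + w | v w. v \<in> ?I \<inter> forms t \<and> w \<in> ?J \<inter> forms t}"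
    then show "x \<in> {x + y | x y. x \<in> ?I \<and> y \<in> ?J} \<inter> forms t" using forms_add by blast
  next
    fix x assume "x \<in> {x + y | x y. x \<in> ?I \<and> y \<in> ?J} \<inter> forms t"
    then obtain v w where vw: "v \<in> ?I" "w \<in> ?J" "x = v + w" "x \<in> forms t" by blast
    then have "x = hcomp t v + hcomp t w" by (metis hcomp_add hcomp_form_same)
    moreover have "hcomp t v \<in> ?I" "hcomp t w \<in> ?J"
      using vw homogeneous_hcomp[OF S] homogeneous_hcomp[OF T] by blast+
    ultimately show "x \<in> {v + w | v w. v \<in> ?I \<inter> forms t \<and> w \<in> ?J \<inter> forms t}"
      using hcomp_in_forms by blast
  qed
  have "has_dim (m + n - k) (rmod.span (S \<union> T) \<inter> forms t)"
    using has_dim_sum[OF m(1) n(1) k'] unfolding sum .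
  from codimI[OF this] show ?thesis using m(2) n(2) k(2) \<open>k \<le> m\<close> by simp
qed

text \<open>Rank and nullity of the projection restricted to the forms of degree \<open>t\<close>,
  with kernel \<open>I \<inter> forms t\<close>. Properness of \<open>I\<close> keeps the constants
  a field in the quotient.\<close>

lemma dim_quotient:
  fixes I :: "'k::field poly4 set"
  assumes I: "rmod.subspace I" "I \<noteq> UNIV"
  shows "ring.dim (polyring Quot I) ((\<lambda>a. I +>\<^bsub>polyring\<^esub> pconst a) ` UNIV)
    ((\<lambda>f. I +>\<^bsub>polyring\<^esub> f) ` forms t) = nat (codim I t)"
proof -
  interpret cring "polyring :: 'k poly4 ring" ..
  have ideal: "ideal I polyring" using I(1) by (simp add: ideal_iff_subspace)
  then interpret I: ideal I "polyring :: 'k poly4 ring" .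
  interpret h: ring_hom_ring "polyring :: 'k poly4 ring" "polyring Quot I" "(+>\<^bsub>polyring\<^esub>) I"
    by (rule I.rcos_ring_hom_ring)
  have coset_eq: "I +>\<^bsub>polyring\<^esub> x = I \<longleftrightarrow> x \<in> I" for x
    using I.a_rcos_const[of x] I.a_rcos_self[of x] by auto
  have one_zero: "\<one>\<^bsub>polyring Quot I\<^esub> \<noteq> \<zero>\<^bsub>polyring Quot I\<^esub>"
    using coset_eq[of 1] I rmod.subspace_scale[OF I(1), of 1] by (auto simp: FactRing_def)
  obtain n where n: "has_dim n (I \<inter> forms t)" "codim I t = int (hilb t) - int n" "n \<le> hilb t"
    using has_dim_codim[OF I(1)] .
  have ker: "a_kernel (polyring \<lparr>carrier := forms t\<rparr>) (polyring Quot I) ((+>\<^bsub>polyring\<^esub>) I) = I \<inter> forms t"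
    unfolding a_kernel_def' FactRing_def using coset_eq by auto
  have "h.S.dimension (hilb t - n) ((+>\<^bsub>polyring\<^esub>) I ` range pconst) ((+>\<^bsub>polyring\<^esub>) I ` forms t)"
    by (rule h.rank_nullity_theorem[OF subfield_pconst one_zero])
      (use has_dim_forms n(1) in \<open>simp_all add: ker has_dim_def\<close>)
  moreover have "subfield ((+>\<^bsub>polyring\<^esub>) I ` range pconst) (polyring Quot I)"
    by (rule h.img_is_subfield(2)[OF subfield_pconst one_zero])
  ultimately have "h.S.dim ((+>\<^bsub>polyring\<^esub>) I ` range pconst) ((+>\<^bsub>polyring\<^esub>) I ` forms t) = hilb t - n"
    using h.S.dimI by (simp add: over_def)
  then show ?thesis using n by (simp add: image_image)
qed

section \<open>Hilbert functions along the regular sequence\<close>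

context regular_forms begin

lemma F_nonzero: "F1 \<noteq> 0" "F2 \<noteq> 0" "F3 \<noteq> 0" "F4 \<noteq> 0"
proof -
  have "F \<noteq> 0" if "nzd F (rmod.span S)" "S \<subseteq> {F1, F2, F3, F4}" for F S
  proof
    assume "F = 0"
    then have "F * 1 \<in> rmod.span S" by (simp add: rmod.span_zero)
    then have "1 \<in> rmod.span S" by (rule nzdD[OF that(1)])
    then have "1 \<in> rmod.span {F1, F2, F3, F4}" using rmod.span_mono[OF that(2)] by blast
    then show False using proper rmod.span_scale[of 1] by auto
  qed
  from this[OF reg1] this[OF reg2] this[OF reg3] this[OF reg4]
  show "F1 \<noteq> 0" "F2 \<noteq> 0" "F3 \<noteq> 0" "F4 \<noteq> 0" by simp_all
qed

lemma codim_pair: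
  "codim (rmod.span {F1, F2}) t = int (hilb t) - 2 * int (hilb (t - int d)) + int (hilb (t - 2 * int d))"
proof -
  have 1: "codim (rmod.span {F1}) s = int (hilb s) - int (hilb (s - int d))" for s
    using codim_insert[of "{}" F1 "int d" s] homogeneous_zero F_forms(1) F_nonzero(1) reg1
    by (simp add: codim_zero)
  have "codim (rmod.span {F2, F1}) t = codim (rmod.span {F1}) t - codim (rmod.span {F1}) (t - int d)"
    by (rule codim_insert) (use homogeneous_spans F_forms F_nonzero reg2 in auto)
  then have "codim (rmod.span {F1, F2}) t = codim (rmod.span {F1}) t - codim (rmod.span {F1}) (t - int d)"
    by (simp add: insert_commute)
  then show ?thesis unfolding 1 by (simp add: algebra_simps)
qed

text \<open>A fourth difference with step \<open>d\<close>: each form of the sequence contributes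
  one difference. The coefficients are the ranks in the Koszul complex on four forms.\<close>

lemma codim_all:
  "codim (rmod.span {F1, F2, F3, F4}) t = int (hilb t) - 4 * int (hilb (t - int d))
    + 6 * int (hilb (t - 2 * int d)) - 4 * int (hilb (t - 3 * int d)) + int (hilb (t - 4 * int d))"
proof -
  have hom: "homogeneous (rmod.span {F1, F2, F3})"
    using F_forms by (auto intro!: homogeneous_span_forms)
  have 3: "codim (rmod.span {F1, F2, F3}) s =
      codim (rmod.span {F1, F2}) s - codim (rmod.span {F1, F2}) (s - int d)" for s
    using codim_insert[of "{F1, F2}" F3 "int d" s] homogeneous_spans F_forms F_nonzero reg3
    by (simp add: insert_commute)
  have "codim (rmod.span {F1, F2, F3, F4}) t =
      codim (rmod.span {F1, F2, F3}) t - codim (rmod.span {F1, F2, F3}) (t - int d)"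
    using codim_insert[of "{F1, F2, F3}" F4 "int d" t] hom F_forms F_nonzero reg4
    by (simp add: insert_commute)
  then show ?thesis by (simp add: 3 codim_pair algebra_simps)
qed

text \<open>For \<open>t \<ge> 4d\<close> the dimension of \<open>(R/J)\<^sub>t\<close> is a fourth difference of a cubic polynomial, hence zero.\<close>

lemma forms_subset_all:
  assumes "t \<ge> 4 * int d"
  shows "forms t \<subseteq> rmod.span {F1, F2, F3, F4}"
proof -
  have "6 * codim (rmod.span {F1, F2, F3, F4}) t = 0"
  proof -
    have "6 * int (hilb (t - i * int d)) = (t - i * int d + 1) * (t - i * int d + 2) * (t - i * int d + 3)"
      if "i \<in> {0, 1, 2, 3, 4}" for i
      using that assms by (intro hilb_cubic) auto
    from this[of 0] this[of 1] this[of 2] this[of 3] this[of 4]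
    show ?thesis unfolding codim_all by (simp add: algebra_simps)
  qed
  then have 0: "codim (rmod.span {F1, F2, F3, F4}) t = 0" by simp
  obtain n where n: "has_dim n (rmod.span {F1, F2, F3, F4} \<inter> forms t)"
      "codim (rmod.span {F1, F2, F3, F4}) t = int (hilb t) - int n"
    using has_dim_codim[OF rmod.subspace_span] .
  then have "n = hilb t" using 0 by simp
  then have "rmod.span {F1, F2, F3, F4} \<inter> forms t = forms t"
    using has_dim_mono(2)[OF n(1) has_dim_forms] by blast
  then show ?thesis by blast
qed

text \<open>A point containing all four forms would contain every form of degree
  \<open>4 * d\<close>, in particular that power of a variable outside it.\<close>

lemma F_not_all_vanish:
  assumes P: "P \<in> proj3"
  shows "F1 \<notin> P \<or> F2 \<notin> P \<or> F3 \<notin> P \<or> F4 \<notin> P"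
proof (rule ccontr)
  assume "\<not> ?thesis"
  then have sub: "rmod.span {F1, F2, F3, F4} \<subseteq> P"
    by (intro rmod.span_minimal homogeneous_subspace proj3_homogeneous P) auto
  obtain i where i: "pvar i \<notin> P" using proj3_var[OF P] by blast
  have "pvar i ^ (4 * d) \<in> forms (int (4 * d) * 1)" by (rule forms_power) simp
  then have "pvar i ^ (4 * d) \<in> P" using forms_subset_all[of "4 * int d"] sub by auto
  then show False using i proj3_power_iff[OF P] by blast
qed

text \<open>Obtained from the two ideals and their sum; the coefficients 4, 4, 1 in the degrees 2d,
  3d, 4d are the ranks in the tensor product of the two resolutions.\<close>

lemma codim_union:
  "codim (rmod.span {F1, F2} \<inter> rmod.span {F3, F4}) t =
    int (hilb t) - 4 * int (hilb (t - 2 * int d)) + 4 * int (hilb (t - 3 * int d)) - int (hilb (t - 4 * int d))"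
proof -
  interpret x: regular_forms F3 F4 F1 F2 d by (rule regular_forms_exchange)
  show ?thesis
    using codim_inter[OF homogeneous_spans(2,3), of t]
    by (simp add: codim_all codim_pair x.codim_pair insert_commute)
qed

end

section \<open>Sections of the sheaves as elements of the function field\<close>

definition emb :: "'a::idom \<Rightarrow> 'a fract"
  where "emb a = Fract a 1"

lemma emb_zero [simp]: "emb 0 = 0"
  and emb_one [simp]: "emb 1 = 1"
  by (simp_all add: emb_def Zero_fract_def One_fract_def)

lemma emb_add: "emb (a + b) = emb a + emb b"
  and emb_mult: "emb (a * b) = emb a * emb b"
  and emb_uminus: "emb (- a) = - emb a"
  and emb_diff: "emb (a - b) = emb a - emb b"
  by (simp_all add: emb_def)

lemma emb_eq_iff [simp]: "emb a = emb b \<longleftrightarrow> a = b"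
  by (simp add: emb_def eq_fract)

lemma emb_eq_0_iff [simp]: "emb a = 0 \<longleftrightarrow> a = 0"
  using emb_eq_iff[of a 0] by (simp del: emb_eq_iff)

lemma Fract_eq_iff_emb: "b \<noteq> 0 \<Longrightarrow> \<kappa> = Fract a b \<longleftrightarrow> emb b * \<kappa> = emb a"
proof -
  assume b: "b \<noteq> 0"
  have "emb b * Fract a b = emb a" using b by (simp add: emb_def eq_fract)
  then show ?thesis using b by (metis emb_eq_0_iff mult_left_cancel)
qed

text \<open>The part of degree \<open>t\<close> of the homogeneous localisation of \<open>I\<close>
  at \<open>P\<close>, as a subset of the function field. The fraction a/f is expressed by an
  equation, which holds without any division.\<close>

definition stalk :: "'k::field poly4 set \<Rightarrow> int \<Rightarrow> 'k poly4 set \<Rightarrow> 'k poly4 fract set"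
  where "stalk I t P = {\<kappa>. \<exists>n f a. f \<in> forms n \<and> f \<notin> P \<and> a \<in> I \<and> a \<in> forms (n + t) \<and> emb f * \<kappa> = emb a}"

lemma stalkI:
  "f \<in> forms n \<Longrightarrow> f \<notin> P \<Longrightarrow> a \<in> I \<Longrightarrow> a \<in> forms (n + t) \<Longrightarrow> emb f * \<kappa> = emb a \<Longrightarrow> \<kappa> \<in> stalk I t P"
  unfolding stalk_def by blast

lemma stalkE:
  assumes "\<kappa> \<in> stalk I t P"
  obtains n f a where "f \<in> forms n" "f \<notin> P" "a \<in> I" "a \<in> forms (n + t)" "emb f * \<kappa> = emb a"
  using assms unfolding stalk_def by blast

lemma emb_in_stalk: "P \<in> proj3 \<Longrightarrow> a \<in> I \<Longrightarrow> a \<in> forms t \<Longrightarrow> emb a \<in> stalk I t P"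
  by (rule stalkI[of 1 0]) (simp_all add: proj3_one)

lemma stalk_mono: "I \<subseteq> J \<Longrightarrow> stalk I t P \<subseteq> stalk J t P"
  unfolding stalk_def by blast

lemma stalk_zero: "P \<in> proj3 \<Longrightarrow> rmod.subspace I \<Longrightarrow> 0 \<in> stalk I t P"
  using emb_in_stalk[of P 0 I t] rmod.subspace_0[of I] by simp

lemma stalk_add:
  assumes P: "P \<in> proj3" and I: "rmod.subspace I" and k: "\<kappa> \<in> stalk I t P" and l: "\<mu> \<in> stalk I t P"
  shows "\<kappa> + \<mu> \<in> stalk I t P"
proof -
  obtain n f a where f: "f \<in> forms n" "f \<notin> P" "a \<in> I" "a \<in> forms (n + t)" "emb f * \<kappa> = emb a"
    using k by (rule stalkE)
  obtain m g b where g: "g \<in> forms m" "g \<notin> P" "b \<in> I" "b \<in> forms (m + t)" "emb g * \<mu> = emb b"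
    using l by (rule stalkE)
  show ?thesis
  proof (rule stalkI)
    show "f * g \<in> forms (n + m)" using f(1) g(1) by (rule forms_mult)
    show "f * g \<notin> P" using f(2) g(2) proj3_mult_iff[OF P] by blast
    show "g * a + f * b \<in> I" using f(3) g(3) I by (simp add: rmod.subspace_add rmod.subspace_scale)
    show "g * a + f * b \<in> forms (n + m + t)"
      using forms_mult[OF g(1) f(4)] forms_mult[OF f(1) g(4)] by (intro forms_add) (simp_all add: algebra_simps)
    have "emb (f * g) * (\<kappa> + \<mu>) = emb g * (emb f * \<kappa>) + emb f * (emb g * \<mu>)"
      by (simp add: emb_mult algebra_simps)
    then show "emb (f * g) * (\<kappa> + \<mu>) = emb (g * a + f * b)"
      by (simp add: f(5) g(5) emb_mult emb_add)
  qed
qed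

lemma stalk_mult:
  assumes P: "P \<in> proj3" and k: "\<kappa> \<in> stalk I s P" and l: "\<mu> \<in> stalk UNIV t P" and I: "rmod.subspace I"
  shows "\<kappa> * \<mu> \<in> stalk I (s + t) P"
proof -
  obtain n f a where f: "f \<in> forms n" "f \<notin> P" "a \<in> I" "a \<in> forms (n + s)" "emb f * \<kappa> = emb a"
    using k by (rule stalkE)
  obtain m g b where g: "g \<in> forms m" "g \<notin> P" "b \<in> forms (m + t)" "emb g * \<mu> = emb b"
    using l by (rule stalkE)
  show ?thesis
  proof (rule stalkI)
    show "f * g \<in> forms (n + m)" using f(1) g(1) by (rule forms_mult)
    show "f * g \<notin> P" using f(2) g(2) proj3_mult_iff[OF P] by blast
    show "b * a \<in> I" using f(3) I by (simp add: rmod.subspace_scale)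
    show "b * a \<in> forms (n + m + (s + t))"
      using forms_mult[OF g(3) f(4)] by (simp add: algebra_simps)
    have "emb (f * g) * (\<kappa> * \<mu>) = (emb g * \<mu>) * (emb f * \<kappa>)"
      by (simp add: emb_mult algebra_simps)
    then show "emb (f * g) * (\<kappa> * \<mu>) = emb (b * a)"
      by (simp add: f(5) g(4) emb_mult)
  qed
qed

lemma stalk_scale:
  assumes "P \<in> proj3" "\<kappa> \<in> stalk I t P" "r \<in> forms e" "rmod.subspace I"
  shows "emb r * \<kappa> \<in> stalk I (t + e) P"
  using stalk_mult[OF assms(1,2) emb_in_stalk[OF assms(1) UNIV_I assms(3)] assms(4)]
  by (simp add: mult.commute)

lemma stalk_uminus:
  assumes "P \<in> proj3" "rmod.subspace I" "\<kappa> \<in> stalk I t P"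
  shows "- \<kappa> \<in> stalk I t P"
  using stalk_scale[OF assms(1,3) forms_uminus[OF forms_one] assms(2)] by (simp add: emb_uminus)

lemma stalk_diff:
  assumes "P \<in> proj3" "rmod.subspace I" "\<kappa> \<in> stalk I t P" "\<mu> \<in> stalk I t P"
  shows "\<kappa> - \<mu> \<in> stalk I t P"
  using stalk_add[OF assms(1-3) stalk_uminus[OF assms(1,2,4)]] by simp

text \<open>Over the common denominator \<open>f * g\<close> the numerators are \<open>g * a\<close>
  and \<open>f * b\<close>. They agree since R embeds into its fraction field, so the numerator lies
  in both ideals.\<close>

lemma stalk_Int:
  assumes P: "P \<in> proj3" and I: "rmod.subspace I" and J: "rmod.subspace J"
  shows "stalk (I \<inter> J) t P = stalk I t P \<inter> stalk J t P"
proof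
  show "stalk (I \<inter> J) t P \<subseteq> stalk I t P \<inter> stalk J t P"
    using stalk_mono[of "I \<inter> J" I] stalk_mono[of "I \<inter> J" J] by blast
  show "stalk I t P \<inter> stalk J t P \<subseteq> stalk (I \<inter> J) t P"
  proof
    fix \<kappa> assume k: "\<kappa> \<in> stalk I t P \<inter> stalk J t P"
    obtain n f a where f: "f \<in> forms n" "f \<notin> P" "a \<in> I" "a \<in> forms (n + t)" "emb f * \<kappa> = emb a"
      using k by (blast elim: stalkE)
    obtain m g b where g: "g \<in> forms m" "g \<notin> P" "b \<in> J" "b \<in> forms (m + t)" "emb g * \<kappa> = emb b"
      using k by (blast elim: stalkE)
    have fg: "emb (f * g) * \<kappa> = emb (g * a)" "emb (f * g) * \<kappa> = emb (f * b)"
      using f(5) g(5) by (simp_all add: emb_mult ac_simps)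
    then have ab: "g * a = f * b" by (metis emb_eq_iff)
    show "\<kappa> \<in> stalk (I \<inter> J) t P"
    proof (rule stalkI)
      show "f * g \<in> forms (n + m)" using f(1) g(1) by (rule forms_mult)
      show "f * g \<notin> P" using f(2) g(2) proj3_mult_iff[OF P] by blast
      show "g * a \<in> I \<inter> J" using f(3) g(3) I J ab by (metis IntI rmod.subspace_scale)
      show "g * a \<in> forms (n + m + t)" using forms_mult[OF g(1) f(4)] by (simp add: algebra_simps)
    qed (rule fg(1))
  qed
qed

text \<open>A form outside \<open>P\<close> is invertible at \<open>P\<close>; this undoes
  \<open>stalk_scale\<close>.\<close>

lemma stalk_cancel:
  assumes P: "P \<in> proj3" and r: "r \<in> forms e" "r \<notin> P" and k: "emb r * \<kappa> \<in> stalk I (t + e) P"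
  shows "\<kappa> \<in> stalk I t P"
proof -
  obtain n f a where f: "f \<in> forms n" "f \<notin> P" "a \<in> I" "a \<in> forms (n + (t + e))" "emb f * (emb r * \<kappa>) = emb a"
    using k by (rule stalkE)
  show ?thesis
  proof (rule stalkI)
    show "f * r \<in> forms (n + e)" using f(1) r(1) by (rule forms_mult)
    show "f * r \<notin> P" using f(2) r(2) proj3_mult_iff[OF P] by blast
    show "a \<in> forms (n + e + t)" using f(4) by (simp add: algebra_simps)
    show "emb (f * r) * \<kappa> = emb a" using f(5) by (simp add: emb_mult mult.assoc)
  qed (rule f(3))
qed

text \<open>Expanding a fraction by \<open>r\<close> moves its numerator into \<open>I\<close>: off
  its zero set an ideal has the full stalk.\<close>

lemma stalk_of_unit:
  assumes P: "P \<in> proj3" and I: "rmod.subspace I" and r: "r \<in> I" "r \<in> forms e" "r \<notin> P"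
    and k: "\<kappa> \<in> stalk UNIV t P"
  shows "\<kappa> \<in> stalk I t P"
proof -
  obtain n f a where f: "f \<in> forms n" "f \<notin> P" "a \<in> forms (n + t)" "emb f * \<kappa> = emb a"
    using k by (rule stalkE)
  show ?thesis
  proof (rule stalkI)
    show "r * f \<in> forms (e + n)" using r(2) f(1) by (rule forms_mult)
    show "r * f \<notin> P" using f(2) r(3) proj3_mult_iff[OF P] by blast
    show "a * r \<in> I" using r(1) I by (simp add: rmod.subspace_scale)
    show "a * r \<in> forms (e + n + t)" using forms_mult[OF f(3) r(2)] by (simp add: algebra_simps)
    show "emb (r * f) * \<kappa> = emb (a * r)" using f(4) by (simp add: emb_mult ac_simps)
  qed
qed

section \<open>The Zariski topology and its generic point\<close>

definition basic_open :: "'k::field poly4 \<Rightarrow> 'k poly4 set set"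
  where "basic_open f = {P \<in> proj3. f \<notin> P}"

lemma topspace_zariski [simp]: "topspace zariski = proj3"
proof -
  have "proj3 = {P \<in> proj3. 1 \<notin> P}" using proj3_one by blast
  then show ?thesis unfolding zariski_def topology_generated_by_topspace using forms_one by blast
qed

lemma openin_basic_open: "f \<in> forms n \<Longrightarrow> openin zariski (basic_open f)"
  unfolding zariski_def basic_open_def by (rule topology_generated_by_Basis) blast

lemma basic_open_mult: "basic_open (f * g) = basic_open f \<inter> basic_open g"
  by (auto simp: basic_open_def proj3_mult_iff)

text \<open>Products of forms are forms, so the generating sets are already a base. The extra
  factor, a variable outside \<open>P\<close>, makes the degree positive and hence puts the form
  into the irrelevant ideal.\<close>

lemma openin_zariski_basic:
  assumes "openin zariski U" "P \<in> U"
  obtains f n where "n > 0" "f \<in> forms n" "P \<in> basic_open f" "basic_open f \<subseteq> U"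
proof -
  have P: "P \<in> proj3" using openin_subset[OF assms(1)] assms(2) by auto
  have "\<exists>f n. f \<in> forms n \<and> P \<in> basic_open f \<and> basic_open f \<subseteq> U"
    using assms unfolding zariski_def openin_topology_generated_by_iff
  proof (induction rule: generate_topology_on.induct)
    case (Int A B)
    then obtain f m g n where "f \<in> forms m" "g \<in> forms n" "P \<in> basic_open f" "basic_open f \<subseteq> A"
      "P \<in> basic_open g" "basic_open g \<subseteq> B" by blast
    then have "f * g \<in> forms (m + n)" "P \<in> basic_open (f * g)" "basic_open (f * g) \<subseteq> A \<inter> B"
      by (auto simp: forms_mult basic_open_mult)
    then show ?case by blast
  next
    case (UN K)
    then show ?case by (meson Union_iff Union_upper subset_trans)
  next
    case (Basis S)
    then show ?case unfolding basic_open_def by blast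
  qed simp
  then obtain f n where f: "f \<in> forms n" "P \<in> basic_open f" "basic_open f \<subseteq> U" by blast
  obtain i where "pvar i \<notin> P" using proj3_var[OF P] by blast
  moreover have "n \<ge> 0"
    using forms_negative[OF _ f(1)] f(2) proj3_zero[OF P] by (force simp: basic_open_def)
  ultimately show thesis
    using f(2,3) forms_mult[OF f(1) forms_pvar] P
    by (intro that[of "n + 1" "f * pvar i"]) (auto simp: basic_open_mult, auto simp: basic_open_def)
qed

lemma generic_point: "openin zariski U \<Longrightarrow> P \<in> U \<Longrightarrow> {0} \<in> U"
proof -
  assume U: "openin zariski U" "P \<in> U"
  obtain f n where f: "P \<in> basic_open f" "basic_open f \<subseteq> U"
    using openin_zariski_basic[OF U] by blast
  then have "f \<noteq> 0" using proj3_zero by (auto simp: basic_open_def)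
  then show "{0} \<in> U" using f(2) zero_in_proj3 by (auto simp: basic_open_def)
qed

lemma stalk_open:
  assumes "\<kappa> \<in> stalk I t P" "P \<in> proj3"
  obtains V where "openin zariski V" "P \<in> V" "\<And>Q. Q \<in> V \<Longrightarrow> \<kappa> \<in> stalk I t Q"
proof -
  obtain n f a where f: "f \<in> forms n" "f \<notin> P" "a \<in> I" "a \<in> forms (n + t)" "emb f * \<kappa> = emb a"
    using assms(1) by (rule stalkE)
  show thesis
  proof (rule that[of "basic_open f"])
    show "openin zariski (basic_open f)" using f(1) by (rule openin_basic_open)
    show "P \<in> basic_open f" using f(2) assms(2) by (simp add: basic_open_def)
    show "\<kappa> \<in> stalk I t Q" if "Q \<in> basic_open f" for Q
      using that by (intro stalkI[OF f(1) _ f(3-5)]) (simp add: basic_open_def)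
  qed
qed

definition const_section :: "'p set \<Rightarrow> 'v::zero \<Rightarrow> 'p \<Rightarrow> 'v"
  where "const_section U \<kappa> = (\<lambda>P. if P \<in> U then \<kappa> else 0)"

text \<open>As the space is irreducible, all the local representations of a section agree in the function field.\<close>

lemma mem_associated_sheaf:
  "s \<in> associated_sheaf I t U \<longleftrightarrow>
    openin zariski U \<and> (\<exists>\<kappa>. s = const_section U \<kappa> \<and> (\<forall>P\<in>U. \<kappa> \<in> stalk I t P))"
proof (intro iffI conjI)
  assume s: "s \<in> associated_sheaf I t U"
  have loc: "\<exists>V n a f. openin zariski V \<and> P \<in> V \<and> V \<subseteq> U \<and> a \<in> I \<and> a \<in> forms (n + t) \<and> f \<in> forms n \<and>
      (\<forall>Q\<in>V. f \<notin> Q \<and> s Q = Fract a f)" if "P \<in> U" for P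
    using s that unfolding associated_sheaf_def by blast
  then show U: "openin zariski U" by (subst openin_subopen) blast
  have "s P = s {0} \<and> s {0} \<in> stalk I t P" if P: "P \<in> U" for P
  proof -
    obtain V n a f where V: "openin zariski V" "P \<in> V" "a \<in> I" "a \<in> forms (n + t)" "f \<in> forms n"
      "\<And>Q. Q \<in> V \<Longrightarrow> f \<notin> Q \<and> s Q = Fract a f" using loc[OF P] by blast
    have "P \<in> proj3" using openin_subset[OF V(1)] V(2) by auto
    then have "f \<noteq> 0" using V(6)[OF V(2)] proj3_zero by auto
    then have "emb f * s P = emb a" using V(6)[OF V(2)] Fract_eq_iff_emb by blast
    then have "s P \<in> stalk I t P" using V by (intro stalkI[of f n P a]) auto
    moreover have "s P = s {0}" using V(6)[OF V(2)] V(6)[OF generic_point[OF V(1,2)]] by simp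
    ultimately show ?thesis by simp
  qed
  moreover have "s P = 0" if "P \<notin> U" for P using s that unfolding associated_sheaf_def by blast
  ultimately show "\<exists>\<kappa>. s = const_section U \<kappa> \<and> (\<forall>P\<in>U. \<kappa> \<in> stalk I t P)"
    by (intro exI[of _ "s {0}"]) (auto simp: const_section_def fun_eq_iff)
next
  assume "openin zariski U \<and> (\<exists>\<kappa>. s = const_section U \<kappa> \<and> (\<forall>P\<in>U. \<kappa> \<in> stalk I t P))"
  then obtain \<kappa> where U: "openin zariski U" and s: "s = const_section U \<kappa>"
    and k: "\<And>P. P \<in> U \<Longrightarrow> \<kappa> \<in> stalk I t P" by blast
  have "\<exists>V. openin zariski V \<and> P \<in> V \<and> V \<subseteq> U \<and>
      (\<exists>n a f. a \<in> I \<and> a \<in> forms (n + t) \<and> f \<in> forms n \<and> (\<forall>Q\<in>V. f \<notin> Q \<and> s Q = Fract a f))"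
    if P: "P \<in> U" for P
  proof -
    obtain n f a where f: "f \<in> forms n" "f \<notin> P" "a \<in> I" "a \<in> forms (n + t)" "emb f * \<kappa> = emb a"
      using k[OF P] by (rule stalkE)
    have P3: "P \<in> proj3" using openin_subset[OF U] P by auto
    then have "f \<noteq> 0" using f(2) proj3_zero by auto
    then have "\<kappa> = Fract a f" using f(5) Fract_eq_iff_emb by blast
    then show ?thesis
      using f U P P3 openin_basic_open[OF f(1)]
      by (intro exI[of _ "U \<inter> basic_open f"]) (auto simp: s const_section_def basic_open_def)
  qed
  then show "s \<in> associated_sheaf I t U"
    unfolding associated_sheaf_def using s by (auto simp: const_section_def)
qed

text \<open>The twisting sheaf is trivial where the linear form \<open>x\<close> does not vanish:
  \<open>u\<close> is the power x^t in the function field, for negative \<open>t\<close> the inverse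
  of a form.\<close>

lemma invertible_element:
  assumes x: "x \<in> forms 1" "x \<noteq> 0"
  obtains u where "u \<noteq> 0"
    "\<And>Q. Q \<in> proj3 \<Longrightarrow> x \<notin> Q \<Longrightarrow> u \<in> stalk UNIV t Q"
    "\<And>Q I \<kappa>. Q \<in> proj3 \<Longrightarrow> x \<notin> Q \<Longrightarrow> rmod.subspace I \<Longrightarrow> \<kappa> \<in> stalk I t Q \<Longrightarrow> \<kappa> / u \<in> stalk I 0 Q"
proof (cases "t \<ge> 0")
  case True
  let ?y = "x ^ nat t"
  have y: "?y \<in> forms t" using forms_power[OF x(1), of "nat t"] True by simp
  show thesis
  proof (rule that[of "emb ?y"])
    show "emb ?y \<noteq> 0" using x(2) by simp
    show "emb ?y \<in> stalk UNIV t Q" if "Q \<in> proj3" for Q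
      using emb_in_stalk[OF that UNIV_I y] .
    show "\<kappa> / emb ?y \<in> stalk I 0 Q"
      if "Q \<in> proj3" "x \<notin> Q" "\<kappa> \<in> stalk I t Q" for Q I \<kappa>
    proof (rule stalk_cancel[OF that(1) y])
      show "?y \<notin> Q" using that(1,2) proj3_power_iff by blast
      show "emb ?y * (\<kappa> / emb ?y) \<in> stalk I (0 + t) Q" using that(3) x(2) by simp
    qed
  qed
next
  case False
  let ?y = "x ^ nat (- t)"
  have y: "?y \<in> forms (- t)" using forms_power[OF x(1), of "nat (- t)"] False by simp
  show thesis
  proof (rule that[of "inverse (emb ?y)"])
    show "inverse (emb ?y) \<noteq> 0" using x(2) by simp
    show "inverse (emb ?y) \<in> stalk UNIV t Q" if "Q \<in> proj3" "x \<notin> Q" for Q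
      using x(2) that proj3_power_iff by (intro stalkI[of ?y "- t" Q 1]) (auto simp: y)
    show "\<kappa> / inverse (emb ?y) \<in> stalk I 0 Q"
      if "Q \<in> proj3" "rmod.subspace I" "\<kappa> \<in> stalk I t Q" for Q I \<kappa>
      using stalk_scale[OF that(1,3) y that(2)] by (simp add: divide_inverse mult.commute)
  qed
qed

text \<open>A twist consists of local products of a section of the ideal sheaf and one of the
  twisting sheaf. Conversely, near a point outside which some variable lies, the factor
  \<open>u\<close> of \<open>invertible_element\<close> can be split off from any element of the
  stalks. So twisting \<open>subscheme_of I\<close> gives the sheaf of the module I(t).\<close>

lemma mem_twist:
  fixes I :: "'k::field poly4 set"
  assumes I: "rmod.subspace I"
  shows "s \<in> twist (subscheme_of I) t U \<longleftrightarrow>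
    openin zariski U \<and> (\<exists>\<kappa>. s = const_section U \<kappa> \<and> (\<forall>P\<in>U. \<kappa> \<in> stalk I t P))"
proof (intro iffI conjI)
  assume s: "s \<in> twist (subscheme_of I) t U"
  have loc: "\<exists>V \<kappa>. openin zariski V \<and> P \<in> V \<and> V \<subseteq> U \<and> (\<forall>Q\<in>V. s Q = \<kappa> \<and> \<kappa> \<in> stalk I t Q)"
    if P: "P \<in> U" for P
  proof -
    from s have "\<forall>P\<in>U. \<exists>V. openin zariski V \<and> P \<in> V \<and> V \<subseteq> U \<and>
        (\<exists>g\<in>associated_sheaf I 0 V. \<exists>h\<in>\<O> t V. \<forall>Q\<in>V. s Q = g Q * h Q)"
      unfolding twist_def subscheme_of_def mem_Collect_eq by (rule conjunct2)
    from bspec[OF this P] obtain V where V: "openin zariski V" "P \<in> V" "V \<subseteq> U"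
      and gh: "\<exists>g\<in>associated_sheaf I 0 V. \<exists>h\<in>\<O> t V. \<forall>Q\<in>V. s Q = g Q * h Q" by blast
    then obtain g h where gh: "g \<in> associated_sheaf I 0 V" "h \<in> \<O> t V"
      "\<And>Q. Q \<in> V \<Longrightarrow> s Q = g Q * h Q" by blast
    obtain \<kappa> \<mu> where k: "g = const_section V \<kappa>" "\<And>Q. Q \<in> V \<Longrightarrow> \<kappa> \<in> stalk I 0 Q"
      "h = const_section V \<mu>" "\<And>Q. Q \<in> V \<Longrightarrow> \<mu> \<in> stalk UNIV t Q"
      using gh(1,2) unfolding mem_associated_sheaf by blast
    have "V \<subseteq> proj3" using openin_subset[OF V(1)] by auto
    then have "\<forall>Q\<in>V. s Q = \<kappa> * \<mu> \<and> \<kappa> * \<mu> \<in> stalk I t Q"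
      using gh(3) k stalk_mult[OF _ k(2) k(4) I] by (auto simp: const_section_def)
    then show ?thesis using V(1-3) by blast
  qed
  then show U: "openin zariski U" by (subst openin_subopen) blast
  have "s P = s {0} \<and> s {0} \<in> stalk I t P" if P: "P \<in> U" for P
    using loc[OF P] generic_point by metis
  moreover have "s P = 0" if "P \<notin> U" for P using s that unfolding twist_def by blast
  ultimately show "\<exists>\<kappa>. s = const_section U \<kappa> \<and> (\<forall>P\<in>U. \<kappa> \<in> stalk I t P)"
    by (intro exI[of _ "s {0}"]) (auto simp: const_section_def fun_eq_iff)
next
  assume "openin zariski U \<and> (\<exists>\<kappa>. s = const_section U \<kappa> \<and> (\<forall>P\<in>U. \<kappa> \<in> stalk I t P))"
  then obtain \<kappa> where U: "openin zariski U" and s: "s = const_section U \<kappa>"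
    and k: "\<And>P. P \<in> U \<Longrightarrow> \<kappa> \<in> stalk I t P" by blast
  have U3: "U \<subseteq> proj3" using openin_subset[OF U] by auto
  have "\<exists>V. openin zariski V \<and> P \<in> V \<and> V \<subseteq> U \<and>
      (\<exists>g\<in>associated_sheaf I 0 V. \<exists>h\<in>associated_sheaf UNIV t V. \<forall>Q\<in>V. s Q = g Q * h Q)"
    if P: "P \<in> U" for P
  proof -
    obtain i where i: "pvar i \<notin> P" using proj3_var P U3 by blast
    obtain u :: "'k poly4 fract" where u: "u \<noteq> 0"
      "\<And>Q. Q \<in> proj3 \<Longrightarrow> pvar i \<notin> Q \<Longrightarrow> u \<in> stalk UNIV t Q"
      "\<And>Q I \<kappa>. Q \<in> proj3 \<Longrightarrow> pvar i \<notin> Q \<Longrightarrow> rmod.subspace I \<Longrightarrow> \<kappa> \<in> stalk I t Q \<Longrightarrow> \<kappa> / u \<in> stalk I 0 Q"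
      using invertible_element[OF forms_pvar pvar_nonzero] by metis
    define V where "V = U \<inter> basic_open (pvar i)"
    have V: "openin zariski V" unfolding V_def using U openin_basic_open[OF forms_pvar] by blast
    have "const_section V (\<kappa> / u) \<in> associated_sheaf I 0 V" "const_section V u \<in> associated_sheaf UNIV t V"
      unfolding mem_associated_sheaf using V u(2,3) k I by (auto simp: V_def basic_open_def)
    moreover have "\<forall>Q\<in>V. s Q = const_section V (\<kappa> / u) Q * const_section V u Q"
      using u(1) by (auto simp: s const_section_def V_def)
    moreover have "P \<in> V" "V \<subseteq> U" using P i U3 by (auto simp: V_def basic_open_def)
    ultimately show ?thesis using V by blast
  qed
  then show "s \<in> twist (subscheme_of I) t U"
    unfolding twist_def subscheme_of_def using s by (auto simp: const_section_def)
qed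

lemma mem_total_ideal:
  fixes I :: "'k::field poly4 set"
  assumes I: "rmod.subspace I"
  shows "f \<in> total_ideal (subscheme_of I) \<longleftrightarrow> (\<forall>t. \<forall>P\<in>proj3. emb (hcomp t f) \<in> stalk I t P)"
proof -
  have "(\<lambda>P. if P \<in> proj3 then Fract (hcomp t f) 1 else 0) \<in> twist (subscheme_of I) t proj3 \<longleftrightarrow>
      (\<forall>P\<in>proj3. emb (hcomp t f) \<in> stalk I t P)" for t
  proof -
    have inj: "const_section proj3 (emb (hcomp t f)) = const_section proj3 \<kappa> \<longleftrightarrow> emb (hcomp t f) = \<kappa>" for \<kappa>
      using zero_in_proj3 by (auto simp: const_section_def fun_eq_iff)
    have "openin zariski (proj3 :: 'k poly4 set set)" using openin_topspace[of zariski] by simp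
    then show ?thesis
      unfolding mem_twist[OF I] emb_def[symmetric] const_section_def[symmetric] inj by simp
  qed
  then show ?thesis unfolding total_ideal_def by simp
qed

lemma subscheme_of_Int:
  assumes "rmod.subspace I" "rmod.subspace J"
  shows "subscheme_of (I \<inter> J) = scheme_union (subscheme_of I) (subscheme_of J)"
proof (intro ext Set.set_eqI)
  fix U s
  show "s \<in> subscheme_of (I \<inter> J) U \<longleftrightarrow> s \<in> scheme_union (subscheme_of I) (subscheme_of J) U"
  proof (cases "openin zariski U")
    case True
    then have U3: "U \<subseteq> proj3" using openin_subset by fastforce
    have int: "\<kappa> \<in> stalk (I \<inter> J) 0 P \<longleftrightarrow> \<kappa> \<in> stalk I 0 P \<and> \<kappa> \<in> stalk J 0 P" if "P \<in> U" for P \<kappa>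
      using stalk_Int[OF _ assms] that U3 by blast
    show ?thesis
    proof (cases "U = {}")
      case False
      \<comment> \<open>Over the empty set \<open>const_section\<close> forgets its constant; only
        over nonempty sets can the constants obtained for the two ideals be identified.\<close>
      then have inj: "const_section U \<kappa> = const_section U \<mu> \<longleftrightarrow> \<kappa> = \<mu>" for \<kappa> \<mu> :: "'a poly4 fract"
        by (auto simp: const_section_def fun_eq_iff)
      show ?thesis
        unfolding scheme_union_def subscheme_of_def Int_iff mem_associated_sheaf
        using True int inj by auto
    qed (simp add: scheme_union_def subscheme_of_def mem_associated_sheaf)
  qed (simp add: scheme_union_def subscheme_of_def mem_associated_sheaf)
qed

text \<open>Where \<open>f\<close> does not vanish, 1 = f/f is a section of the ideal sheaf.\<close>

lemma scheme_support_subset: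
  assumes I: "rmod.subspace I" and P: "P \<in> scheme_support (subscheme_of I)" and f: "f \<in> I" "f \<in> forms n"
  shows "f \<in> P"
proof (rule ccontr)
  assume fP: "f \<notin> P"
  have "const_section (basic_open f) 1 \<in> subscheme_of I (basic_open f)"
    unfolding subscheme_of_def mem_associated_sheaf
  proof (intro conjI exI ballI)
    show "openin zariski (basic_open f)" using f(2) by (rule openin_basic_open)
    show "1 \<in> stalk I 0 Q" if "Q \<in> basic_open f" for Q
      using that f by (intro stalkI[of f n Q f]) (auto simp: basic_open_def)
  qed simp
  then show False
    using P fP openin_basic_open[OF f(2)]
    unfolding scheme_support_def const_section_def by (auto simp: basic_open_def)
qed

text \<open>Ideals of denominators will be given by a condition \<open>D n\<close> on the forms of degree \<open>n\<close>.\<close>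

lemma homogeneous_ideal_of_forms:
  fixes D :: "int \<Rightarrow> 'k::field poly4 \<Rightarrow> bool"
  assumes zero: "\<And>n. D n 0"
    and add: "\<And>n r s. D n r \<Longrightarrow> D n s \<Longrightarrow> D n (r + s)"
    and mult: "\<And>n e c r. c \<in> forms e \<Longrightarrow> D n r \<Longrightarrow> D (n + e) (c * r)"
  shows "homogeneous {r. \<forall>n. D n (hcomp n r)}"
  unfolding homogeneous_def
proof (intro conjI ballI allI)
  have D_sum: "(\<And>i. i \<in> S \<Longrightarrow> D n (f i)) \<Longrightarrow> D n (sum f S)" for n S and f :: "int \<Rightarrow> 'k poly4"
    by (induction S rule: infinite_finite_induct) (auto simp: zero intro: add)
  show "rmod.subspace {r. \<forall>n. D n (hcomp n r)}"
  proof (rule rmod.subspaceI)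
    fix c x assume x: "x \<in> {r. \<forall>n. D n (hcomp n r)}"
    have "D n (hcomp n (c * x))" for n
      unfolding hcomp_mult
    proof (rule D_sum)
      fix e
      show "D n (hcomp e c * hcomp (n - e) x)"
        using mult[OF hcomp_in_forms, of "n - e" "hcomp (n - e) x" e c] x by simp
    qed
    then show "c * x \<in> {r. \<forall>n. D n (hcomp n r)}" by simp
  qed (auto simp: zero add hcomp_add)
  show "hcomp t f \<in> {r. \<forall>n. D n (hcomp n r)}" if "f \<in> {r. \<forall>n. D n (hcomp n r)}" for f t
    using that by (simp add: hcomp_form[OF hcomp_in_forms] zero)
qed

text \<open>The forms that multiply \<kappa> into \<open>I\<close>, in the right degree, are the
  forms of a homogeneous ideal. At each point of the basic open set the denominator given by the
  stalk is an element of it outside that point, so a power of \<open>F\<close> belongs to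
  it.\<close>

lemma section_on_basic_open:
  assumes I: "rmod.subspace I" and F: "F \<in> forms e" "e > 0"
    and k: "\<And>P. P \<in> basic_open F \<Longrightarrow> \<kappa> \<in> stalk I t P"
  obtains N a where "a \<in> I" "a \<in> forms (int N * e + t)" "emb (F ^ N) * \<kappa> = emb a"
proof -
  define D where "D = (\<lambda>n r. \<exists>a\<in>I. a \<in> forms (n + t) \<and> emb r * \<kappa> = emb a)"
  have D: "homogeneous {r. \<forall>n. D n (hcomp n r)}"
  proof (rule homogeneous_ideal_of_forms)
    show "D n 0" for n unfolding D_def using rmod.subspace_0[OF I] by (intro bexI[of _ 0]) auto
    show "D n (r + s)" if rs: "D n r" "D n s" for n r s
    proof -
      obtain a b where "a \<in> I" "a \<in> forms (n + t)" "emb r * \<kappa> = emb a"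
        "b \<in> I" "b \<in> forms (n + t)" "emb s * \<kappa> = emb b" using rs unfolding D_def by blast
      then show ?thesis unfolding D_def
        by (intro bexI[of _ "a + b"]) (auto simp: forms_add emb_add distrib_right rmod.subspace_add[OF I])
    qed
    show "D (n + e) (c * r)" if c: "c \<in> forms e" and r: "D n r" for n e c r
    proof -
      obtain a where a: "a \<in> I" "a \<in> forms (n + t)" "emb r * \<kappa> = emb a" using r unfolding D_def by blast
      have "c * a \<in> forms (n + e + t)" using forms_mult[OF c a(2)] by (simp add: algebra_simps)
      moreover have "emb (c * r) * \<kappa> = emb (c * a)" using a(3) by (simp add: emb_mult mult.assoc)
      ultimately show ?thesis unfolding D_def using rmod.subspace_scale[OF I a(1)] by blast
    qed
  qed
  have "\<exists>N. F ^ N \<in> {r. \<forall>n. D n (hcomp n r)}"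
  proof (rule power_mem_if_avoided[OF D])
    show "F \<in> irrelevant_ideal" using F by (rule form_in_irrelevant)
    fix P assume P: "P \<in> proj3" "F \<notin> P"
    then have "\<kappa> \<in> stalk I t P" by (intro k) (simp add: basic_open_def)
    then obtain n f a where f: "f \<in> forms n" "f \<notin> P" "a \<in> I" "a \<in> forms (n + t)" "emb f * \<kappa> = emb a"
      by (rule stalkE)
    have "D m (hcomp m f)" for m
    proof (cases "m = n")
      case True
      then show ?thesis using f unfolding D_def by auto
    next
      case False
      then have "hcomp m f = 0" using hcomp_form[OF f(1)] by simp
      then show ?thesis unfolding D_def using rmod.subspace_0[OF I] by (intro bexI[of _ 0]) auto
    qed
    then show "\<not> {r. \<forall>n. D n (hcomp n r)} \<subseteq> P" using f(2) by blast
  qed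
  then obtain N where "D (int N * e) (hcomp (int N * e) (F ^ N))" by blast
  then show thesis using that forms_power[OF F(1), of N] unfolding D_def by auto
qed

text \<open>Powers of both \<open>G\<close> and \<open>H\<close> are denominators of \<kappa>. As
  these powers form a regular sequence, \<open>G ^ N\<close> divides its own numerator, so \<kappa>
  is a polynomial \<open>f\<close>; as \<open>G\<close> is a nonzerodivisor modulo \<open>I\<close>,
  \<open>f\<close> lies in \<open>I\<close>.\<close>

lemma global_section:
  assumes I: "rmod.subspace I" and G: "G \<in> forms e" and H: "H \<in> forms e" and e: "e > 0"
    and reg: "nzd G (rmod.span {})" "nzd H (rmod.span {G})" "nzd G I"
    and k: "\<And>P. P \<in> proj3 \<Longrightarrow> \<kappa> \<in> stalk I t P"
  obtains f where "f \<in> I" "f \<in> forms t" "\<kappa> = emb f"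
proof -
  have k': "\<kappa> \<in> stalk I t P" if "P \<in> basic_open F" for P F using k that by (simp add: basic_open_def)
  obtain N a where a: "a \<in> I" "a \<in> forms (int N * e + t)" "emb (G ^ N) * \<kappa> = emb a"
    using section_on_basic_open[OF I G e k'] .
  obtain M b where b: "emb (H ^ M) * \<kappa> = emb b"
    using section_on_basic_open[OF I H e k'] .
  have "emb (H ^ M) * emb a = emb b * emb (G ^ N)" by (simp flip: a(3) b add: ac_simps)
  then have ab: "H ^ M * a = b * G ^ N" by (simp flip: emb_mult)
  have "G \<noteq> 0" using nzdD[OF reg(1), of 1] by auto
  have "nzd (H ^ M) (rmod.span {G ^ N})"
    using nzd_power[OF nzd_span_insert_power[OF reg(1,2)]] by simp
  moreover have "H ^ M * a \<in> rmod.span {G ^ N}" unfolding ab by (intro rmod.span_scale rmod.span_base) simp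
  ultimately have "a \<in> rmod.span {G ^ N}" by (rule nzdD)
  then obtain f where f: "a = f * G ^ N" by (auto simp: rmod.span_singleton)
  have "emb (G ^ N) * \<kappa> = emb (G ^ N) * emb f" using a(3) by (simp add: f emb_mult mult.commute)
  then have "\<kappa> = emb f" using \<open>G \<noteq> 0\<close> by simp
  moreover have "G ^ N * f \<in> I" using a(1) by (simp add: f mult.commute)
  then have "f \<in> I" by (rule nzdD[OF nzd_power[OF reg(3)]])
  moreover have "a = hcomp t f * G ^ N"
  proof -
    have "a = hcomp (int N * e + t) (f * G ^ N)" using a(2) by (simp flip: f)
    then show ?thesis by (simp add: hcomp_mult_form_right[OF forms_power[OF G]])
  qed
  then have "f = hcomp t f" using \<open>G \<noteq> 0\<close> by (simp add: f)
  then have "f \<in> forms t" using hcomp_in_forms[of t f] by simp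
  ultimately show thesis using that by blast
qed

lemma total_ideal_eq:
  assumes I: "homogeneous I"
    and glob: "\<And>\<kappa> t. (\<And>P. P \<in> proj3 \<Longrightarrow> \<kappa> \<in> stalk I t P) \<Longrightarrow> \<exists>f\<in>I. \<kappa> = emb f"
  shows "total_ideal (subscheme_of I) = I"
proof (intro equalityI subsetI)
  fix f assume "f \<in> total_ideal (subscheme_of I)"
  then have "hcomp t f \<in> I" for t
    using glob[of "emb (hcomp t f)" t] by (auto simp: mem_total_ideal[OF homogeneous_subspace[OF I]])
  then show "f \<in> I" by (rule homogeneous_memI[OF I])
next
  fix f assume "f \<in> I"
  then show "f \<in> total_ideal (subscheme_of I)"
    unfolding mem_total_ideal[OF homogeneous_subspace[OF I]]
    by (intro allI ballI emb_in_stalk homogeneous_hcomp[OF I] hcomp_in_forms)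
qed

context regular_forms begin

lemma global_section_UNIV:
  fixes \<kappa> :: "'k poly4 fract"
  assumes "\<And>P. P \<in> proj3 \<Longrightarrow> \<kappa> \<in> stalk UNIV t P"
  obtains f where "f \<in> forms t" "\<kappa> = emb f"
  by (rule global_section[OF rmod.subspace_UNIV F_forms(1,2) _ reg1 reg2 nzd_UNIV assms])
    (use d_pos that in auto)

text \<open>The denominators are powers of \<open>F3\<close> and \<open>F4\<close>:
  \<open>F3\<close> is a nonzerodivisor modulo the ideal of the first curve, whereas
  \<open>F1\<close> and \<open>F2\<close> are zero there.\<close>

lemma global_section_pair:
  assumes "\<And>P. P \<in> proj3 \<Longrightarrow> \<kappa> \<in> stalk (rmod.span {F1, F2}) t P"
  obtains f where "f \<in> rmod.span {F1, F2}" "f \<in> forms t" "\<kappa> = emb f"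
proof -
  interpret x: regular_forms F3 F4 F1 F2 d by (rule regular_forms_exchange)
  show thesis
    by (rule global_section[OF rmod.subspace_span F_forms(3,4) _ x.reg1 x.reg2 reg3 assms])
      (use d_pos that in auto)
qed

lemma total_ideal_pair: "total_ideal (subscheme_of (rmod.span {F1, F2})) = rmod.span {F1, F2}"
  using homogeneous_spans(2) global_section_pair by (intro total_ideal_eq) metis+

lemma total_ideal_inter:
  "total_ideal (subscheme_of (rmod.span {F1, F2} \<inter> rmod.span {F3, F4})) = rmod.span {F1, F2} \<inter> rmod.span {F3, F4}"
proof (rule total_ideal_eq)
  interpret x: regular_forms F3 F4 F1 F2 d by (rule regular_forms_exchange)
  show "homogeneous (rmod.span {F1, F2} \<inter> rmod.span {F3, F4})"
    using homogeneous_spans by (simp add: homogeneous_Int)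
  fix \<kappa> t assume "\<And>P. P \<in> proj3 \<Longrightarrow> \<kappa> \<in> stalk (rmod.span {F1, F2} \<inter> rmod.span {F3, F4}) t P"
  then have k: "\<kappa> \<in> stalk (rmod.span {F1, F2}) t P" "\<kappa> \<in> stalk (rmod.span {F3, F4}) t P" if "P \<in> proj3" for P
    using that by (auto simp: stalk_Int)
  obtain f where "f \<in> rmod.span {F1, F2}" "\<kappa> = emb f" using global_section_pair[OF k(1)] by blast
  moreover obtain g where "g \<in> rmod.span {F3, F4}" "\<kappa> = emb g" using x.global_section_pair[OF k(2)] by blast
  ultimately show "\<exists>f\<in>rmod.span {F1, F2} \<inter> rmod.span {F3, F4}. \<kappa> = emb f" by auto
qed

lemma complete_intersection_pair: "complete_intersection 2 (subscheme_of (rmod.span {F1, F2}))"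
  unfolding complete_intersection_def
  using F_forms regular_pair total_ideal_pair by (intro exI[of _ "[F1, F2]"]) (auto simp: Idl_eq_span)

lemma disjoint_supports:
  "scheme_support (subscheme_of (rmod.span {F1, F2})) \<inter> scheme_support (subscheme_of (rmod.span {F3, F4})) = {}"
proof (rule ccontr)
  assume "\<not> ?thesis"
  then obtain P where P: "P \<in> scheme_support (subscheme_of (rmod.span {F1, F2}))"
    "P \<in> scheme_support (subscheme_of (rmod.span {F3, F4}))" by blast
  then have "P \<in> proj3" by (simp add: scheme_support_def)
  moreover have "F1 \<in> P" "F2 \<in> P" "F3 \<in> P" "F4 \<in> P"
    using scheme_support_subset[OF rmod.subspace_span P(1) rmod.span_base]
      scheme_support_subset[OF rmod.subspace_span P(2) rmod.span_base] F_forms by auto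
  ultimately show False using F_not_all_vanish by blast
qed

lemma hilbert_function_union:
  "hilbert_function (subscheme_of (rmod.span {F1, F2} \<inter> rmod.span {F3, F4})) t =
    nat (int (hilb t) - 4 * int (hilb (t - 2 * int d)) + 4 * int (hilb (t - 3 * int d)) - int (hilb (t - 4 * int d)))"
proof -
  have "rmod.span {F1, F2} \<subseteq> rmod.span {F1, F2, F3, F4}" by (rule rmod.span_mono) auto
  then have "rmod.span {F1, F2} \<inter> rmod.span {F3, F4} \<noteq> UNIV" using proper by blast
  then show ?thesis
    unfolding hilbert_function_def total_ideal_inter
    using dim_quotient[of "rmod.span {F1, F2} \<inter> rmod.span {F3, F4}" t]
    by (simp add: rmod.subspace_inter codim_union)
qed

end

section \<open>Cohomology of subsheaves of a constant sheaf\<close>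

text \<open>
  On a space with a generic point \<open>\<eta>\<close>, a Cech one-cocycle of such a sheaf is determined by the values
  \<open>g \<eta> x \<eta>\<close>. Hence the first cohomology group consists of the families of values that are locally
  constant modulo the stalks, modulo the constant families and the families of elements of the stalks.
\<close>

locale constant_subsheaf =
  fixes T :: "'p topology" and \<eta> :: 'p and S :: "'p \<Rightarrow> 'v::comm_ring set"
    and F :: "'p set \<Rightarrow> ('p \<Rightarrow> 'v) set"
  assumes \<eta>_space: "\<eta> \<in> topspace T"
    and \<eta>_generic: "openin T U \<Longrightarrow> x \<in> U \<Longrightarrow> \<eta> \<in> U"
    and S_zero: "x \<in> topspace T \<Longrightarrow> 0 \<in> S x"
    and S_diff: "x \<in> topspace T \<Longrightarrow> a \<in> S x \<Longrightarrow> b \<in> S x \<Longrightarrow> a - b \<in> S x"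
    and S_open: "x \<in> topspace T \<Longrightarrow> a \<in> S x \<Longrightarrow> \<exists>V. openin T V \<and> x \<in> V \<and> (\<forall>y\<in>V. a \<in> S y)"
    and F_iff: "openin T U \<Longrightarrow> s \<in> F U \<longleftrightarrow> (\<exists>\<kappa>. s = const_section U \<kappa> \<and> (\<forall>x\<in>U. \<kappa> \<in> S x))"
begin

text \<open>A family of this kind represents a global section of the quotient of the constant sheaf
  by \<open>F\<close>, and \<open>similar\<close> divides by the global constants. The sequence 0 ->
  F -> K -> K/F -> 0 with K constant on an irreducible space is the source of both notions.\<close>

definition consistent :: "('p \<Rightarrow> 'v) \<Rightarrow> bool"
  where "consistent \<beta> \<longleftrightarrow> (\<forall>x\<in>topspace T. \<exists>V. openin T V \<and> x \<in> V \<and> (\<forall>y\<in>V. \<beta> x - \<beta> y \<in> S y))"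

definition similar :: "('p \<Rightarrow> 'v) \<Rightarrow> ('p \<Rightarrow> 'v) \<Rightarrow> bool"
  where "similar \<beta> \<gamma> \<longleftrightarrow> (\<exists>\<kappa>. \<forall>x\<in>topspace T. \<beta> x - \<gamma> x - \<kappa> \<in> S x)"

definition coh_class :: "('p \<Rightarrow> 'v) \<Rightarrow> ('p, 'v) cochain set"
  where "coh_class \<beta> = {(N, g) \<in> cech_cocycles T F. similar (\<lambda>x. g \<eta> x \<eta>) \<beta>}"

lemma S_uminus: "x \<in> topspace T \<Longrightarrow> a \<in> S x \<Longrightarrow> - a \<in> S x"
  using S_diff[OF _ S_zero] by force

lemma S_add: "x \<in> topspace T \<Longrightarrow> a \<in> S x \<Longrightarrow> b \<in> S x \<Longrightarrow> a + b \<in> S x"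
  using S_diff[OF _ _ S_uminus, of x a b] by simp

lemma similar_refl: "similar \<beta> \<beta>"
  unfolding similar_def using S_zero by (intro exI[of _ 0]) simp

lemma similar_sym:
  assumes "similar \<beta> \<gamma>"
  shows "similar \<gamma> \<beta>"
proof -
  obtain \<kappa> where k: "\<And>x. x \<in> topspace T \<Longrightarrow> \<beta> x - \<gamma> x - \<kappa> \<in> S x"
    using assms unfolding similar_def by blast
  have "\<gamma> x - \<beta> x - (- \<kappa>) \<in> S x" if "x \<in> topspace T" for x
    using S_uminus[OF that k[OF that]] by (simp add: algebra_simps)
  then show ?thesis unfolding similar_def by blast
qed

lemma similar_add:
  assumes "similar \<beta> \<gamma>" "similar \<beta>' \<gamma>'"
  shows "similar (\<lambda>x. \<beta> x + \<beta>' x) (\<lambda>x. \<gamma> x + \<gamma>' x)"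
proof -
  obtain \<kappa> \<mu> where k: "\<And>x. x \<in> topspace T \<Longrightarrow> \<beta> x - \<gamma> x - \<kappa> \<in> S x"
    "\<And>x. x \<in> topspace T \<Longrightarrow> \<beta>' x - \<gamma>' x - \<mu> \<in> S x"
    using assms unfolding similar_def by blast
  have "(\<beta> x + \<beta>' x) - (\<gamma> x + \<gamma>' x) - (\<kappa> + \<mu>) \<in> S x" if "x \<in> topspace T" for x
    using S_add[OF that k(1)[OF that] k(2)[OF that]] by (simp add: algebra_simps)
  then show ?thesis unfolding similar_def by blast
qed

lemma similar_trans:
  assumes "similar \<alpha> \<beta>" "similar \<beta> \<gamma>"
  shows "similar \<alpha> \<gamma>"
proof -
  obtain \<kappa> \<mu> where k: "\<And>x. x \<in> topspace T \<Longrightarrow> \<alpha> x - \<beta> x - \<kappa> \<in> S x"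
    "\<And>x. x \<in> topspace T \<Longrightarrow> \<beta> x - \<gamma> x - \<mu> \<in> S x"
    using assms unfolding similar_def by blast
  have "\<alpha> x - \<gamma> x - (\<kappa> + \<mu>) \<in> S x" if "x \<in> topspace T" for x
    using S_add[OF that k(1)[OF that] k(2)[OF that]] by (simp add: algebra_simps)
  then show ?thesis unfolding similar_def by blast
qed

lemma const_section_mem:
  "openin T U \<Longrightarrow> (\<And>x. x \<in> U \<Longrightarrow> \<kappa> \<in> S x) \<Longrightarrow> const_section U \<kappa> \<in> F U"
  by (subst F_iff) auto

lemma section_value:
  assumes "openin T U" "x \<in> U" "s \<in> F U"
  shows "s = const_section U (s \<eta>)" and "y \<in> U \<Longrightarrow> s \<eta> \<in> S y"
proof -
  obtain \<kappa> where k: "s = const_section U \<kappa>" "\<forall>x\<in>U. \<kappa> \<in> S x" using assms by (auto simp: F_iff)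
  have "s \<eta> = \<kappa>" using \<eta>_generic[OF assms(1,2)] by (simp add: k(1) const_section_def)
  then show "s = const_section U (s \<eta>)" "y \<in> U \<Longrightarrow> s \<eta> \<in> S y" using k by auto
qed

lemma point_coverD:
  assumes "point_cover T N" "x \<in> topspace T"
  shows "openin T (N x)" "x \<in> N x" "\<eta> \<in> N x" "N x \<subseteq> topspace T"
  using assms \<eta>_generic openin_subset unfolding point_cover_def by blast+

text \<open>The cocycle rule for the indices \<eta>, \<open>x\<close>, \<open>y\<close>, evaluated
  at \<eta>, expresses the generic germ of \<open>g x y\<close> as a difference; the generic point
  serves both as an index of the cover and as the place of evaluation.\<close>

lemma cocycleD:
  assumes "(N, g) \<in> cech_cocycles T F"
  shows "point_cover T N"
    and "x \<in> topspace T \<Longrightarrow> y \<in> topspace T \<Longrightarrow>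
      g x y = const_section (N x \<inter> N y) (g \<eta> y \<eta> - g \<eta> x \<eta>)"
    and "x \<in> topspace T \<Longrightarrow> y \<in> topspace T \<Longrightarrow> q \<in> N x \<inter> N y \<Longrightarrow> g \<eta> y \<eta> - g \<eta> x \<eta> \<in> S q"
proof -
  show N: "point_cover T N" using assms by (simp add: cech_cocycles_def)
  have *: "g x y = const_section (N x \<inter> N y) (g \<eta> y \<eta> - g \<eta> x \<eta>) \<and>
      (\<forall>q\<in>N x \<inter> N y. g \<eta> y \<eta> - g \<eta> x \<eta> \<in> S q)" if xy: "x \<in> topspace T" "y \<in> topspace T" for x y
  proof -
    have sec: "g x y \<in> F (N x \<inter> N y)" using assms xy by (simp add: cech_cocycles_def)
    have "g \<eta> x q + g x y q = g \<eta> y q" if "q \<in> N \<eta> \<inter> N x \<inter> N y" for q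
      using assms xy \<eta>_space that by (simp add: cech_cocycles_def)
    then have "g \<eta> x \<eta> + g x y \<eta> = g \<eta> y \<eta>" using point_coverD[OF N] \<eta>_space xy by simp
    then have val: "g x y \<eta> = g \<eta> y \<eta> - g \<eta> x \<eta>" by (simp add: algebra_simps)
    have "openin T (N x \<inter> N y)" "\<eta> \<in> N x \<inter> N y" using point_coverD[OF N] xy by auto
    from section_value[OF this sec] show ?thesis unfolding val by blast
  qed
  show "x \<in> topspace T \<Longrightarrow> y \<in> topspace T \<Longrightarrow> g x y = const_section (N x \<inter> N y) (g \<eta> y \<eta> - g \<eta> x \<eta>)"
    using * by blast
  show "x \<in> topspace T \<Longrightarrow> y \<in> topspace T \<Longrightarrow> q \<in> N x \<inter> N y \<Longrightarrow> g \<eta> y \<eta> - g \<eta> x \<eta> \<in> S q"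
    using * by blast
qed

lemma cocycleI:
  assumes N: "point_cover T N"
    and g: "\<And>x y. x \<in> topspace T \<Longrightarrow> y \<in> topspace T \<Longrightarrow> g x y = const_section (N x \<inter> N y) (\<beta> y - \<beta> x)"
    and S: "\<And>x y q. x \<in> topspace T \<Longrightarrow> y \<in> topspace T \<Longrightarrow> q \<in> N x \<inter> N y \<Longrightarrow> \<beta> y - \<beta> x \<in> S q"
  shows "(N, g) \<in> cech_cocycles T F"
  unfolding cech_cocycles_def
proof (intro CollectI case_prodI conjI ballI N)
  fix x y assume xy: "x \<in> topspace T" "y \<in> topspace T"
  then have "openin T (N x \<inter> N y)" using point_coverD[OF N] by blast
  then show "g x y \<in> F (N x \<inter> N y)"
    unfolding g[OF xy] using S[OF xy] by (rule const_section_mem)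
qed (simp add: g const_section_def)

text \<open>Comparing a coboundary at \<eta> for the indices \<eta> and \<open>x\<close> gives the
  constant \<open>- c \<eta> \<eta>\<close>. Conversely, membership in the stalk at \<open>x\<close>
  spreads to a neighbourhood by \<open>S_open\<close>, and intersecting with these neighbourhoods
  gives the common refinement.\<close>

lemma cohomologous_iff:
  "((N, g), (N', h)) \<in> cohomologous T F \<longleftrightarrow>
    (N, g) \<in> cech_cocycles T F \<and> (N', h) \<in> cech_cocycles T F \<and> similar (\<lambda>x. g \<eta> x \<eta>) (\<lambda>x. h \<eta> x \<eta>)"
proof (intro iffI conjI)
  assume A: "((N, g), (N', h)) \<in> cohomologous T F"
  then show "(N, g) \<in> cech_cocycles T F" "(N', h) \<in> cech_cocycles T F" by (auto simp: cohomologous_def)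
  have "\<exists>N'' c. point_cover T N'' \<and> (\<forall>x\<in>topspace T. N'' x \<subseteq> N x \<inter> N' x \<and> c x \<in> F (N'' x)) \<and>
      (\<forall>x\<in>topspace T. \<forall>y\<in>topspace T. \<forall>q\<in>N'' x \<inter> N'' y. g x y q - h x y q = c y q - c x q)"
    using A by (simp add: cohomologous_def)
  then obtain N'' c where N'': "point_cover T N''" and c: "\<And>x. x \<in> topspace T \<Longrightarrow> c x \<in> F (N'' x)"
    and eq: "\<And>x y q. x \<in> topspace T \<Longrightarrow> y \<in> topspace T \<Longrightarrow> q \<in> N'' x \<inter> N'' y \<Longrightarrow> g x y q - h x y q = c y q - c x q"
    by blast
  have "g \<eta> x \<eta> - h \<eta> x \<eta> - (- c \<eta> \<eta>) \<in> S x" if x: "x \<in> topspace T" for x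
  proof -
    have "g \<eta> x \<eta> - h \<eta> x \<eta> = c x \<eta> - c \<eta> \<eta>"
      using eq[OF \<eta>_space x] point_coverD[OF N''] \<eta>_space x by blast
    then have "g \<eta> x \<eta> - h \<eta> x \<eta> - (- c \<eta> \<eta>) = c x \<eta>" by simp
    also have "\<dots> \<in> S x"
      using section_value(2)[OF _ _ c[OF x]] point_coverD[OF N'' x] by blast
    finally show ?thesis .
  qed
  then show "similar (\<lambda>x. g \<eta> x \<eta>) (\<lambda>x. h \<eta> x \<eta>)" unfolding similar_def by blast
next
  assume A: "(N, g) \<in> cech_cocycles T F \<and> (N', h) \<in> cech_cocycles T F \<and> similar (\<lambda>x. g \<eta> x \<eta>) (\<lambda>x. h \<eta> x \<eta>)"
  then have g: "(N, g) \<in> cech_cocycles T F" and h: "(N', h) \<in> cech_cocycles T F" by auto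
  define f where "f = (\<lambda>x. g \<eta> x \<eta> - h \<eta> x \<eta>)"
  obtain \<kappa> where k: "\<And>x. x \<in> topspace T \<Longrightarrow> f x - \<kappa> \<in> S x"
    using A unfolding similar_def f_def by blast
  have "\<forall>x\<in>topspace T. \<exists>V. openin T V \<and> x \<in> V \<and> (\<forall>y\<in>V. f x - \<kappa> \<in> S y)"
    using S_open[OF _ k] by simp
  from bchoice[OF this] obtain V
    where V: "\<forall>x\<in>topspace T. openin T (V x) \<and> x \<in> V x \<and> (\<forall>y\<in>V x. f x - \<kappa> \<in> S y)" by blast
  define N'' where "N'' = (\<lambda>x. N x \<inter> N' x \<inter> V x)"
  define c where "c = (\<lambda>x. const_section (N'' x) (f x - \<kappa>))"
  have N'': "point_cover T N''"
    using cocycleD(1)[OF g] cocycleD(1)[OF h] V unfolding point_cover_def N''_def by blast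
  have "c x \<in> F (N'' x)" if "x \<in> topspace T" for x
    unfolding c_def using point_coverD(1)[OF N'' that]
    by (rule const_section_mem) (use V that in \<open>auto simp: N''_def\<close>)
  moreover have "g x y q - h x y q = c y q - c x q"
    if "x \<in> topspace T" "y \<in> topspace T" "q \<in> N'' x \<inter> N'' y" for x y q
    using that(3) unfolding cocycleD(2)[OF g that(1,2)] cocycleD(2)[OF h that(1,2)] c_def
    by (simp add: const_section_def N''_def f_def)
  moreover have "N'' x \<subseteq> N x \<inter> N' x" for x unfolding N''_def by blast
  ultimately have "point_cover T N'' \<and> (\<forall>x\<in>topspace T. N'' x \<subseteq> N x \<inter> N' x \<and> c x \<in> F (N'' x)) \<and>
      (\<forall>x\<in>topspace T. \<forall>y\<in>topspace T. \<forall>q\<in>N'' x \<inter> N'' y. g x y q - h x y q = c y q - c x q)"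
    using N'' by simp
  then show "((N, g), (N', h)) \<in> cohomologous T F"
    unfolding cohomologous_def using g h by (intro CollectI case_prodI conjI) blast+
qed

lemma coh_class_eq_Image:
  assumes "(N, g) \<in> coh_class \<beta>"
  shows "cohomologous T F `` {(N, g)} = coh_class \<beta>"
proof -
  have g: "(N, g) \<in> cech_cocycles T F" "similar (\<lambda>x. g \<eta> x \<eta>) \<beta>"
    using assms by (auto simp: coh_class_def)
  have "similar (\<lambda>x. g \<eta> x \<eta>) (\<lambda>x. h \<eta> x \<eta>) \<longleftrightarrow> similar (\<lambda>x. h \<eta> x \<eta>) \<beta>" for h :: "'p \<Rightarrow> 'p \<Rightarrow> 'p \<Rightarrow> 'v"
    using g(2) similar_trans similar_sym by blast
  then have "(N', h) \<in> cohomologous T F `` {(N, g)} \<longleftrightarrow> (N', h) \<in> coh_class \<beta>" for N' h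
    using g(1) by (simp add: coh_class_def cohomologous_iff)
  then show ?thesis by (intro Set.set_eqI) (metis surj_pair)
qed

lemma consistent_germ:
  assumes "(N, g) \<in> cech_cocycles T F"
  shows "consistent (\<lambda>x. g \<eta> x \<eta>)"
  unfolding consistent_def
proof
  fix x assume x: "x \<in> topspace T"
  note N = cocycleD(1)[OF assms]
  have "g \<eta> x \<eta> - g \<eta> y \<eta> \<in> S y" if "y \<in> N x" for y
  proof -
    have y: "y \<in> topspace T" using that point_coverD(4)[OF N x] by blast
    then show ?thesis using cocycleD(3)[OF assms y x] that point_coverD(2)[OF N y] by blast
  qed
  then show "\<exists>V. openin T V \<and> x \<in> V \<and> (\<forall>y\<in>V. g \<eta> x \<eta> - g \<eta> y \<eta> \<in> S y)"
    using point_coverD[OF N x] by blast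
qed

lemma coh_class_nonempty:
  assumes "consistent \<beta>"
  obtains N g where "(N, g) \<in> coh_class \<beta>"
proof -
  have "\<forall>x. \<exists>V. x \<in> topspace T \<longrightarrow> openin T V \<and> x \<in> V \<and> (\<forall>y\<in>V. \<beta> x - \<beta> y \<in> S y)"
    using assms unfolding consistent_def by blast
  then obtain N where N: "\<And>x. x \<in> topspace T \<Longrightarrow> openin T (N x) \<and> x \<in> N x \<and> (\<forall>y\<in>N x. \<beta> x - \<beta> y \<in> S y)"
    by metis
  define g where "g = (\<lambda>x y. const_section (N x \<inter> N y) (\<beta> y - \<beta> x))"
  have cover: "point_cover T N" using N unfolding point_cover_def by blast
  have "(N, g) \<in> cech_cocycles T F"
  proof (rule cocycleI[OF cover])
    fix x y q assume xy: "x \<in> topspace T" "y \<in> topspace T" "q \<in> N x \<inter> N y"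
    then have "q \<in> topspace T" using point_coverD(4)[OF cover] by blast
    then have "(\<beta> x - \<beta> q) - (\<beta> y - \<beta> q) \<in> S q"
      using N xy by (intro S_diff[of q "\<beta> x - \<beta> q" "\<beta> y - \<beta> q"]) auto
    from S_uminus[OF \<open>q \<in> topspace T\<close> this] have "\<beta> y - \<beta> x \<in> S q" by simp
    then show "\<beta> y - \<beta> x \<in> S q" by simp
  qed (simp add: g_def)
  \<comment> \<open>The germs of this cocycle are \<open>\<beta> x - \<beta> \<eta>\<close>, which
    differ from \<beta> by a constant.\<close>
  moreover have "similar (\<lambda>x. g \<eta> x \<eta>) \<beta>"
    unfolding similar_def
    using point_coverD(3)[OF cover] \<eta>_space S_zero
    by (intro exI[of _ "- \<beta> \<eta>"]) (simp add: g_def const_section_def)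
  ultimately show thesis using that by (simp add: coh_class_def)
qed

lemma coh_class_eq_iff:
  assumes "consistent \<beta>"
  shows "coh_class \<beta> = coh_class \<gamma> \<longleftrightarrow> similar \<beta> \<gamma>"
proof
  assume eq: "coh_class \<beta> = coh_class \<gamma>"
  obtain N g where "(N, g) \<in> coh_class \<beta>" using coh_class_nonempty[OF assms] .
  then have "similar (\<lambda>x. g \<eta> x \<eta>) \<beta>" "similar (\<lambda>x. g \<eta> x \<eta>) \<gamma>"
    using eq by (auto simp: coh_class_def)
  then show "similar \<beta> \<gamma>" using similar_trans similar_sym by blast
next
  assume "similar \<beta> \<gamma>"
  then have "similar f \<beta> \<longleftrightarrow> similar f \<gamma>" for f
    using similar_trans similar_sym by blast
  then show "coh_class \<beta> = coh_class \<gamma>" by (simp add: coh_class_def)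
qed

lemma carrier_H1: "carrier (H1 T F) = coh_class ` {\<beta>. consistent \<beta>}"
proof (intro equalityI subsetI)
  fix \<alpha> assume "\<alpha> \<in> carrier (H1 T F)"
  then obtain N g where g: "(N, g) \<in> cech_cocycles T F" "\<alpha> = cohomologous T F `` {(N, g)}"
    by (auto simp: H1_def elim!: quotientE)
  then have "(N, g) \<in> coh_class (\<lambda>x. g \<eta> x \<eta>)" using similar_refl by (simp add: coh_class_def)
  then have "\<alpha> = coh_class (\<lambda>x. g \<eta> x \<eta>)" using g(2) coh_class_eq_Image by simp
  then show "\<alpha> \<in> coh_class ` {\<beta>. consistent \<beta>}" using consistent_germ[OF g(1)] by blast
next
  fix \<alpha> assume "\<alpha> \<in> coh_class ` {\<beta>. consistent \<beta>}"
  then obtain \<beta> where b: "consistent \<beta>" "\<alpha> = coh_class \<beta>" by blast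
  obtain N g where g: "(N, g) \<in> coh_class \<beta>" using coh_class_nonempty[OF b(1)] .
  then have "(N, g) \<in> cech_cocycles T F" by (simp add: coh_class_def)
  moreover have "\<alpha> = cohomologous T F `` {(N, g)}" using coh_class_eq_Image[OF g] b(2) by simp
  ultimately show "\<alpha> \<in> carrier (H1 T F)" by (auto simp: H1_def intro: quotientI)
qed

lemma cochain_add_mem:
  assumes "(N, g) \<in> coh_class \<beta>" "(N', h) \<in> coh_class \<gamma>"
  shows "cochain_add (N, g) (N', h) \<in> coh_class (\<lambda>x. \<beta> x + \<gamma> x)"
proof -
  have g: "(N, g) \<in> cech_cocycles T F" "similar (\<lambda>x. g \<eta> x \<eta>) \<beta>"
    and h: "(N', h) \<in> cech_cocycles T F" "similar (\<lambda>x. h \<eta> x \<eta>) \<gamma>"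
    using assms by (auto simp: coh_class_def)
  define M where "M = (\<lambda>x. N x \<inter> N' x)"
  define s where "s = (\<lambda>x y q. if q \<in> M x \<inter> M y then g x y q + h x y q else 0)"
  have add: "cochain_add (N, g) (N', h) = (M, s)" by (simp add: M_def s_def)
  have M: "point_cover T M"
    using cocycleD(1)[OF g(1)] cocycleD(1)[OF h(1)] unfolding point_cover_def M_def by blast
  have germ: "s \<eta> x \<eta> = g \<eta> x \<eta> + h \<eta> x \<eta>" if "x \<in> topspace T" for x
    using point_coverD(3)[OF M] that \<eta>_space by (simp add: s_def)
  have "(M, s) \<in> cech_cocycles T F"
  proof (rule cocycleI[OF M])
    fix x y assume xy: "x \<in> topspace T" "y \<in> topspace T"
    show "s x y = const_section (M x \<inter> M y)
        ((g \<eta> y \<eta> + h \<eta> y \<eta>) - (g \<eta> x \<eta> + h \<eta> x \<eta>))"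
      using cocycleD(2)[OF g(1) xy] cocycleD(2)[OF h(1) xy]
      by (auto simp: s_def const_section_def M_def fun_eq_iff)
    fix q assume q: "q \<in> M x \<inter> M y"
    then have "q \<in> topspace T" using point_coverD(4)[OF M xy(1)] by blast
    then have "(g \<eta> y \<eta> - g \<eta> x \<eta>) + (h \<eta> y \<eta> - h \<eta> x \<eta>) \<in> S q"
      using q cocycleD(3)[OF g(1) xy] cocycleD(3)[OF h(1) xy] by (intro S_add) (auto simp: M_def)
    then show "(g \<eta> y \<eta> + h \<eta> y \<eta>) - (g \<eta> x \<eta> + h \<eta> x \<eta>) \<in> S q"
      by (simp add: algebra_simps)
  qed
  moreover have "similar (\<lambda>x. s \<eta> x \<eta>) (\<lambda>x. \<beta> x + \<gamma> x)"
  proof -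
    obtain \<kappa> where k: "\<And>x. x \<in> topspace T \<Longrightarrow> (g \<eta> x \<eta> + h \<eta> x \<eta>) - (\<beta> x + \<gamma> x) - \<kappa> \<in> S x"
      using similar_add[OF g(2) h(2)] unfolding similar_def by blast
    then have "s \<eta> x \<eta> - (\<beta> x + \<gamma> x) - \<kappa> \<in> S x" if "x \<in> topspace T" for x
      using that by (simp add: germ)
    then show ?thesis unfolding similar_def by blast
  qed
  ultimately show ?thesis unfolding add coh_class_def by simp
qed

lemma mult_H1:
  assumes "consistent \<beta>" "consistent \<gamma>"
  shows "coh_class \<beta> \<otimes>\<^bsub>H1 T F\<^esub> coh_class \<gamma> = coh_class (\<lambda>x. \<beta> x + \<gamma> x)"
proof -
  have "cohomologous T F `` {cochain_add a b} = coh_class (\<lambda>x. \<beta> x + \<gamma> x)"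
    if "a \<in> coh_class \<beta>" "b \<in> coh_class \<gamma>" for a b
    using that cochain_add_mem[of "fst a" "snd a" \<beta> "fst b" "snd b" \<gamma>]
      coh_class_eq_Image[of "fst (cochain_add a b)" "snd (cochain_add a b)"] by simp
  moreover obtain a where "a \<in> coh_class \<beta>" using coh_class_nonempty[OF assms(1)] by blast
  moreover obtain b where "b \<in> coh_class \<gamma>" using coh_class_nonempty[OF assms(2)] by blast
  ultimately have "(\<Union>a\<in>coh_class \<beta>. \<Union>b\<in>coh_class \<gamma>. cohomologous T F `` {cochain_add a b}) =
      coh_class (\<lambda>x. \<beta> x + \<gamma> x)"
    by (intro UN_constant_eq ballI) auto
  then show ?thesis by (simp add: H1_def)
qed

lemma one_H1: "\<one>\<^bsub>H1 T F\<^esub> = coh_class (\<lambda>x. 0)"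
proof -
  have "((\<lambda>_. topspace T), \<lambda>_ _ _. 0) \<in> cech_cocycles T F"
    by (rule cocycleI[where \<beta> = "\<lambda>_. 0"])
      (auto simp: point_cover_def const_section_def S_zero)
  then have "((\<lambda>_. topspace T), \<lambda>_ _ _. 0) \<in> coh_class (\<lambda>x. 0)"
    using similar_refl by (simp add: coh_class_def)
  from coh_class_eq_Image[OF this] show ?thesis by (simp add: H1_def)
qed

end

lemma H1_scale_coh_class:
  assumes F: "constant_subsheaf T \<eta> S F" and G: "constant_subsheaf T \<eta> S' G"
    and v: "\<And>x a. x \<in> topspace T \<Longrightarrow> a \<in> S x \<Longrightarrow> v * a \<in> S' x"
    and \<beta>: "constant_subsheaf.consistent T S \<beta>"
  shows "H1_scale T G v (constant_subsheaf.coh_class T \<eta> S F \<beta>) =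
    constant_subsheaf.coh_class T \<eta> S' G (\<lambda>x. v * \<beta> x)"
proof -
  interpret F: constant_subsheaf T \<eta> S F by (rule F)
  interpret G: constant_subsheaf T \<eta> S' G by (rule G)
  have "cohomologous T G `` {(N, \<lambda>x y q. v * g x y q)} = G.coh_class (\<lambda>x. v * \<beta> x)"
    if g: "(N, g) \<in> F.coh_class \<beta>" for N g
  proof (rule G.coh_class_eq_Image)
    have g: "(N, g) \<in> cech_cocycles T F" "F.similar (\<lambda>x. g \<eta> x \<eta>) \<beta>"
      using g by (auto simp: F.coh_class_def)
    note N = F.cocycleD(1)[OF g(1)]
    have "(N, \<lambda>x y q. v * g x y q) \<in> cech_cocycles T G"
    proof (rule G.cocycleI[OF N])
      fix x y assume xy: "x \<in> topspace T" "y \<in> topspace T"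
      show "(\<lambda>q. v * g x y q) = const_section (N x \<inter> N y) (v * g \<eta> y \<eta> - v * g \<eta> x \<eta>)"
        unfolding F.cocycleD(2)[OF g(1) xy] by (auto simp: const_section_def right_diff_distrib)
      fix q assume q: "q \<in> N x \<inter> N y"
      then have "q \<in> topspace T" using F.point_coverD(4)[OF N xy(1)] by blast
      then show "v * g \<eta> y \<eta> - v * g \<eta> x \<eta> \<in> S' q"
        using v[OF _ F.cocycleD(3)[OF g(1) xy q]] by (simp add: right_diff_distrib)
    qed
    moreover have "G.similar (\<lambda>x. v * g \<eta> x \<eta>) (\<lambda>x. v * \<beta> x)"
    proof -
      obtain \<kappa> where k: "\<And>x. x \<in> topspace T \<Longrightarrow> g \<eta> x \<eta> - \<beta> x - \<kappa> \<in> S x"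
        using g(2) unfolding F.similar_def by blast
      have "v * g \<eta> x \<eta> - v * \<beta> x - v * \<kappa> \<in> S' x" if "x \<in> topspace T" for x
        using v[OF that k[OF that]] by (simp add: right_diff_distrib)
      then show ?thesis unfolding G.similar_def by blast
    qed
    ultimately show "(N, \<lambda>x y q. v * g x y q) \<in> G.coh_class (\<lambda>x. v * \<beta> x)"
      by (simp add: G.coh_class_def)
  qed
  moreover obtain N g where "(N, g) \<in> F.coh_class \<beta>" using F.coh_class_nonempty[OF \<beta>] .
  ultimately show ?thesis unfolding H1_scale_def by (intro UN_constant_eq) auto
qed

section \<open>The first cohomology of the twisted ideal sheaves\<close>

lemma constant_subsheaf_twist:
  fixes I :: "'k::field poly4 set"
  assumes I: "rmod.subspace I"
  shows "constant_subsheaf zariski {0} (stalk I t) (twist (subscheme_of I) t)"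
proof
  show "{0} \<in> topspace (zariski :: 'k poly4 set topology)" by (simp add: zero_in_proj3)
  show "{0} \<in> U" if "openin zariski U" "P \<in> U" for U and P :: "'k poly4 set"
    using that by (rule generic_point)
  show "0 \<in> stalk I t P" if "P \<in> topspace zariski" for P
    using that I stalk_zero by simp
  show "a - b \<in> stalk I t P" if "P \<in> topspace zariski" "a \<in> stalk I t P" "b \<in> stalk I t P" for P a b
    using that I stalk_diff by simp
  show "\<exists>V. openin zariski V \<and> P \<in> V \<and> (\<forall>Q\<in>V. a \<in> stalk I t Q)"
    if P: "P \<in> topspace zariski" "a \<in> stalk I t P" for P a
  proof -
    have "P \<in> proj3" using P(1) by simp
    with P(2) show ?thesis
    proof (rule stalk_open)
      fix V assume V: "openin zariski V" "P \<in> V" "\<And>Q. Q \<in> V \<Longrightarrow> a \<in> stalk I t Q"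
      then show ?thesis by blast
    qed
  qed
  show "s \<in> twist (subscheme_of I) t U \<longleftrightarrow> (\<exists>\<kappa>. s = const_section U \<kappa> \<and> (\<forall>x\<in>U. \<kappa> \<in> stalk I t x))"
    if "openin zariski U" for U s
    unfolding mem_twist[OF I] using that by blast
qed

definition locally_constant_mod :: "'k::field poly4 set \<Rightarrow> int \<Rightarrow> ('k poly4 set \<Rightarrow> 'k poly4 fract) \<Rightarrow> bool"
  where "locally_constant_mod I t \<beta> \<longleftrightarrow>
    (\<forall>P\<in>proj3. \<exists>V. openin zariski V \<and> P \<in> V \<and> (\<forall>Q\<in>V. \<beta> P - \<beta> Q \<in> stalk I t Q))"

lemma locally_constant_mod_mono:
  fixes I J :: "'k::field poly4 set"
  assumes IJ: "I \<subseteq> J" and \<beta>: "locally_constant_mod I t \<beta>"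
  shows "locally_constant_mod J t \<beta>"
  unfolding locally_constant_mod_def
proof
  fix P :: "'k poly4 set" assume "P \<in> proj3"
  then obtain V where "openin zariski V" "P \<in> V" "\<forall>Q\<in>V. \<beta> P - \<beta> Q \<in> stalk I t Q"
    using \<beta> unfolding locally_constant_mod_def by meson
  then show "\<exists>V. openin zariski V \<and> P \<in> V \<and> (\<forall>Q\<in>V. \<beta> P - \<beta> Q \<in> stalk J t Q)"
    using subsetD[OF stalk_mono[OF IJ]] by (intro exI[of _ V] conjI ballI) simp_all
qed

text \<open>Exactness of the Koszul cochain complex on four elements at its second step, where three
  regular elements provide enough depth. The relation for the indices 1, 2, 3 puts
  \<open>b12\<close> into the ideal of \<open>f1\<close>, \<open>f2\<close>, which gives
  \<open>r1\<close> and \<open>r2\<close>; a syzygy of \<open>f1\<close>, \<open>f2\<close> then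
  yields each of \<open>r3\<close> and \<open>r4\<close>.\<close>

lemma koszul_syzygies:
  fixes f1 f2 f3 f4 :: "'a::comm_ring_1"
  assumes n1: "nzd f1 (rmod.span {})" and n2: "nzd f2 (rmod.span {f1})" and n3: "nzd f3 (rmod.span {f1, f2})"
    and e123: "b12 * f3 + b23 * f1 = b13 * f2"
    and e124: "b12 * f4 + b24 * f1 = b14 * f2"
    and e134: "b13 * f4 + b34 * f1 = b14 * f3"
  obtains r1 r2 r3 r4 where
    "b12 = f2 * r1 - f1 * r2" "b13 = f3 * r1 - f1 * r3" "b14 = f4 * r1 - f1 * r4"
    "b23 = f3 * r2 - f2 * r3" "b24 = f4 * r2 - f2 * r4" "b34 = f4 * r3 - f3 * r4"
proof -
  have "f3 * b12 = - b23 * f1 + b13 * f2" using e123 by (simp add: algebra_simps eq_diff_eq)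
  then have "f3 * b12 \<in> rmod.span {f1, f2}" unfolding mem_span_pair by blast
  then have "b12 \<in> rmod.span {f1, f2}" by (rule nzdD[OF n3])
  then obtain p q where pq: "b12 = p * f1 + q * f2" unfolding mem_span_pair by blast
  define r1 r2 where "r1 = q" and "r2 = - p"
  have b12: "b12 = f2 * r1 - f1 * r2" by (simp add: pq r1_def r2_def algebra_simps)
  have solve: "\<exists>r. c1 = f * r1 - f1 * r \<and> c2 = f * r2 - f2 * r" if "b12 * f + c2 * f1 = c1 * f2" for c1 c2 f
  proof -
    have "f1 * (c2 - f * r2) + f2 * (f * r1 - c1) = b12 * f + c2 * f1 - c1 * f2"
      by (simp add: b12 algebra_simps)
    then have "f1 * (c2 - f * r2) + f2 * (f * r1 - c1) \<in> rmod.span {}" using that by simp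
    then obtain r where "(f * r1 - c1) - f1 * r \<in> rmod.span {}" "(c2 - f * r2) + f2 * r \<in> rmod.span {}"
      using syzygy[OF n1 n2] by blast
    then have "c1 = f * r1 - f1 * r" "c2 = f * r2 - f2 * r" by (simp_all add: algebra_simps eq_neg_iff_add_eq_0)
    then show ?thesis by blast
  qed
  obtain r3 where r3: "b13 = f3 * r1 - f1 * r3" "b23 = f3 * r2 - f2 * r3" using solve[OF e123] by blast
  obtain r4 where r4: "b14 = f4 * r1 - f1 * r4" "b24 = f4 * r2 - f2 * r4" using solve[OF e124] by blast
  have "f1 * (b34 - (f4 * r3 - f3 * r4)) = b13 * f4 + b34 * f1 - b14 * f3"
    unfolding r3(1) r4(1) by (simp add: algebra_simps)
  then have "f1 * (b34 - (f4 * r3 - f3 * r4)) \<in> rmod.span {}" using e134 by simp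
  then have "b34 - (f4 * r3 - f3 * r4) \<in> rmod.span {}" by (rule nzdD[OF n1])
  then have "b34 = f4 * r3 - f3 * r4" by simp
  with b12 r3 r4 show thesis by (intro that)
qed

lemma mem_span_finite:
  assumes "x \<in> rmod.span S"
  obtains T where "finite T" "T \<subseteq> S" "x \<in> rmod.span T"
proof -
  obtain T r where T: "finite T" "T \<subseteq> S" "x = (\<Sum>a\<in>T. r a * a)"
    using assms unfolding rmod.span_explicit by blast
  have "x \<in> rmod.span T" unfolding T(3) by (intro rmod.span_sum rmod.span_scale rmod.span_base)
  with T(1,2) show thesis by (rule that)
qed

context regular_forms begin

text \<open>The denominators \<open>g P\<close> generate an ideal contained in no point, which
  therefore contains powers of \<open>F1\<close>, ..., \<open>F4\<close>. Finitely many generators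
  account for these four powers, and a point outside all their basic open sets would contain all
  four forms.\<close>

lemma quasi_compact:
  fixes g :: "'k poly4 set \<Rightarrow> 'k poly4"
  assumes g: "\<And>P. P \<in> proj3 \<Longrightarrow> P \<in> basic_open (g P)" "\<And>P. P \<in> proj3 \<Longrightarrow> \<exists>n. g P \<in> forms n"
  obtains Y where "finite Y" "Y \<subseteq> proj3" "\<And>Q. Q \<in> proj3 \<Longrightarrow> \<exists>P\<in>Y. Q \<in> basic_open (g P)"
proof -
  have "homogeneous (rmod.span (g ` proj3))"
    using g(2) by (intro homogeneous_span_forms) auto
  moreover have "\<not> rmod.span (g ` proj3) \<subseteq> P" if "P \<in> proj3" for P
    using g(1)[OF that] rmod.span_base[OF imageI[OF that]] by (auto simp: basic_open_def)
  ultimately have pow: "\<exists>N T. finite T \<and> T \<subseteq> g ` proj3 \<and> F ^ N \<in> rmod.span T" if "F \<in> irrelevant_ideal" for F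
    using power_mem_if_avoided[OF _ that] mem_span_finite by metis
  obtain N1 T1 where 1: "finite T1" "T1 \<subseteq> g ` proj3" "F1 ^ N1 \<in> rmod.span T1" using pow[OF F_irrelevant(1)] by blast
  obtain N2 T2 where 2: "finite T2" "T2 \<subseteq> g ` proj3" "F2 ^ N2 \<in> rmod.span T2" using pow[OF F_irrelevant(2)] by blast
  obtain N3 T3 where 3: "finite T3" "T3 \<subseteq> g ` proj3" "F3 ^ N3 \<in> rmod.span T3" using pow[OF F_irrelevant(3)] by blast
  obtain N4 T4 where 4: "finite T4" "T4 \<subseteq> g ` proj3" "F4 ^ N4 \<in> rmod.span T4" using pow[OF F_irrelevant(4)] by blast
  define T where "T = T1 \<union> T2 \<union> T3 \<union> T4"
  have "finite T" "T \<subseteq> g ` proj3" using 1 2 3 4 by (auto simp: T_def)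
  then obtain Y where Y: "Y \<subseteq> proj3" "finite Y" "T = g ` Y" using finite_subset_image by metis
  have sub: "T1 \<subseteq> T" "T2 \<subseteq> T" "T3 \<subseteq> T" "T4 \<subseteq> T" by (auto simp: T_def)
  have "\<exists>P\<in>Y. Q \<in> basic_open (g P)" if Q: "Q \<in> proj3" for Q
  proof (rule ccontr)
    assume "\<not> ?thesis"
    then have "T \<subseteq> Q" using Q by (auto simp: Y(3) basic_open_def)
    then have "rmod.span T \<subseteq> Q"
      using homogeneous_subspace[OF proj3_homogeneous[OF Q]] by (rule rmod.span_minimal)
    then have "F1 ^ N1 \<in> Q" "F2 ^ N2 \<in> Q" "F3 ^ N3 \<in> Q" "F4 ^ N4 \<in> Q"
      using 1(3) 2(3) 3(3) 4(3) sub[THEN rmod.span_mono] by blast+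
    then show False using F_not_all_vanish[OF Q] proj3_power_iff[OF Q] by blast
  qed
  with Y show thesis using that by blast
qed

text \<open>
  Every class in \<open>\<Oplus>\<^sub>t H\<^sup>1(\<I>(t))\<close> is killed by a power of each \<open>F\<^sub>i\<close>, since it becomes trivial on the
  affine open subset where \<open>F\<^sub>i\<close> does not vanish.
\<close>

lemma power_kills_class:
  assumes I: "rmod.subspace I" and \<beta>: "locally_constant_mod I t \<beta>"
  obtains N where "\<And>F. F \<in> {F1, F2, F3, F4} \<Longrightarrow>
    \<exists>\<kappa>. \<forall>P\<in>proj3. emb (F ^ N) * \<beta> P - \<kappa> \<in> stalk I (t + int N * int d) P"
proof -
  have "\<forall>P\<in>proj3. \<exists>f. (\<exists>n>0. f \<in> forms n) \<and> P \<in> basic_open f \<and>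
      (\<forall>Q\<in>basic_open f. \<beta> P - \<beta> Q \<in> stalk I t Q)"
  proof
    fix P :: "'k poly4 set" assume "P \<in> proj3"
    then obtain V where V: "openin zariski V" "P \<in> V" "\<forall>Q\<in>V. \<beta> P - \<beta> Q \<in> stalk I t Q"
      using \<beta> unfolding locally_constant_mod_def by blast
    obtain f n where "n > 0" "f \<in> forms n" "P \<in> basic_open f" "basic_open f \<subseteq> V"
      using openin_zariski_basic[OF V(1,2)] .
    then show "\<exists>f. (\<exists>n>0. f \<in> forms n) \<and> P \<in> basic_open f \<and> (\<forall>Q\<in>basic_open f. \<beta> P - \<beta> Q \<in> stalk I t Q)"
      using V(3) by blast
  qed
  from bchoice[OF this] obtain g where g: "\<And>P. P \<in> proj3 \<Longrightarrow> \<exists>n>0. g P \<in> forms n"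
    "\<And>P. P \<in> proj3 \<Longrightarrow> P \<in> basic_open (g P)"
    "\<And>P Q. P \<in> proj3 \<Longrightarrow> Q \<in> basic_open (g P) \<Longrightarrow> \<beta> P - \<beta> Q \<in> stalk I t Q" by blast
  have g': "\<exists>n. g P \<in> forms n" if "P \<in> proj3" for P using g(1)[OF that] by blast
  obtain Y where Y: "finite Y" "Y \<subseteq> proj3" "\<And>Q. Q \<in> proj3 \<Longrightarrow> \<exists>P\<in>Y. Q \<in> basic_open (g P)"
    using quasi_compact[OF g(2) g'] by blast
  \<comment> \<open>\<open>D n r\<close> says that multiplication by \<open>r\<close>, regarded as a
    form of degree \<open>n\<close>, makes the class trivial.\<close>
  define D where "D = (\<lambda>n r. \<exists>\<kappa>. \<forall>Q\<in>proj3. emb r * \<beta> Q - \<kappa> \<in> stalk I (t + n) Q)"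
  have hom: "homogeneous {r. \<forall>n. D n (hcomp n r)}"
  proof (rule homogeneous_ideal_of_forms)
    show D0: "D n 0" for n unfolding D_def using stalk_zero[OF _ I] by (intro exI[of _ 0]) simp
    show "D n (r + s)" if rs: "D n r" "D n s" for n r s
    proof -
      obtain \<kappa> \<mu> where k: "\<And>Q. Q \<in> proj3 \<Longrightarrow> emb r * \<beta> Q - \<kappa> \<in> stalk I (t + n) Q"
        "\<And>Q. Q \<in> proj3 \<Longrightarrow> emb s * \<beta> Q - \<mu> \<in> stalk I (t + n) Q" using rs unfolding D_def by blast
      have "emb (r + s) * \<beta> Q - (\<kappa> + \<mu>) \<in> stalk I (t + n) Q" if "Q \<in> proj3" for Q
        using stalk_add[OF that I k(1)[OF that] k(2)[OF that]] by (simp add: emb_add algebra_simps)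
      then show ?thesis unfolding D_def by blast
    qed
    show "D (n + e) (c * r)" if c: "c \<in> forms e" and r: "D n r" for n e c r
    proof -
      obtain \<kappa> where k: "\<And>Q. Q \<in> proj3 \<Longrightarrow> emb r * \<beta> Q - \<kappa> \<in> stalk I (t + n) Q"
        using r unfolding D_def by blast
      have "emb (c * r) * \<beta> Q - emb c * \<kappa> \<in> stalk I (t + (n + e)) Q" if "Q \<in> proj3" for Q
        using stalk_scale[OF that k[OF that] c I] by (simp add: emb_mult algebra_simps)
      then show ?thesis unfolding D_def by blast
    qed
  qed
  have D_iff: "r \<in> {r. \<forall>n. D n (hcomp n r)}" if r: "r \<in> forms m" "D m r" for r m
  proof -
    have "D n 0" for n unfolding D_def using stalk_zero[OF _ I] by (intro exI[of _ 0]) simp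
    then show ?thesis using r by (simp add: hcomp_form[OF r(1)])
  qed
  \<comment> \<open>On \<open>basic_open (g P)\<close> the class is represented by the constant
    \<open>\<beta> P\<close>. The differences \<open>\<beta> P - \<beta> R\<close> lie in the stalks
    over the overlap with \<open>basic_open (g R)\<close>, and a power of \<open>g P\<close> clears
    their denominators on all of \<open>basic_open (g R)\<close>. Finitely many \<open>R\<close>
    cover the space, so one exponent serves everywhere.\<close>
  have kill: "\<exists>N. g P ^ N \<in> {r. \<forall>n. D n (hcomp n r)}" if P: "P \<in> Y" for P
  proof -
    have P3: "P \<in> proj3" using P Y(2) by blast
    obtain n where n: "n > 0" "g P \<in> forms n" using g(1)[OF P3] by blast
    have "\<forall>R\<in>Y. \<exists>M. \<forall>Q\<in>basic_open (g R). emb (g P ^ M) * (\<beta> P - \<beta> R) \<in> stalk I (t + int M * n) Q"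
    proof
      fix R assume R: "R \<in> Y"
      then have R3: "R \<in> proj3" using Y(2) by blast
      obtain m where m: "m > 0" "g R \<in> forms m" using g(1)[OF R3] by blast
      have PR: "g P * g R \<in> forms (n + m)" using n(2) m(2) by (rule forms_mult)
      have nm: "n + m > 0" using n(1) m(1) by simp
      have diff: "\<beta> P - \<beta> R \<in> stalk I t Q" if "Q \<in> basic_open (g P * g R)" for Q
      proof -
        have Q: "Q \<in> proj3" "Q \<in> basic_open (g P)" "Q \<in> basic_open (g R)"
          using that unfolding basic_open_mult by (auto simp: basic_open_def)
        from stalk_diff[OF Q(1) I g(3)[OF P3 Q(2)] g(3)[OF R3 Q(3)]] show ?thesis by simp
      qed
      obtain M a where
        a: "a \<in> I" "a \<in> forms (int M * (n + m) + t)" "emb ((g P * g R) ^ M) * (\<beta> P - \<beta> R) = emb a"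
        using section_on_basic_open[OF I PR nm diff] by blast
      have "emb (g P ^ M) * (\<beta> P - \<beta> R) \<in> stalk I (t + int M * n) Q" if Q: "Q \<in> basic_open (g R)" for Q
      proof (rule stalkI)
        show "g R ^ M \<in> forms (int M * m)" using m(2) by (rule forms_power)
        show "g R ^ M \<notin> Q" using Q by (auto simp: basic_open_def proj3_power_iff)
        show "a \<in> forms (int M * m + (t + int M * n))" using a(2) by (simp add: algebra_simps)
        show "emb (g R ^ M) * (emb (g P ^ M) * (\<beta> P - \<beta> R)) = emb a"
          unfolding a(3)[symmetric] by (simp add: power_mult_distrib emb_mult ac_simps)
      qed (rule a(1))
      then show "\<exists>M. \<forall>Q\<in>basic_open (g R). emb (g P ^ M) * (\<beta> P - \<beta> R) \<in> stalk I (t + int M * n) Q"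
        by blast
    qed
    from bchoice[OF this] obtain M where
      M: "\<And>R Q. R \<in> Y \<Longrightarrow> Q \<in> basic_open (g R) \<Longrightarrow> emb (g P ^ M R) * (\<beta> P - \<beta> R) \<in> stalk I (t + int (M R) * n) Q"
      by blast
    define N where "N = (\<Sum>R\<in>Y. M R)"
    have "emb (g P ^ N) * \<beta> Q - emb (g P ^ N) * \<beta> P \<in> stalk I (t + int N * n) Q" if Q: "Q \<in> proj3" for Q
    proof -
      obtain R where R: "R \<in> Y" "Q \<in> basic_open (g R)" using Y(3)[OF Q] by blast
      have "M R \<le> N" unfolding N_def using R(1) Y(1) by (intro member_le_sum) auto
      then obtain K where K: "N = M R + K" using le_Suc_ex by blast
      have "emb (g P ^ K) * (emb (g P ^ M R) * (\<beta> P - \<beta> R)) \<in> stalk I (t + int (M R) * n + int K * n) Q"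
        using stalk_scale[OF Q M[OF R] forms_power[OF n(2)] I] .
      moreover have "emb (g P ^ K) * (emb (g P ^ M R) * (\<beta> P - \<beta> R)) = emb (g P ^ N) * (\<beta> P - \<beta> R)"
        by (simp add: K power_add emb_mult ac_simps)
      moreover have "t + int (M R) * n + int K * n = t + int N * n" by (simp add: K algebra_simps)
      ultimately have 1: "emb (g P ^ N) * (\<beta> P - \<beta> R) \<in> stalk I (t + int N * n) Q" by simp
      have 2: "emb (g P ^ N) * (\<beta> R - \<beta> Q) \<in> stalk I (t + int N * n) Q"
        using stalk_scale[OF Q g(3)[OF _ R(2)] forms_power[OF n(2)] I] R(1) Y(2) by blast
      have "emb (g P ^ N) * \<beta> Q - emb (g P ^ N) * \<beta> P =
          - (emb (g P ^ N) * (\<beta> P - \<beta> R) + emb (g P ^ N) * (\<beta> R - \<beta> Q))"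
        by (simp add: algebra_simps)
      then show ?thesis using stalk_uminus[OF Q I stalk_add[OF Q I 1 2]] by simp
    qed
    then have "D (int N * n) (g P ^ N)" unfolding D_def by blast
    from D_iff[OF forms_power[OF n(2)] this] show ?thesis by blast
  qed
  have pow: "\<exists>N. F ^ N \<in> {r. \<forall>n. D n (hcomp n r)}" if F: "F \<in> irrelevant_ideal" for F
  proof (rule power_mem_if_avoided[OF hom F])
    fix P assume P: "P \<in> proj3" "F \<notin> P"
    obtain R where R: "R \<in> Y" "P \<in> basic_open (g R)" using Y(3)[OF P(1)] by blast
    obtain N where "g R ^ N \<in> {r. \<forall>n. D n (hcomp n r)}" using kill[OF R(1)] by blast
    moreover have "g R ^ N \<notin> P" using R(2) by (auto simp: basic_open_def proj3_power_iff)
    ultimately show "\<not> {r. \<forall>n. D n (hcomp n r)} \<subseteq> P" by blast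
  qed
  have "\<forall>F\<in>{F1, F2, F3, F4}. \<exists>N. F ^ N \<in> {r. \<forall>n. D n (hcomp n r)}"
    using pow F_irrelevant by blast
  from bchoice[OF this] obtain M where M: "\<And>F. F \<in> {F1, F2, F3, F4} \<Longrightarrow> F ^ M F \<in> {r. \<forall>n. D n (hcomp n r)}"
    by blast
  define N where "N = M F1 + M F2 + M F3 + M F4"
  have "\<exists>\<kappa>. \<forall>P\<in>proj3. emb (F ^ N) * \<beta> P - \<kappa> \<in> stalk I (t + int N * int d) P"
    if F: "F \<in> {F1, F2, F3, F4}" for F
  proof -
    have "M F \<le> N" using F by (auto simp: N_def)
    then have "F ^ N = F ^ (N - M F) * F ^ M F" by (simp flip: power_add)
    then have "F ^ N \<in> {r. \<forall>n. D n (hcomp n r)}"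
      using rmod.subspace_scale[OF homogeneous_subspace[OF hom] M[OF F]] by simp
    then have "D (int N * int d) (hcomp (int N * int d) (F ^ N))" by blast
    moreover have "F \<in> forms (int d)" using F F_forms by blast
    ultimately show ?thesis unfolding D_def by (simp add: forms_power)
  qed
  then show thesis by (rule that)
qed

text \<open>
  If \<open>F\<^sub>i\<^sup>N\<close> times the class is represented by the constant \<open>k\<^sub>i\<close>, then \<open>b\<^sub>i\<^sub>j = F\<^sub>j\<^sup>N k\<^sub>i - F\<^sub>i\<^sup>N k\<^sub>j\<close> is a Koszul
  cocycle with values in \<open>I\<close>. It is a coboundary over \<open>R\<close> as \<open>F\<^sub>1\<^sup>N, F\<^sub>2\<^sup>N, F\<^sub>3\<^sup>N\<close> is regular, and then a
  coboundary over \<open>I\<close> as \<open>F\<^sub>3\<^sup>N, F\<^sub>4\<^sup>N\<close> is regular modulo \<open>I\<close>; this corrects the \<open>k\<^sub>i\<close> to multiples of one \<open>\<kappa>\<close>.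
\<close>

lemma H1_pair_vanishes:
  assumes \<beta>: "locally_constant_mod (rmod.span {F1, F2}) t \<beta>"
  obtains \<kappa> where "\<And>P. P \<in> proj3 \<Longrightarrow> \<beta> P - \<kappa> \<in> stalk (rmod.span {F1, F2}) t P"
proof -
  let ?I = "rmod.span {F1, F2}"
  have I: "rmod.subspace ?I" by simp
  interpret s: regular_forms F2 F1 F3 F4 d by (rule regular_forms_swap12)
  obtain N where "\<And>F. F \<in> {F1, F2, F3, F4} \<Longrightarrow>
      \<exists>\<kappa>. \<forall>P\<in>proj3. emb (F ^ N) * \<beta> P - \<kappa> \<in> stalk ?I (t + int N * int d) P"
    using power_kills_class[OF I \<beta>] by blast
  then have "\<forall>F\<in>{F1, F2, F3, F4}. \<exists>\<kappa>. \<forall>P\<in>proj3. emb (F ^ N) * \<beta> P - \<kappa> \<in> stalk ?I (t + int N * int d) P"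
    by blast
  from bchoice[OF this] obtain k where
    k: "\<And>F P. F \<in> {F1, F2, F3, F4} \<Longrightarrow> P \<in> proj3 \<Longrightarrow> emb (F ^ N) * \<beta> P - k F \<in> stalk ?I (t + int N * int d) P"
    by blast
  define e where "e = int N * int d"
  note k = k[folded e_def]
  have Fe: "F ^ N \<in> forms e" if "F \<in> {F1, F2, F3, F4}" for F
    using that F_forms forms_power unfolding e_def by blast
  \<comment> \<open>Eliminating \<beta> between the two multiples leaves an element that lies in all
    stalks of the ideal sheaf, hence a form in the ideal.\<close>
  have ex_b: "\<exists>b\<in>?I. b \<in> forms (t + e + e) \<and> emb b = emb (G ^ N) * k F - emb (F ^ N) * k G"
    if FG: "F \<in> {F1, F2, F3, F4}" "G \<in> {F1, F2, F3, F4}" for F G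
  proof -
    have "emb (G ^ N) * k F - emb (F ^ N) * k G \<in> stalk ?I (t + e + e) P" if P: "P \<in> proj3" for P
    proof -
      have "emb (F ^ N) * (emb (G ^ N) * \<beta> P - k G) - emb (G ^ N) * (emb (F ^ N) * \<beta> P - k F)
          \<in> stalk ?I (t + e + e) P"
        using stalk_diff[OF P I stalk_scale[OF P k[OF FG(2) P] Fe[OF FG(1)] I]
          stalk_scale[OF P k[OF FG(1) P] Fe[OF FG(2)] I]] .
      then show ?thesis by (simp add: algebra_simps)
    qed
    then show ?thesis using global_section_pair by metis
  qed
  define b where "b = (\<lambda>F G. SOME b. b \<in> ?I \<and> b \<in> forms (t + e + e) \<and> emb b = emb (G ^ N) * k F - emb (F ^ N) * k G)"
  have b: "b F G \<in> ?I" "b F G \<in> forms (t + e + e)" "emb (b F G) = emb (G ^ N) * k F - emb (F ^ N) * k G"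
    if "F \<in> {F1, F2, F3, F4}" "G \<in> {F1, F2, F3, F4}" for F G
    using someI_ex[OF ex_b[OF that, unfolded Bex_def]] unfolding b_def by blast+
  have cyc: "b F G * H ^ N + b G H * F ^ N = b F H * G ^ N"
    if "F \<in> {F1, F2, F3, F4}" "G \<in> {F1, F2, F3, F4}" "H \<in> {F1, F2, F3, F4}" for F G H
  proof -
    have "emb (b F G * H ^ N + b G H * F ^ N) = emb (b F H * G ^ N)"
      using that by (simp add: emb_add emb_mult b(3) algebra_simps)
    then show ?thesis by simp
  qed
  have n1: "nzd (F1 ^ N) (rmod.span {})" using nzd_power[OF reg1] .
  have n2': "nzd F2 (rmod.span {F1 ^ N})" using nzd_span_insert_power[OF reg1 reg2] .
  have n2: "nzd (F2 ^ N) (rmod.span {F1 ^ N})" using nzd_power[OF n2'] .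
  \<comment> \<open>The generators are replaced by powers one at a time, \<open>F1\<close> with
    \<open>F2\<close> present and afterwards \<open>F2\<close> with \<open>F1 ^ N\<close>
    present.\<close>
  have "nzd F3 (rmod.span {F1 ^ N, F2})" using nzd_span_insert_power[OF s.reg2, of F3 N] reg3 by simp
  then have "nzd F3 (rmod.span {F2 ^ N, F1 ^ N})"
    using nzd_span_insert_power[OF n2', of F3 N] by (simp add: insert_commute)
  then have n3: "nzd (F3 ^ N) (rmod.span {F1 ^ N, F2 ^ N})"
    using nzd_power by (simp add: insert_commute)
  have cyc': "b F1 F2 * F3 ^ N + b F2 F3 * F1 ^ N = b F1 F3 * F2 ^ N"
    "b F1 F2 * F4 ^ N + b F2 F4 * F1 ^ N = b F1 F4 * F2 ^ N"
    "b F1 F3 * F4 ^ N + b F3 F4 * F1 ^ N = b F1 F4 * F3 ^ N"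
    by (rule cyc; simp)+
  obtain r1 r2 r3 r4 where r:
    "b F1 F2 = F2 ^ N * r1 - F1 ^ N * r2" "b F1 F3 = F3 ^ N * r1 - F1 ^ N * r3"
    "b F1 F4 = F4 ^ N * r1 - F1 ^ N * r4" "b F2 F3 = F3 ^ N * r2 - F2 ^ N * r3"
    "b F2 F4 = F4 ^ N * r2 - F2 ^ N * r4" "b F3 F4 = F4 ^ N * r3 - F3 ^ N * r4"
    by (rule koszul_syzygies[OF n1 n2 n3 cyc'])
  have n4: "nzd (F4 ^ N) (rmod.span (insert (F3 ^ N) {F1, F2}))"
    using nzd_power[OF nzd_span_insert_power[OF reg3, of F4 N]] reg4 by (simp add: insert_commute)
  \<comment> \<open>Membership of \<open>b F3 F4\<close> in the ideal makes \<open>(r3, r4)\<close>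
    the multiple by some \<open>c\<close> of \<open>(F3 ^ N, F4 ^ N)\<close> modulo the ideal.
    Subtracting \<open>F ^ N * c\<close> from the \<open>r\<close> belonging to \<open>F\<close>
    leaves every \<open>b\<close> unchanged and moves all four into the ideal, \<open>r1\<close> and
    \<open>r2\<close> by \<open>red\<close>.\<close>
  have "F3 ^ N * (- r4) + F4 ^ N * r3 \<in> ?I" using b(1)[of F3 F4] by (simp add: r(6))
  then obtain c where c: "r3 - F3 ^ N * c \<in> ?I" "- r4 + F4 ^ N * c \<in> ?I"
    using syzygy[OF nzd_power[OF reg3] n4] by blast
  have red: "q - F ^ N * c \<in> ?I" if "F3 ^ N * q - F ^ N * r3 \<in> ?I" for F q
  proof -
    have "F3 ^ N * (q - F ^ N * c) = (F3 ^ N * q - F ^ N * r3) + F ^ N * (r3 - F3 ^ N * c)"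
      by (simp add: algebra_simps)
    moreover have "\<dots> \<in> ?I" using that c(1) by (intro rmod.span_add rmod.span_scale)
    ultimately have "F3 ^ N * (q - F ^ N * c) \<in> ?I" by simp
    then show ?thesis by (rule nzdD[OF nzd_power[OF reg3]])
  qed
  \<comment> \<open>The syzygies were found without regard to degrees; taking components of degree
    \<open>t + e\<close> makes them forms and preserves the relations.\<close>
  define s1 s2 s3 s4 where "s1 = hcomp (t + e) (r1 - F1 ^ N * c)" and "s2 = hcomp (t + e) (r2 - F2 ^ N * c)"
    and "s3 = hcomp (t + e) (r3 - F3 ^ N * c)" and "s4 = hcomp (t + e) (r4 - F4 ^ N * c)"
  note s_def = s1_def s2_def s3_def s4_def
  have "r4 - F4 ^ N * c \<in> ?I" using rmod.span_neg[OF c(2)] by simp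
  moreover have "r1 - F1 ^ N * c \<in> ?I" using b(1)[of F1 F3] by (intro red) (simp add: r(2))
  moreover have "r2 - F2 ^ N * c \<in> ?I" using b(1)[of F2 F3] by (intro red) (simp add: r(4))
  ultimately have sI: "s1 \<in> ?I" "s2 \<in> ?I" "s3 \<in> ?I" "s4 \<in> ?I"
    unfolding s_def using c(1) homogeneous_hcomp[OF homogeneous_spans(2)] by blast+
  have s_forms: "s1 \<in> forms (t + e)" "s2 \<in> forms (t + e)" "s3 \<in> forms (t + e)" "s4 \<in> forms (t + e)"
    by (simp_all add: s_def)
  have hom: "b F1 G = G ^ N * s1 - F1 ^ N * hcomp (t + e) (q - G ^ N * c)"
    if "G \<in> {F1, F2, F3, F4}" "b F1 G = G ^ N * r1 - F1 ^ N * q" for G q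
  proof -
    have "b F1 G = G ^ N * (r1 - F1 ^ N * c) - F1 ^ N * (q - G ^ N * c)"
      unfolding that(2) by (simp add: algebra_simps)
    then have "hcomp (t + e + e) (b F1 G) = G ^ N * s1 - F1 ^ N * hcomp (t + e) (q - G ^ N * c)"
      by (simp add: hcomp_diff[of _ "G ^ N * (r1 - F1 ^ N * c)"] hcomp_mult_form[OF Fe[OF that(1)]]
          hcomp_mult_form[OF Fe[of F1]] s1_def add.commute[of e t])
    then show ?thesis using b(2)[of F1 G] that(1) by simp
  qed
  \<comment> \<open>By the relations between the \<open>b\<close> the four quotients (k F - s) / F^N
    coincide, so the one for \<open>F1\<close> may be taken.\<close>
  define \<kappa> where "\<kappa> = (k F1 - emb s1) / emb (F1 ^ N)"
  have F1N: "emb (F1 ^ N) \<noteq> 0" using F_nonzero(1) by simp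
  have \<kappa>: "emb (G ^ N) * \<kappa> = k G - emb s"
    if "G \<in> {F1, F2, F3, F4}" "b F1 G = G ^ N * s1 - F1 ^ N * s" for G s
  proof -
    have "emb (G ^ N) * k F1 - emb (F1 ^ N) * k G = emb (G ^ N) * emb s1 - emb (F1 ^ N) * emb s"
      using b(3)[of F1 G] that by (simp add: emb_diff emb_mult)
    then have *: "emb (G ^ N) * (k F1 - emb s1) = emb (F1 ^ N) * (k G - emb s)"
      by (simp add: algebra_simps)
    have "emb (F1 ^ N) * \<kappa> = k F1 - emb s1" using F1N by (simp add: \<kappa>_def)
    then have "emb (F1 ^ N) * (emb (G ^ N) * \<kappa>) = emb (F1 ^ N) * (k G - emb s)"
      unfolding mult.left_commute[of "emb (F1 ^ N)"] by (simp only: *)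
    then show ?thesis by (rule mult_left_cancel[OF F1N, THEN iffD1])
  qed
  have \<kappa>s: "emb (F1 ^ N) * \<kappa> = k F1 - emb s1" "emb (F2 ^ N) * \<kappa> = k F2 - emb s2"
    "emb (F3 ^ N) * \<kappa> = k F3 - emb s3" "emb (F4 ^ N) * \<kappa> = k F4 - emb s4"
    using F1N \<kappa>[of F2 s2] \<kappa>[of F3 s3] \<kappa>[of F4 s4] hom[of F2 r2] hom[of F3 r3] hom[of F4 r4] r
    by (simp_all add: \<kappa>_def s_def)
  have fin: "\<beta> P - \<kappa> \<in> stalk ?I t P"
    if P: "P \<in> proj3" and G: "G \<in> {F1, F2, F3, F4}" "G \<notin> P"
      and s: "emb (G ^ N) * \<kappa> = k G - emb s" "s \<in> ?I" "s \<in> forms (t + e)" for P G s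
  proof (rule stalk_cancel[OF P Fe[OF G(1)]])
    show "G ^ N \<notin> P" using P G(2) proj3_power_iff by blast
    have "emb (G ^ N) * (\<beta> P - \<kappa>) = (emb (G ^ N) * \<beta> P - k G) + emb s"
      by (simp add: right_diff_distrib s(1))
    also have "\<dots> \<in> stalk ?I (t + e) P"
      using k[OF G(1) P] emb_in_stalk[OF P s(2,3)] by (rule stalk_add[OF P I])
    finally show "emb (G ^ N) * (\<beta> P - \<kappa>) \<in> stalk ?I (t + e) P" .
  qed
  show thesis
  proof (rule that)
    fix P :: "'k poly4 set" assume P: "P \<in> proj3"
    from F_not_all_vanish[OF P] show "\<beta> P - \<kappa> \<in> stalk ?I t P"
      using fin[OF P, of F1 s1] fin[OF P, of F2 s2] fin[OF P, of F3 s3] fin[OF P, of F4 s4] \<kappa>s sI s_forms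
      by blast
  qed
qed

text \<open>
  The class of a form \<open>f\<close>: it is represented by \<open>f\<close> along the first curve and by \<open>0\<close> on its complement,
  as in the connecting homomorphism of \<open>0 \<rightarrow> \<I>\<^sub>1 \<inter> \<I>\<^sub>2 \<rightarrow> \<I>\<^sub>1 \<oplus> \<I>\<^sub>2 \<rightarrow> \<O> \<rightarrow> 0\<close>.
\<close>

definition jump :: "'k poly4 \<Rightarrow> 'k poly4 set \<Rightarrow> 'k poly4 fract"
  where "jump f P = (if F1 \<in> P \<and> F2 \<in> P then emb f else 0)"

abbreviation inter_ideal :: "'k poly4 set"
  where "inter_ideal \<equiv> rmod.span {F1, F2} \<inter> rmod.span {F3, F4}"

lemma stalk_off_curve:
  assumes "P \<in> proj3" "F1 \<notin> P \<or> F2 \<notin> P" "\<kappa> \<in> stalk UNIV t P"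
  shows "\<kappa> \<in> stalk (rmod.span {F1, F2}) t P"
  using assms(2)
proof
  assume "F1 \<notin> P"
  then show ?thesis
    using stalk_of_unit[OF assms(1) rmod.subspace_span rmod.span_base F_forms(1) _ assms(3)] by simp
next
  assume "F2 \<notin> P"
  then show ?thesis
    using stalk_of_unit[OF assms(1) rmod.subspace_span rmod.span_base F_forms(2) _ assms(3)] by simp
qed

lemma stalk_off_other_curve:
  assumes "P \<in> proj3" "F1 \<in> P \<and> F2 \<in> P" "\<kappa> \<in> stalk UNIV t P"
  shows "\<kappa> \<in> stalk (rmod.span {F3, F4}) t P"
  using regular_forms.stalk_off_curve[OF regular_forms_exchange assms(1) _ assms(3)]
    F_not_all_vanish[OF assms(1)] assms(2) by blast

text \<open>The curves are disjoint, so at every point one of the two ideals has the full stalk and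
  only the other one imposes a condition.\<close>

lemma stalk_inter_iff:
  assumes "P \<in> proj3"
  shows "\<kappa> \<in> stalk inter_ideal t P \<longleftrightarrow>
    (if F1 \<in> P \<and> F2 \<in> P then \<kappa> \<in> stalk (rmod.span {F1, F2}) t P else \<kappa> \<in> stalk (rmod.span {F3, F4}) t P)"
proof -
  have sub: "\<kappa> \<in> stalk I t P \<Longrightarrow> \<kappa> \<in> stalk UNIV t P" for I using stalk_mono[of I UNIV] by blast
  show ?thesis
    unfolding stalk_Int[OF assms rmod.subspace_span rmod.subspace_span]
    using stalk_off_curve[OF assms] stalk_off_other_curve[OF assms] sub by auto
qed

text \<open>Off the first curve the family is zero. Around a point of that curve take the complement
  of the second one: the values there are \<open>f\<close> and 0, and where 0 occurs neither curve
  is met, so that \<open>f\<close> lies in the full stalk.\<close>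

lemma jump_locally_constant:
  assumes f: "f \<in> forms t"
  shows "locally_constant_mod inter_ideal t (jump f)"
  unfolding locally_constant_mod_def
proof
  interpret x: regular_forms F3 F4 F1 F2 d by (rule regular_forms_exchange)
  fix P :: "'k poly4 set" assume P: "P \<in> proj3"
  have zero: "0 \<in> stalk inter_ideal t Q" if "Q \<in> proj3" for Q
    using that by (simp add: stalk_zero rmod.subspace_inter)
  have ef: "emb f \<in> stalk UNIV t Q" if "Q \<in> proj3" for Q
    using that f by (simp add: emb_in_stalk)
  have open_F: "openin zariski (basic_open F)" if "F \<in> {F1, F2, F3, F4}" for F
    using that F_forms openin_basic_open by blast
  show "\<exists>V. openin zariski V \<and> P \<in> V \<and> (\<forall>Q\<in>V. jump f P - jump f Q \<in> stalk inter_ideal t Q)"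
  proof (cases "F1 \<in> P \<and> F2 \<in> P")
    case False
    let ?V = "basic_open F1 \<union> basic_open F2"
    have "openin zariski ?V" using open_F by blast
    moreover have "P \<in> ?V" using False P by (auto simp: basic_open_def)
    moreover have "jump f P - jump f Q \<in> stalk inter_ideal t Q" if "Q \<in> ?V" for Q
      using that False zero by (auto simp: jump_def basic_open_def)
    ultimately show ?thesis by blast
  next
    case True
    let ?V = "basic_open F3 \<union> basic_open F4"
    have "openin zariski ?V" using open_F by blast
    moreover have "P \<in> ?V" using True F_not_all_vanish[OF P] P by (auto simp: basic_open_def)
    moreover have "jump f P - jump f Q \<in> stalk inter_ideal t Q" if Q: "Q \<in> ?V" for Q
    proof -
      have Q3: "Q \<in> proj3" "F3 \<notin> Q \<or> F4 \<notin> Q" using Q by (auto simp: basic_open_def)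
      show ?thesis
      proof (cases "F1 \<in> Q \<and> F2 \<in> Q")
        case True
        then show ?thesis using \<open>F1 \<in> P \<and> F2 \<in> P\<close> zero[OF Q3(1)] by (simp add: jump_def)
      next
        case False
        have "emb f \<in> stalk inter_ideal t Q"
          unfolding stalk_inter_iff[OF Q3(1)] if_not_P[OF False]
          by (rule x.stalk_off_curve[OF Q3 ef[OF Q3(1)]])
        then show ?thesis using True False by (auto simp: jump_def)
      qed
    qed
    ultimately show ?thesis by blast
  qed
qed

text \<open>The vanishing theorem represents the family by a constant \<kappa> modulo the first
  ideal and by \<mu> modulo the second. Their difference lies in all stalks of the twisting sheaf
  and is thus a form \<open>f\<close>; the family is \<kappa> along the first curve and \<mu>
  elsewhere, that is, \<mu> plus the jump of \<open>f\<close>.\<close>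

lemma jump_surjective:
  assumes \<beta>: "locally_constant_mod inter_ideal t \<beta>"
  obtains f \<kappa> where "f \<in> forms t" "\<And>P. P \<in> proj3 \<Longrightarrow> \<beta> P - jump f P - \<kappa> \<in> stalk inter_ideal t P"
proof -
  interpret x: regular_forms F3 F4 F1 F2 d by (rule regular_forms_exchange)
  obtain \<kappa> where k: "\<And>P. P \<in> proj3 \<Longrightarrow> \<beta> P - \<kappa> \<in> stalk (rmod.span {F1, F2}) t P"
    using H1_pair_vanishes[OF locally_constant_mod_mono[OF Int_lower1 \<beta>]] by blast
  obtain \<mu> where m: "\<And>P. P \<in> proj3 \<Longrightarrow> \<beta> P - \<mu> \<in> stalk (rmod.span {F3, F4}) t P"
    using x.H1_pair_vanishes[OF locally_constant_mod_mono[OF Int_lower2 \<beta>]] by blast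
  have "\<kappa> - \<mu> \<in> stalk UNIV t P" if P: "P \<in> proj3" for P
  proof -
    have sub: "stalk I t P \<subseteq> stalk UNIV t P" for I by (rule stalk_mono) simp
    have "(\<beta> P - \<mu>) - (\<beta> P - \<kappa>) \<in> stalk UNIV t P"
      using stalk_diff[OF P rmod.subspace_UNIV subsetD[OF sub m[OF P]] subsetD[OF sub k[OF P]]] .
    then show ?thesis by simp
  qed
  then obtain f where f: "f \<in> forms t" "\<kappa> - \<mu> = emb f" by (rule global_section_UNIV)
  have "\<beta> P - jump f P - \<mu> \<in> stalk inter_ideal t P" if P: "P \<in> proj3" for P
  proof -
    have "\<beta> P - jump f P - \<mu> = (if F1 \<in> P \<and> F2 \<in> P then \<beta> P - \<kappa> else \<beta> P - \<mu>)"
      by (simp add: jump_def flip: f(2))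
    then show ?thesis using k[OF P] m[OF P] by (simp add: stalk_inter_iff[OF P])
  qed
  with f(1) show thesis by (rule that)
qed

text \<open>If the jump is a constant \<kappa> modulo the stalks, then \<kappa> lies in all stalks
  of the second ideal and \<open>emb f - \<kappa>\<close> in all those of the first; both are global
  sections, which exhibits \<open>f\<close> as a sum. Conversely, for \<open>f = a + b\<close> with
  \<open>b\<close> in the second ideal the constant is \<open>b\<close>.\<close>

lemma jump_trivial_iff:
  assumes f: "f \<in> forms t"
  shows "(\<exists>\<kappa>. \<forall>P\<in>proj3. jump f P - \<kappa> \<in> stalk inter_ideal t P) \<longleftrightarrow> f \<in> rmod.span {F1, F2, F3, F4}"
proof
  interpret x: regular_forms F3 F4 F1 F2 d by (rule regular_forms_exchange)
  have union: "{F1, F2} \<union> {F3, F4} = {F1, F2, F3, F4}" by auto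
  have ef: "emb f \<in> stalk UNIV t P" if "P \<in> proj3" for P
    using that f by (simp add: emb_in_stalk)
  have sub: "stalk I t P \<subseteq> stalk UNIV t P" for I P by (rule stalk_mono) simp
  {
    assume "\<exists>\<kappa>. \<forall>P\<in>proj3. jump f P - \<kappa> \<in> stalk inter_ideal t P"
    then obtain \<kappa> where k: "\<And>P. P \<in> proj3 \<Longrightarrow> jump f P - \<kappa> \<in> stalk inter_ideal t P" by blast
    have k2: "\<kappa> \<in> stalk (rmod.span {F3, F4}) t P" if P: "P \<in> proj3" for P
    proof (cases "F1 \<in> P \<and> F2 \<in> P")
      case True
      have "emb f - \<kappa> \<in> stalk UNIV t P" using k[OF P] True sub by (auto simp: jump_def)
      then have "emb f - (emb f - \<kappa>) \<in> stalk UNIV t P" by (rule stalk_diff[OF P rmod.subspace_UNIV ef[OF P]])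
      then show ?thesis using stalk_off_other_curve[OF P True] by simp
    next
      case False
      then have "- \<kappa> \<in> stalk (rmod.span {F3, F4}) t P"
        using k[OF P] by (auto simp: jump_def stalk_inter_iff[OF P])
      then show ?thesis using stalk_uminus[OF P rmod.subspace_span] by fastforce
    qed
    then obtain g where g: "g \<in> rmod.span {F3, F4}" "g \<in> forms t" "\<kappa> = emb g"
      using x.global_section_pair by blast
    have "emb (f - g) \<in> stalk (rmod.span {F1, F2}) t P" if P: "P \<in> proj3" for P
    proof (cases "F1 \<in> P \<and> F2 \<in> P")
      case True
      then show ?thesis using k[OF P] by (simp add: jump_def stalk_inter_iff[OF P] g(3) emb_diff)
    next
      case False
      have "emb (f - g) \<in> stalk UNIV t P" using P f g(2) by (simp add: emb_in_stalk forms_diff)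
      then show ?thesis using stalk_off_curve[OF P] False by blast
    qed
    then obtain h where "h \<in> rmod.span {F1, F2}" "emb (f - g) = emb h"
      using global_section_pair by blast
    then have "f = h + g" "h \<in> rmod.span {F1, F2}" by (simp_all add: algebra_simps)
    then show "f \<in> rmod.span {F1, F2, F3, F4}"
      using g(1) rmod.span_Un[of "{F1, F2}" "{F3, F4}"] unfolding union by blast
  }
  assume "f \<in> rmod.span {F1, F2, F3, F4}"
  then obtain a0 b0 where ab0: "a0 \<in> rmod.span {F1, F2}" "b0 \<in> rmod.span {F3, F4}" "f = a0 + b0"
    using rmod.span_Un[of "{F1, F2}" "{F3, F4}"] unfolding union by blast
  define a b where "a = hcomp t a0" and "b = hcomp t b0"
  have ab: "a \<in> rmod.span {F1, F2}" "b \<in> rmod.span {F3, F4}" "a \<in> forms t" "b \<in> forms t"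
    using ab0 homogeneous_hcomp homogeneous_spans by (auto simp: a_def b_def)
  have "hcomp t f = a + b" by (simp add: a_def b_def ab0(3) hcomp_add)
  then have fab: "f = a + b" using f by simp
  have "jump f P - emb b \<in> stalk inter_ideal t P" if P: "P \<in> proj3" for P
  proof (cases "F1 \<in> P \<and> F2 \<in> P")
    case True
    then show ?thesis
      using emb_in_stalk[OF P ab(1,3)] by (simp add: jump_def stalk_inter_iff[OF P] fab emb_add)
  next
    case False
    then show ?thesis
      using stalk_uminus[OF P rmod.subspace_span emb_in_stalk[OF P ab(2,4)]]
      by (auto simp: jump_def stalk_inter_iff[OF P])
  qed
  then show "\<exists>\<kappa>. \<forall>P\<in>proj3. jump f P - \<kappa> \<in> stalk inter_ideal t P" by blast
qed

end

section \<open>Graded complexes\<close>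

lemma sign_in_forms: "(- 1) ^ n \<in> forms 0"
  using forms_power[OF forms_uminus[OF forms_one], of n] by simp

lemma signed_form: "f \<in> forms t \<Longrightarrow> (- 1) ^ n * f \<in> forms t"
  using forms_mult[OF sign_in_forms] by fastforce

lemma koszul_complex_simps:
  "basis (koszul_complex d fs) = Pow {..<length fs}"
  "hdeg (koszul_complex d fs) S = card S"
  "shift (koszul_complex d fs) S = int (card S * d)"
  "basis (koszul_ideal_complex d fs) = Pow {..<length fs} - {{}}"
  "hdeg (koszul_ideal_complex d fs) S = card S - 1"
  "shift (koszul_ideal_complex d fs) S = int (card S * d)"
  "diff (koszul_ideal_complex d fs) = diff (koszul_complex d fs)"
  by (simp_all add: koszul_complex_def koszul_ideal_complex_def)

lemma diff_koszul_complex: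
  assumes "S \<subseteq> {..<length fs}" "set fs \<subseteq> forms (int d)"
  shows "diff (koszul_complex d fs) S T \<in> forms (int (card S * d) - int (card T * d))"
    and "card S \<noteq> Suc (card T) \<Longrightarrow> diff (koszul_complex d fs) S T = 0"
    and "d > 0 \<Longrightarrow> diff (koszul_complex d fs) S T \<in> irrelevant_ideal"
proof -
  have diff: "diff (koszul_complex d fs) S T =
      (\<Sum>i\<in>S. if T = S - {i} then (- 1) ^ card {j \<in> S. j < i} * fs ! i else 0)"
    by (simp add: koszul_complex_def)
  have fin: "finite S" using assms(1) finite_subset by blast
  have card: "card S = Suc (card T)" if "i \<in> S" "T = S - {i}" for i
    using card_Suc_Diff1[OF fin that(1)] that(2) by simp
  have form: "fs ! i \<in> forms (int d)" if "i \<in> S" for i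
    using that assms nth_mem[of i fs] by blast
  show "diff (koszul_complex d fs) S T \<in> forms (int (card S * d) - int (card T * d))"
    unfolding diff
  proof (rule forms_sum)
    fix i assume i: "i \<in> S"
    show "(if T = S - {i} then (- 1) ^ card {j \<in> S. j < i} * fs ! i else 0) \<in>
        forms (int (card S * d) - int (card T * d))"
      using card[OF i] signed_form[OF form[OF i]] by (simp add: algebra_simps)
  qed
  show "diff (koszul_complex d fs) S T = 0" if "card S \<noteq> Suc (card T)"
    unfolding diff by (rule sum.neutral) (use card that in auto)
  show "diff (koszul_complex d fs) S T \<in> irrelevant_ideal" if "d > 0"
    unfolding diff irrelevant_ideal_eq
  proof (rule rmod.span_sum)
    fix i assume "i \<in> S"
    then have "fs ! i \<in> rmod.span (range pvar)"
      using form_in_irrelevant[OF form] that unfolding irrelevant_ideal_eq by simp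
    then show "(if T = S - {i} then (- 1) ^ card {j \<in> S. j < i} * fs ! i else 0) \<in> rmod.span (range pvar)"
      by (simp add: rmod.span_scale rmod.span_zero)
  qed
qed

lemma graded_free_koszul_complex:
  "set fs \<subseteq> forms (int d) \<Longrightarrow> graded_free (koszul_complex d fs)"
  using diff_koszul_complex[of _ fs d] by (simp add: graded_free_def koszul_complex_simps)

lemma graded_free_koszul_ideal_complex:
  assumes "set fs \<subseteq> forms (int d)"
  shows "graded_free (koszul_ideal_complex d fs)"
  unfolding graded_free_def koszul_complex_simps
proof (intro conjI ballI impI)
  fix S T assume "S \<in> Pow {..<length fs} - {{}}" and "T \<in> Pow {..<length fs} - {{}}"
  then have S: "S \<subseteq> {..<length fs}" and T: "T \<subseteq> {..<length fs}" "T \<noteq> {}" by auto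
  show "diff (koszul_complex d fs) S T \<in> forms (int (card S * d) - int (card T * d))"
    using diff_koszul_complex(1)[OF S assms] .
  \<comment> \<open>Since \<open>T\<close> is nonempty, \<open>Suc (card T - 1)\<close> is
    \<open>card T\<close> in spite of truncated subtraction.\<close>
  have "card T > 0" using T finite_subset[of T "{..<length fs}"] card_gt_0_iff by auto
  moreover assume "card S - 1 \<noteq> Suc (card T - 1)"
  ultimately have "card S \<noteq> Suc (card T)" by linarith
  then show "diff (koszul_complex d fs) S T = 0" by (rule diff_koszul_complex(2)[OF S assms])
qed simp

lemma graded_free_tensor:
  assumes "graded_free C" "graded_free D"
  shows "graded_free (tensor_complex C D)"
proof -
  have C: "diff C b b' \<in> forms (shift C b - shift C b')" "hdeg C b \<noteq> Suc (hdeg C b') \<Longrightarrow> diff C b b' = 0"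
    if "b \<in> basis C" "b' \<in> basis C" for b b'
    using assms(1) that by (auto simp: graded_free_def)
  have D: "diff D c c' \<in> forms (shift D c - shift D c')" "hdeg D c \<noteq> Suc (hdeg D c') \<Longrightarrow> diff D c c' = 0"
    if "c \<in> basis D" "c' \<in> basis D" for c c'
    using assms(2) that by (auto simp: graded_free_def)
  have "(if c = c' then diff C b b' else 0) + (if b = b' then (- 1) ^ hdeg C b * diff D c c' else 0)
      \<in> forms (shift C b + shift D c - (shift C b' + shift D c'))"
    if "b \<in> basis C" "b' \<in> basis C" "c \<in> basis D" "c' \<in> basis D" for b b' c c'
    using C(1)[OF that(1,2)] signed_form[OF D(1)[OF that(3,4)]] by (auto intro!: forms_add)
  then show ?thesis
    using assms C(2) D(2) by (auto simp: graded_free_def tensor_complex_def)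
qed

lemma differential_tensor:
  assumes C: "finite (basis C)" and D: "finite (basis D)" and bc: "b' \<in> basis C" "c' \<in> basis D"
  shows "differential (tensor_complex C D) v (b', c') =
    (\<Sum>b\<in>basis C. v (b, c') * diff C b b') + (-1) ^ hdeg C b' * (\<Sum>c\<in>basis D. v (b', c) * diff D c c')"
proof -
  have "differential (tensor_complex C D) v (b', c') =
      (\<Sum>b\<in>basis C. \<Sum>c\<in>basis D. v (b, c) *
        ((if c = c' then diff C b b' else 0) + (if b = b' then (- 1) ^ hdeg C b * diff D c c' else 0)))"
    using bc by (simp add: differential_def tensor_complex_def sum.cartesian_product case_prod_beta cong: if_cong)
  also have "\<dots> = (\<Sum>b\<in>basis C. \<Sum>c\<in>basis D. if c = c' then v (b, c') * diff C b b' else 0) +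
      (\<Sum>b\<in>basis C. \<Sum>c\<in>basis D. if b = b' then v (b', c) * ((- 1) ^ hdeg C b' * diff D c c') else 0)"
    unfolding sum.distrib[symmetric] by (intro sum.cong refl) (auto simp: distrib_left)
  also have "(\<Sum>b\<in>basis C. \<Sum>c\<in>basis D. if c = c' then v (b, c') * diff C b b' else 0) =
      (\<Sum>b\<in>basis C. v (b, c') * diff C b b')"
    using bc D by (simp add: sum.delta)
  also have "(\<Sum>b\<in>basis C. \<Sum>c\<in>basis D. if b = b' then v (b', c) * ((- 1) ^ hdeg C b' * diff D c c') else 0) =
      (\<Sum>c\<in>basis D. \<Sum>b\<in>basis C. if b = b' then v (b', c) * ((- 1) ^ hdeg C b' * diff D c c') else 0)"
    by (rule sum.swap)
  also have "\<dots> = (-1) ^ hdeg C b' * (\<Sum>c\<in>basis D. v (b', c) * diff D c c')"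
    using bc C by (simp add: sum.delta sum_distrib_left ac_simps)
  finally show ?thesis .
qed

section \<open>The tensor product of the two Koszul resolutions\<close>

abbreviation E0 :: "nat set" where "E0 \<equiv> {0}"
abbreviation E1 :: "nat set" where "E1 \<equiv> {Suc 0}"
abbreviation E01 :: "nat set" where "E01 \<equiv> {0, Suc 0}"

text \<open>Removing the index 1 from \<open>E01\<close> passes one smaller index, whence the sign
  of \<open>- g\<close>. The singletons map only to the empty set, which is not in the
  basis.\<close>

lemma koszul_ideal_pair:
  fixes f g :: "'a::comm_ring_1" and d :: nat
  defines "K \<equiv> koszul_ideal_complex d [f, g]"
  shows "basis K = {E0, E1, E01}"
    and "hdeg K E0 = 0" "hdeg K E1 = 0" "hdeg K E01 = 1"
    and "diff K E01 E0 = - g" "diff K E01 E1 = f"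
    and "T \<noteq> {} \<Longrightarrow> diff K E0 T = 0" "T \<noteq> {} \<Longrightarrow> diff K E1 T = 0"
    and "diff K E01 E01 = 0"
proof -
  have "Pow {..<2 :: nat} - {{}} = {{0}, {Suc 0}, {0, Suc 0}}"
    by (auto simp: numeral_2_eq_2 lessThan_Suc Pow_insert)
  then show "basis K = {E0, E1, E01}"
    by (simp add: K_def koszul_ideal_complex_def numeral_2_eq_2)
  show "hdeg K E0 = 0" "hdeg K E1 = 0" "hdeg K E01 = 1"
    by (simp_all add: K_def koszul_ideal_complex_def)
  have d: "diff K S T = (\<Sum>i\<in>S. if T = S - {i} then (- 1) ^ card {j \<in> S. j < i} * [f, g] ! i else 0)" for S T
    by (simp add: K_def koszul_ideal_complex_def koszul_complex_def)
  have "{j \<in> E01. j < Suc 0} = {0}" by auto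
  moreover have "E01 - {0} = {Suc 0}" "E01 - {Suc 0} = {0}" by auto
  ultimately show "diff K E01 E0 = - g" "diff K E01 E1 = f"
    "diff K E01 E01 = 0"
    unfolding d by (auto simp: doubleton_eq_iff)
  show "diff K E0 T = 0" if "T \<noteq> {}" using that unfolding d by simp
  show "diff K E1 T = 0" if "T \<noteq> {}" using that unfolding d by simp
qed

lemma E_distinct:
  "E0 \<noteq> E1" "E0 \<noteq> E01" "E1 \<noteq> E01"
  "E1 \<noteq> E0" "E01 \<noteq> E0" "E01 \<noteq> E1"
  by auto

lemma finsum_ideal_module:
  fixes I :: "'k::field poly4 set"
  assumes I: "rmod.subspace I" and f: "\<And>b. b \<in> B \<Longrightarrow> f b \<in> I" "finite B"
  shows "finsum (ideal_module I) f B = sum f B"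
proof -
  interpret comm_monoid "add_monoid (ideal_module I)"
    by (rule comm_monoidI) (use I in \<open>auto simp: ideal_module_def rmod.subspace_add rmod.subspace_0 algebra_simps\<close>)
  show ?thesis
    unfolding finsum_def using f(2,1)
  proof (induction B)
    case empty
    then show ?case using finprod_empty[of f] by (simp add: ideal_module_def)
  next
    case (insert b B)
    have "f \<in> B \<rightarrow> carrier (add_monoid (ideal_module I))" "f b \<in> carrier (add_monoid (ideal_module I))"
      using insert.prems by (auto simp: ideal_module_def)
    from finprod_insert[OF insert.hyps this]
    have "finprod (add_monoid (ideal_module I)) f (insert b B) = f b + finprod (add_monoid (ideal_module I)) f B"
      by (simp add: ideal_module_def)
    also have "finprod (add_monoid (ideal_module I)) f B = sum f B"
      using insert.prems by (intro insert.IH) simp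
    finally show ?case using insert.hyps by simp
  qed
qed

context regular_forms begin

text \<open>Read as a syzygy of \<open>F1\<close>, \<open>F2\<close>, the relation gives
  \<open>w\<close> with \<open>F1 * w\<close> in the ideal of \<open>F3\<close>, \<open>F4\<close>.
  Regularity puts \<open>w\<close> itself there, with coefficients \<open>x\<close>,
  \<open>y\<close>, and what is left are two syzygies of \<open>F3\<close>, \<open>F4\<close>, with
  factors \<open>p\<close> and \<open>q\<close>.\<close>

lemma tensor_exact_0:
  assumes "a * (F1 * F3) + b * (F1 * F4) + c * (F2 * F3) + e * (F2 * F4) = 0"
  obtains x y p q where "a = - F2 * x - F4 * p" "b = - F2 * y + F3 * p" "c = F1 * x - F4 * q" "e = F1 * y + F3 * q"
proof -
  interpret x: regular_forms F3 F4 F1 F2 d by (rule regular_forms_exchange)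
  have "F1 * (a * F3 + b * F4) + F2 * (c * F3 + e * F4) = 0"
    using assms by (simp add: algebra_simps)
  then have "F1 * (a * F3 + b * F4) + F2 * (c * F3 + e * F4) \<in> rmod.span {}" by simp
  then obtain w where w0: "c * F3 + e * F4 - F1 * w \<in> rmod.span {}" "a * F3 + b * F4 + F2 * w \<in> rmod.span {}"
    using syzygy[OF reg1 reg2] by blast
  have w: "c * F3 + e * F4 = F1 * w" "a * F3 + b * F4 = - F2 * w"
    using w0 by (simp_all add: eq_neg_iff_add_eq_0)
  have "F1 * w \<in> rmod.span {F3, F4}" unfolding mem_span_pair w(1)[symmetric] by blast
  then have "w \<in> rmod.span {F3, F4}" by (rule nzdD[OF x.reg3])
  then obtain x y where xy: "w = x * F3 + y * F4" unfolding mem_span_pair by blast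
  \<comment> \<open>Applied with \<open>G = F1\<close> and with \<open>G = - F2\<close>.\<close>
  have solve: "\<exists>q. r = G * x - F4 * q \<and> s = G * y + F3 * q" if "r * F3 + s * F4 = G * w" for r s G
  proof -
    have "F3 * (r - G * x) + F4 * (s - G * y) = r * F3 + s * F4 - G * w"
      by (simp add: xy algebra_simps)
    then have "F3 * (r - G * x) + F4 * (s - G * y) \<in> rmod.span {}" using that by simp
    then obtain q where "s - G * y - F3 * q \<in> rmod.span {}" "r - G * x + F4 * q \<in> rmod.span {}"
      using syzygy[OF x.reg1 x.reg2] by blast
    then have "r = G * x - F4 * q" "s = G * y + F3 * q" by (simp_all add: algebra_simps eq_diff_eq)
    then show ?thesis by blast
  qed
  obtain q where "c = F1 * x - F4 * q" "e = F1 * y + F3 * q" using solve[OF w(1)] by blast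
  moreover obtain p where "a = - F2 * x - F4 * p" "b = - F2 * y + F3 * p" using solve[OF w(2)] by blast
  ultimately show thesis by (intro that)
qed

text \<open>The third equation, with \<open>F1\<close> a nonzerodivisor modulo \<open>F4\<close>,
  makes \<open>x\<close> a multiple of \<open>F4\<close>; the remaining three unknowns follow by
  cancelling \<open>F4\<close> or \<open>F1\<close>.\<close>

lemma tensor_exact_1:
  assumes "- F2 * x - F4 * p = 0" "- F2 * y + F3 * p = 0" "F1 * x - F4 * q = 0" "F1 * y + F3 * q = 0"
  obtains w where "x = F4 * w" "y = - F3 * w" "p = - F2 * w" "q = F1 * w"
proof -
  interpret x: regular_forms F3 F4 F1 F2 d by (rule regular_forms_exchange)
  \<comment> \<open>The order \<open>F4\<close>, \<open>F1\<close>, \<open>F3\<close>,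
    \<open>F2\<close> is regular as well.\<close>
  have n: "nzd F1 (rmod.span {F4})"
    using regular_forms.reg2[OF regular_forms.regular_forms_swap23[OF x.regular_forms_swap12]] .
  have "F1 * x = q * F4" using assms(3) by (simp add: algebra_simps)
  then have "F1 * x \<in> rmod.span {F4}" by (auto simp: rmod.span_singleton)
  then have "x \<in> rmod.span {F4}" by (rule nzdD[OF n])
  then obtain w where w: "x = F4 * w" by (auto simp: rmod.span_singleton mult.commute)
  have "F4 * (q - F1 * w) = - (F1 * x - F4 * q)" by (simp add: w algebra_simps)
  then have "F4 * (q - F1 * w) = 0" using assms(3) by simp
  then have q: "q = F1 * w" using F_nonzero(4) by simp
  have "F4 * (p + F2 * w) = - (- F2 * x - F4 * p)" by (simp add: w algebra_simps)
  also have "\<dots> = 0" unfolding assms(1) by simp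
  finally have "F4 * (p + F2 * w) = 0" .
  then have p: "p = - F2 * w" using F_nonzero(4) by (simp add: add_eq_0_iff)
  have "F1 * (y + F3 * w) = F1 * y + F3 * q" by (simp add: q algebra_simps)
  then have "F1 * (y + F3 * w) = 0" using assms(4) by simp
  then have "y = - F3 * w" using F_nonzero(1) by (simp add: add_eq_0_iff)
  with w p q show thesis by (intro that)
qed

abbreviation K4 :: "(nat set \<times> nat set, 'k poly4) based_complex" where
  "K4 \<equiv> tensor_complex (koszul_ideal_complex d [F1, F2]) (koszul_ideal_complex d [F3, F4])"

lemma basis_tensor_koszul:
  "basis K4 = {E0, E1, E01} \<times> {E0, E1, E01}"
  by (simp add: tensor_complex_def koszul_ideal_pair)

text \<open>The second factor enters with the sign \<open>(- 1) ^ hdeg\<close>, which is negative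
  exactly in the rows with first entry \<open>E01\<close>.\<close>

lemma differential_tensor_koszul:
  "differential K4 v (E0, E0) = - F2 * v (E01, E0) - F4 * v (E0, E01)"
  "differential K4 v (E0, E1) = - F2 * v (E01, E1) + F3 * v (E0, E01)"
  "differential K4 v (E1, E0) = F1 * v (E01, E0) - F4 * v (E1, E01)"
  "differential K4 v (E1, E1) = F1 * v (E01, E1) + F3 * v (E1, E01)"
  "differential K4 v (E01, E0) = F4 * v (E01, E01)"
  "differential K4 v (E01, E1) = - F3 * v (E01, E01)"
  "differential K4 v (E0, E01) = - F2 * v (E01, E01)"
  "differential K4 v (E1, E01) = F1 * v (E01, E01)"
  "differential K4 v (E01, E01) = 0"
  using E_distinct
  by (simp_all add: differential_tensor koszul_ideal_pair mult.commute del: singleton_insert_inj_eq singleton_insert_inj_eq')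

lemma differential_tensor_koszul_outside: "x \<notin> basis K4 \<Longrightarrow> differential K4 v x = 0"
  by (simp add: differential_def)

text \<open>The 2 compensates the shift by one of the homological degree in each factor.\<close>

lemma mem_free_chains_tensor:
  "v \<in> free_chains K4 n \<longleftrightarrow> (\<forall>x. v x \<noteq> 0 \<longrightarrow> x \<in> basis K4 \<and>
    card (fst x) + card (snd x) = n + 2)"
proof -
  have "hdeg K4 x = n \<longleftrightarrow> card (fst x) + card (snd x) = n + 2" if "x \<in> basis K4" for x
    using that unfolding basis_tensor_koszul by (auto simp: tensor_complex_def koszul_ideal_pair)
  then show ?thesis unfolding free_chains_def by blast
qed

lemma free_chains_tensor:
  "v \<in> free_chains K4 0 \<longleftrightarrow> (\<forall>x. x \<notin> {(E0, E0), (E0, E1),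
    (E1, E0), (E1, E1)} \<longrightarrow> v x = 0)"
  "v \<in> free_chains K4 1 \<longleftrightarrow> (\<forall>x. x \<notin> {(E01, E0), (E01, E1),
    (E0, E01), (E1, E01)} \<longrightarrow> v x = 0)"
  "v \<in> free_chains K4 2 \<longleftrightarrow> (\<forall>x. x \<noteq> (E01, E01) \<longrightarrow> v x = 0)"
  "v \<in> free_chains K4 (n + 3) \<longleftrightarrow> (\<forall>x. v x = 0)"
proof -
  have e0: "x \<in> basis K4 \<and> card (fst x) + card (snd x) = 0 + 2 \<longleftrightarrow>
      x \<in> {(E0, E0), (E0, E1), (E1, E0), (E1, E1)}" for x
    unfolding basis_tensor_koszul by (cases x) auto
  have e1: "x \<in> basis K4 \<and> card (fst x) + card (snd x) = 1 + 2 \<longleftrightarrow>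
      x \<in> {(E01, E0), (E01, E1), (E0, E01), (E1, E01)}" for x
    unfolding basis_tensor_koszul by (cases x) auto
  have e2: "x \<in> basis K4 \<and> card (fst x) + card (snd x) = 2 + 2 \<longleftrightarrow>
      x = (E01, E01)" for x
    unfolding basis_tensor_koszul by (cases x) auto
  have e3: "\<not> (x \<in> basis K4 \<and> card (fst x) + card (snd x) = n + 3 + 2)" for x
    unfolding basis_tensor_koszul by (cases x) auto
  show "v \<in> free_chains K4 0 \<longleftrightarrow> (\<forall>x. x \<notin> {(E0, E0), (E0, E1),
      (E1, E0), (E1, E1)} \<longrightarrow> v x = 0)"
    unfolding mem_free_chains_tensor e0 by blast
  show "v \<in> free_chains K4 1 \<longleftrightarrow> (\<forall>x. x \<notin> {(E01, E0), (E01, E1),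
      (E0, E01), (E1, E01)} \<longrightarrow> v x = 0)"
    unfolding mem_free_chains_tensor e1 by blast
  show "v \<in> free_chains K4 2 \<longleftrightarrow> (\<forall>x. x \<noteq> (E01, E01) \<longrightarrow> v x = 0)"
    unfolding mem_free_chains_tensor e2 by blast
  show "v \<in> free_chains K4 (n + 3) \<longleftrightarrow> (\<forall>x. v x = 0)"
    unfolding mem_free_chains_tensor using e3 by blast
qed

lemma basis_tensor_koszul_list:
  "basis K4 = {(E0, E0), (E0, E1),
    (E1, E0), (E1, E1), (E01, E0), (E01, E1),
    (E0, E01), (E1, E01), (E01, E01)}"
  unfolding basis_tensor_koszul by auto

lemma eq_differential_tensor_koszul:
  "u = differential K4 v \<longleftrightarrow> (\<forall>x. x \<notin> basis K4 \<longrightarrow> u x = 0) \<and>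
    u (E0, E0) = - F2 * v (E01, E0) - F4 * v (E0, E01) \<and>
    u (E0, E1) = - F2 * v (E01, E1) + F3 * v (E0, E01) \<and>
    u (E1, E0) = F1 * v (E01, E0) - F4 * v (E1, E01) \<and>
    u (E1, E1) = F1 * v (E01, E1) + F3 * v (E1, E01) \<and>
    u (E01, E0) = F4 * v (E01, E01) \<and>
    u (E01, E1) = - F3 * v (E01, E01) \<and>
    u (E0, E01) = - F2 * v (E01, E01) \<and>
    u (E1, E01) = F1 * v (E01, E01) \<and>
    u (E01, E01) = 0" (is "_ = ?R")
proof
  show "u = differential K4 v \<Longrightarrow> ?R"
    by (simp only: differential_tensor_koszul simp_thms) (blast intro: differential_tensor_koszul_outside)
  assume R: ?R
  show "u = differential K4 v"
  proof
    fix x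
    show "u x = differential K4 v x"
    proof (cases "x \<in> basis K4")
      case True
      then show ?thesis
        unfolding basis_tensor_koszul_list insert_iff empty_iff using R differential_tensor_koszul[of v]
        by (elim disjE) (simp_all only: simp_thms)
    next
      case False
      then show ?thesis using R differential_tensor_koszul_outside by metis
    qed
  qed
qed

lemma tensor_koszul_augmentation:
  assumes v: "v \<in> free_chains K4 0"
  shows "augmentation K4
      (\<lambda>(S, T). koszul_ideal_augmentation [F1, F2] S * koszul_ideal_augmentation [F3, F4] T)
      (ideal_module inter_ideal) v =
    v (E0, E0) * (F1 * F3) + v (E0, E1) * (F1 * F4) +
    v (E1, E0) * (F2 * F3) + v (E1, E1) * (F2 * F4)"
    (is "augmentation _ ?\<epsilon> _ v = ?rhs")
proof -
  have B: "{b \<in> basis K4. hdeg K4 b = 0} =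
      {(E0, E0), (E0, E1), (E1, E0), (E1, E1)}"
    unfolding basis_tensor_koszul by (auto simp: tensor_complex_def koszul_ideal_pair)
  have \<epsilon>: "?\<epsilon> (E0, E0) = F1 * F3" "?\<epsilon> (E0, E1) = F1 * F4"
    "?\<epsilon> (E1, E0) = F2 * F3" "?\<epsilon> (E1, E1) = F2 * F4"
    by (simp_all add: koszul_ideal_augmentation_def)
  have sI: "rmod.subspace inter_ideal" by (simp add: rmod.subspace_inter)
  have mem: "v b * ?\<epsilon> b \<in> inter_ideal" if "b \<in> {(E0, E0), (E0, E1), (E1, E0), (E1, E1)}" for b
  proof (rule rmod.subspace_scale[OF sI])
    have "{F1 * F3, F1 * F4, F2 * F3, F2 * F4} \<subseteq> inter_ideal"
      unfolding inter_eq_products by (rule rmod.span_superset)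
    then show "?\<epsilon> b \<in> inter_ideal" using that \<epsilon> by auto
  qed
  have "augmentation K4 ?\<epsilon> (ideal_module inter_ideal) v =
      finsum (ideal_module inter_ideal) (\<lambda>b. v b * ?\<epsilon> b)
        {(E0, E0), (E0, E1), (E1, E0), (E1, E1)}"
    unfolding augmentation_def B by (simp add: ideal_module_def)
  also have "\<dots> = (\<Sum>b\<in>{(E0, E0), (E0, E1), (E1, E0), (E1, E1)}. v b * ?\<epsilon> b)"
    by (rule finsum_ideal_module[OF sI mem]) simp_all
  also have "\<dots> = ?rhs" by (simp add: koszul_ideal_augmentation_def add.assoc)
  finally show ?thesis .
qed

text \<open>The augmentation is onto because the products generate the intersection. Exactness in
  degrees 0 and 1 is \<open>tensor_exact_0\<close> and \<open>tensor_exact_1\<close>, and in degree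
  2 it is the injectivity of multiplication by \<open>F1\<close>. Minimality holds as all entries
  are built from forms of positive degree.\<close>

lemma tensor_koszul_resolution:
  "minimal_free_resolution K4
    (\<lambda>(S, T). koszul_ideal_augmentation [F1, F2] S * koszul_ideal_augmentation [F3, F4] T)
    (ideal_module inter_ideal)"
  (is "minimal_free_resolution _ ?\<epsilon> _")
  unfolding minimal_free_resolution_def graded_free_resolution_def
proof (intro conjI ballI allI impI)
  have gf: "graded_free (koszul_ideal_complex d [F1, F2])" "graded_free (koszul_ideal_complex d [F3, F4])"
    using F_forms by (simp_all add: graded_free_koszul_ideal_complex)
  then show "graded_free K4" by (rule graded_free_tensor)
  have products: "{F1 * F3, F1 * F4, F2 * F3, F2 * F4} \<subseteq> inter_ideal"
    unfolding inter_eq_products by (rule rmod.span_superset)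
  show "?\<epsilon> b \<in> piece (ideal_module inter_ideal) (shift K4 b)"
    if "b \<in> basis K4" "hdeg K4 b = 0" for b
  proof -
    have "F * G \<in> forms (int d + int d)" if "F \<in> {F1, F2}" "G \<in> {F3, F4}" for F G
      using that F_forms forms_mult by blast
    then show ?thesis
      using that products unfolding basis_tensor_koszul
      by (auto simp: tensor_complex_def koszul_ideal_pair koszul_ideal_augmentation_def ideal_module_def
          koszul_ideal_complex_def koszul_complex_def)
  qed
  show "augmentation K4 ?\<epsilon> (ideal_module inter_ideal) ` free_chains K4 0 =
      carrier (ideal_module inter_ideal)"
  proof (intro equalityI subsetI)
    fix x assume "x \<in> augmentation K4 ?\<epsilon> (ideal_module inter_ideal) ` free_chains K4 0"
    then obtain v where "v \<in> free_chains K4 0"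
      "x = augmentation K4 ?\<epsilon> (ideal_module inter_ideal) v" by blast
    then have "x = v (E0, E0) * (F1 * F3) + v (E0, E1) * (F1 * F4) +
        v (E1, E0) * (F2 * F3) + v (E1, E1) * (F2 * F4)"
      using tensor_koszul_augmentation by simp
    moreover have "\<dots> \<in> inter_ideal"
      unfolding inter_eq_products by (intro rmod.span_add; rule rmod.span_scale, rule rmod.span_base, simp)
    ultimately show "x \<in> carrier (ideal_module inter_ideal)" by (simp add: ideal_module_def)
  next
    fix x assume "x \<in> carrier (ideal_module inter_ideal)"
    then have "x \<in> rmod.span {F1 * F3, F1 * F4, F2 * F3, F2 * F4}"
      by (simp add: ideal_module_def flip: inter_eq_products)
    then obtain a b c e where "x - a * (F1 * F3) - b * (F1 * F4) - c * (F2 * F3) - e * (F2 * F4) = 0"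
      by (auto simp: rmod.span_insert)
    then have x: "x = a * (F1 * F3) + b * (F1 * F4) + c * (F2 * F3) + e * (F2 * F4)"
      by (simp add: algebra_simps)
    define v where "v = (\<lambda>_. 0)((E0, E0) := a, (E0, E1) := b,
      (E1, E0) := c, (E1, E1) := e)"
    have v: "v \<in> free_chains K4 0" unfolding free_chains_tensor by (simp add: v_def)
    moreover have "augmentation K4 ?\<epsilon> (ideal_module inter_ideal) v = x"
      unfolding tensor_koszul_augmentation[OF v] x by (simp add: v_def)
    ultimately show "x \<in> augmentation K4 ?\<epsilon> (ideal_module inter_ideal) ` free_chains K4 0"
      by blast
  qed
  show "{v \<in> free_chains K4 0. augmentation K4 ?\<epsilon> (ideal_module inter_ideal) v = \<zero>\<^bsub>ideal_module inter_ideal\<^esub>} =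
      differential K4 ` free_chains K4 1"
  proof (intro equalityI subsetI)
    fix v assume "v \<in> {v \<in> free_chains K4 0. augmentation K4 ?\<epsilon> (ideal_module inter_ideal) v = \<zero>\<^bsub>ideal_module inter_ideal\<^esub>}"
    then have v: "v \<in> free_chains K4 0"
      and 0: "augmentation K4 ?\<epsilon> (ideal_module inter_ideal) v = 0"
      by (auto simp: ideal_module_def)
    obtain x y p q where xy: "v (E0, E0) = - F2 * x - F4 * p" "v (E0, E1) = - F2 * y + F3 * p"
      "v (E1, E0) = F1 * x - F4 * q" "v (E1, E1) = F1 * y + F3 * q"
      by (rule tensor_exact_0[OF 0[unfolded tensor_koszul_augmentation[OF v]]])
    define u where "u = (\<lambda>_. 0)((E01, E0) := x, (E01, E1) := y,
      (E0, E01) := p, (E1, E01) := q)"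
    have "u \<in> free_chains K4 1" unfolding free_chains_tensor by (simp add: u_def)
    moreover have "v = differential K4 u"
      unfolding eq_differential_tensor_koszul
      using v xy E_distinct unfolding free_chains_tensor basis_tensor_koszul_list by (simp add: u_def)
    ultimately show "v \<in> differential K4 ` free_chains K4 1" by blast
  next
    fix v assume "v \<in> differential K4 ` free_chains K4 1"
    then obtain u where u: "u \<in> free_chains K4 1" "v = differential K4 u" by blast
    have "u (E01, E01) = 0"
      using u(1) E_distinct unfolding free_chains_tensor by simp
    then have vu: "v (E01, E0) = 0" "v (E01, E1) = 0"
      "v (E0, E01) = 0" "v (E1, E01) = 0" "v (E01, E01) = 0"
      unfolding u(2) differential_tensor_koszul by simp_all
    have v: "v \<in> free_chains K4 0"
      unfolding free_chains_tensor
    proof (intro allI impI)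
      fix x assume x: "x \<notin> {(E0, E0), (E0, E1), (E1, E0), (E1, E1)}"
      show "v x = 0"
      proof (cases "x \<in> basis K4")
        case True
        with x have "x \<in> {(E01, E0), (E01, E1),
            (E0, E01), (E1, E01), (E01, E01)}"
          unfolding basis_tensor_koszul_list by blast
        then show ?thesis using vu by blast
      next
        case False
        then show ?thesis unfolding u(2) by (rule differential_tensor_koszul_outside)
      qed
    qed
    moreover have "augmentation K4 ?\<epsilon> (ideal_module inter_ideal) v = 0"
      unfolding tensor_koszul_augmentation[OF v] unfolding u(2) differential_tensor_koszul
      by (simp add: algebra_simps)
    ultimately show "v \<in> {v \<in> free_chains K4 0. augmentation K4 ?\<epsilon> (ideal_module inter_ideal) v = \<zero>\<^bsub>ideal_module inter_ideal\<^esub>}"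
      by (simp add: ideal_module_def)
  qed
  show "{v \<in> free_chains K4 n. differential K4 v = (\<lambda>_. 0)} =
      differential K4 ` free_chains K4 (Suc n)" if "n \<ge> 1" for n
  proof -
    have "n = 1 \<or> n = 2 \<or> n = (n - 3) + 3" using that by linarith
    then consider "n = 1" | "n = 2" | m where "n = m + 3" by blast
    then show ?thesis
    proof cases
      case 1
      show ?thesis
      proof (intro equalityI subsetI)
        fix v assume "v \<in> {v \<in> free_chains K4 n. differential K4 v = (\<lambda>_. 0)}"
        then have v: "v \<in> free_chains K4 1" and 0: "(\<lambda>_. 0) = differential K4 v"
          by (auto simp: 1)
        obtain w where w: "v (E01, E0) = F4 * w" "v (E01, E1) = - F3 * w"
          "v (E0, E01) = - F2 * w" "v (E1, E01) = F1 * w"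
          by (rule tensor_exact_1[OF
                fun_cong[OF 0, of "(E0, E0)", unfolded differential_tensor_koszul, symmetric]
                fun_cong[OF 0, of "(E0, E1)", unfolded differential_tensor_koszul, symmetric]
                fun_cong[OF 0, of "(E1, E0)", unfolded differential_tensor_koszul, symmetric]
                fun_cong[OF 0, of "(E1, E1)", unfolded differential_tensor_koszul, symmetric]])
        define u where "u = (\<lambda>_. 0)((E01, E01) := w)"
        have "u \<in> free_chains K4 2" unfolding free_chains_tensor by (simp add: u_def)
        moreover have "v = differential K4 u"
          unfolding eq_differential_tensor_koszul
          using v w E_distinct unfolding free_chains_tensor basis_tensor_koszul_list by (simp add: u_def)
        ultimately show "v \<in> differential K4 ` free_chains K4 (Suc n)"
          by (auto simp: 1 numeral_2_eq_2)
      next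
        fix v assume "v \<in> differential K4 ` free_chains K4 (Suc n)"
        then obtain u where u: "u \<in> free_chains K4 2" "v = differential K4 u"
          by (auto simp: 1 numeral_2_eq_2)
        have u0: "u x = 0" if "x \<noteq> (E01, E01)" for x
          using u(1) that unfolding free_chains_tensor by blast
        have u00: "u (E01, E0) = 0" "u (E01, E1) = 0"
          "u (E0, E01) = 0" "u (E1, E01) = 0"
          using E_distinct by (auto intro!: u0)
        have vu: "v (E0, E0) = 0" "v (E0, E1) = 0"
          "v (E1, E0) = 0" "v (E1, E1) = 0" "v (E01, E01) = 0"
          unfolding u(2) differential_tensor_koszul u00 by simp_all
        have v: "v \<in> free_chains K4 1"
          unfolding free_chains_tensor
        proof (intro allI impI)
          fix x assume x: "x \<notin> {(E01, E0), (E01, E1),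
            (E0, E01), (E1, E01)}"
          show "v x = 0"
          proof (cases "x \<in> basis K4")
            case True
            with x have "x \<in> {(E0, E0), (E0, E1),
                (E1, E0), (E1, E1), (E01, E01)}"
              unfolding basis_tensor_koszul_list by blast
            then show ?thesis using vu by blast
          next
            case False
            then show ?thesis unfolding u(2) by (rule differential_tensor_koszul_outside)
          qed
        qed
        moreover have "(\<lambda>_. 0) = differential K4 v"
          unfolding eq_differential_tensor_koszul unfolding u(2) differential_tensor_koszul
          by (simp add: algebra_simps)
        ultimately show "v \<in> {v \<in> free_chains K4 n. differential K4 v = (\<lambda>_. 0)}"
          by (simp add: 1)
      qed
    next
      case 2
      have "free_chains K4 (Suc n) = {\<lambda>_. 0}"
        using free_chains_tensor(4)[of _ 0] by (auto simp: 2 numeral_3_eq_3 numeral_2_eq_2)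
      moreover have "differential K4 (\<lambda>_. 0) = (\<lambda>_. 0)"
        by (auto simp: differential_def)
      moreover have "v = (\<lambda>_. 0)" if "v \<in> free_chains K4 2" "differential K4 v = (\<lambda>_. 0)" for v
      proof
        fix x
        have "F1 * v (E01, E01) = 0"
          using that(2)[symmetric] unfolding eq_differential_tensor_koszul by simp
        then have "v (E01, E01) = 0" using F_nonzero(1) by simp
        then show "v x = 0" using that(1) unfolding free_chains_tensor by metis
      qed
      moreover have "(\<lambda>_. 0) \<in> free_chains K4 2" by (simp add: free_chains_def)
      ultimately show ?thesis by (auto simp: 2)
    next
      case 3
      have "free_chains K4 n = {\<lambda>_. 0}"
        using free_chains_tensor(4)[of _ m] by (auto simp: 3)
      moreover have "free_chains K4 (Suc n) = {\<lambda>_. 0}"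
        using free_chains_tensor(4)[of _ "Suc m"] by (auto simp: 3)
      moreover have "differential K4 (\<lambda>_. 0) = (\<lambda>_. 0)"
        by (auto simp: differential_def)
      ultimately show ?thesis by auto
    qed
  qed
  have irr: "diff (koszul_ideal_complex d fs) S T \<in> irrelevant_ideal"
    if "set fs \<subseteq> forms (int d)" "S \<in> basis (koszul_ideal_complex d fs)" for fs :: "'k poly4 list" and S T
    using diff_koszul_complex(3)[OF _ that(1) d_pos, of S T] that(2)
    by (simp add: koszul_complex_simps)
  show "diff K4 b c \<in> irrelevant_ideal" if "b \<in> basis K4" for b c
  proof -
    have "diff (koszul_ideal_complex d [F1, F2]) (fst b) (fst c) \<in> rmod.span (range pvar)"
      "diff (koszul_ideal_complex d [F3, F4]) (snd b) (snd c) \<in> rmod.span (range pvar)"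
      unfolding irrelevant_ideal_eq[symmetric]
      using that F_forms by (auto intro!: irr simp: tensor_complex_def)
    then show ?thesis
      unfolding irrelevant_ideal_eq
      by (auto simp: tensor_complex_def case_prod_beta rmod.span_zero intro!: rmod.span_add rmod.span_scale)
  qed
qed

end

section \<open>The Hartshorne-Rao module\<close>

context regular_forms begin

abbreviation all_ideal :: "'k poly4 set"
  where "all_ideal \<equiv> rmod.span {F1, F2, F3, F4}"

abbreviation coh_group :: "int \<Rightarrow> ('k poly4 set, 'k poly4 fract) cochain set monoid"
  where "coh_group t \<equiv> H1 zariski (twist (subscheme_of inter_ideal) t)"

lemma constant_subsheaf_inter:
  "constant_subsheaf zariski {0} (stalk inter_ideal t) (twist (subscheme_of inter_ideal) t)"
  by (rule constant_subsheaf_twist) (simp add: rmod.subspace_inter)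

lemma consistent_iff:
  "constant_subsheaf.consistent zariski (stalk inter_ideal t) \<beta> \<longleftrightarrow> locally_constant_mod inter_ideal t \<beta>"
  unfolding constant_subsheaf.consistent_def[OF constant_subsheaf_inter] locally_constant_mod_def by simp

definition rao_class :: "int \<Rightarrow> 'k poly4 \<Rightarrow> ('k poly4 set, 'k poly4 fract) cochain set"
  where "rao_class t f = constant_subsheaf.coh_class zariski {0} (stalk inter_ideal t)
    (twist (subscheme_of inter_ideal) t) (jump f)"

lemma jump_add: "jump f P + jump g P = jump (f + g) P"
  and jump_diff: "jump f P - jump g P = jump (f - g) P"
  and jump_mult: "emb r * jump f P = jump (r * f) P"
  and jump_zero: "jump 0 P = 0"
  by (simp_all add: jump_def emb_add emb_diff emb_mult)

lemma rao_class_eq_iff: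
  assumes "f \<in> forms t" "g \<in> forms t"
  shows "rao_class t f = rao_class t g \<longleftrightarrow> f - g \<in> all_ideal"
proof -
  interpret h: constant_subsheaf zariski "{0}" "stalk inter_ideal t" "twist (subscheme_of inter_ideal) t"
    by (rule constant_subsheaf_inter)
  have "h.consistent (jump f)" using assms(1) by (simp add: consistent_iff jump_locally_constant)
  then have "rao_class t f = rao_class t g \<longleftrightarrow> h.similar (jump f) (jump g)"
    unfolding rao_class_def by (rule h.coh_class_eq_iff)
  also have "\<dots> \<longleftrightarrow> (\<exists>\<kappa>. \<forall>P\<in>proj3. jump (f - g) P - \<kappa> \<in> stalk inter_ideal t P)"
    unfolding h.similar_def by (simp add: jump_diff)
  also have "\<dots> \<longleftrightarrow> f - g \<in> all_ideal"
    by (rule jump_trivial_iff[OF forms_diff[OF assms]])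
  finally show ?thesis .
qed

lemma carrier_coh_group: "carrier (coh_group t) = rao_class t ` forms t"
proof -
  interpret h: constant_subsheaf zariski "{0}" "stalk inter_ideal t" "twist (subscheme_of inter_ideal) t"
    by (rule constant_subsheaf_inter)
  show ?thesis
    unfolding h.carrier_H1
  proof (intro equalityI subsetI)
    fix \<alpha> assume "\<alpha> \<in> h.coh_class ` {\<beta>. h.consistent \<beta>}"
    then obtain \<beta> where b: "h.consistent \<beta>" "\<alpha> = h.coh_class \<beta>" by blast
    have "locally_constant_mod inter_ideal t \<beta>" using b(1) by (simp only: consistent_iff)
    then show "\<alpha> \<in> rao_class t ` forms t"
    proof (rule jump_surjective)
      fix f \<kappa> assume f: "f \<in> forms t" "\<And>P. P \<in> proj3 \<Longrightarrow> \<beta> P - jump f P - \<kappa> \<in> stalk inter_ideal t P"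
      have "h.similar \<beta> (jump f)" unfolding h.similar_def using f(2) by auto
      then have "\<alpha> = rao_class t f"
        unfolding b(2) rao_class_def using h.coh_class_eq_iff[OF b(1)] by blast
      then show ?thesis using f(1) by blast
    qed
  next
    fix \<alpha> assume "\<alpha> \<in> rao_class t ` forms t"
    then obtain f where "f \<in> forms t" "\<alpha> = h.coh_class (jump f)" unfolding rao_class_def by blast
    then show "\<alpha> \<in> h.coh_class ` {\<beta>. h.consistent \<beta>}"
      using jump_locally_constant consistent_iff by blast
  qed
qed

lemma mult_coh_group:
  assumes "f \<in> forms t" "g \<in> forms t"
  shows "rao_class t f \<otimes>\<^bsub>coh_group t\<^esub> rao_class t g = rao_class t (f + g)"
proof -
  interpret h: constant_subsheaf zariski "{0}" "stalk inter_ideal t" "twist (subscheme_of inter_ideal) t"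
    by (rule constant_subsheaf_inter)
  have "h.consistent (jump f)" "h.consistent (jump g)"
    using assms by (simp_all add: consistent_iff jump_locally_constant)
  from h.mult_H1[OF this] show ?thesis unfolding rao_class_def jump_add .
qed

lemma one_coh_group: "\<one>\<^bsub>coh_group t\<^esub> = rao_class t 0"
proof -
  interpret h: constant_subsheaf zariski "{0}" "stalk inter_ideal t" "twist (subscheme_of inter_ideal) t"
    by (rule constant_subsheaf_inter)
  have "jump 0 = (\<lambda>P. 0)" by (simp add: jump_zero fun_eq_iff)
  then show ?thesis unfolding rao_class_def by (simp only: h.one_H1)
qed

lemma scale_coh_group:
  assumes r: "r \<in> forms e" and f: "f \<in> forms (t - e)"
  shows "H1_scale zariski (twist (subscheme_of inter_ideal) t) (Fract r 1) (rao_class (t - e) f) =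
    rao_class t (r * f)"
proof -
  have I: "rmod.subspace inter_ideal" by (simp add: rmod.subspace_inter)
  have "emb r * a \<in> stalk inter_ideal t P" if "P \<in> topspace zariski" "a \<in> stalk inter_ideal (t - e) P" for P a
    using stalk_scale[OF _ that(2) r I] that(1) by simp
  moreover have "constant_subsheaf.consistent zariski (stalk inter_ideal (t - e)) (jump f)"
    using f by (simp add: consistent_iff jump_locally_constant)
  ultimately have "H1_scale zariski (twist (subscheme_of inter_ideal) t) (emb r) (rao_class (t - e) f) =
      constant_subsheaf.coh_class zariski {0} (stalk inter_ideal t) (twist (subscheme_of inter_ideal) t)
        (\<lambda>P. emb r * jump f P)"
    unfolding rao_class_def
    by (rule H1_scale_coh_class[OF constant_subsheaf_inter constant_subsheaf_inter])
  then show ?thesis unfolding emb_def[symmetric] rao_class_def jump_mult .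
qed

text \<open>Every class comes from a form, so the group laws reduce to those of addition of forms.
  The direct sum and the finite products in the Rao module depend on them.\<close>

lemma comm_group_coh_group: "comm_group (coh_group t)"
proof (rule comm_groupI)
  show "\<one>\<^bsub>coh_group t\<^esub> \<in> carrier (coh_group t)" by (auto simp: carrier_coh_group one_coh_group)
  show "\<exists>y\<in>carrier (coh_group t). y \<otimes>\<^bsub>coh_group t\<^esub> x = \<one>\<^bsub>coh_group t\<^esub>"
    if "x \<in> carrier (coh_group t)" for x
  proof -
    obtain f where f: "f \<in> forms t" "x = rao_class t f" using \<open>x \<in> carrier (coh_group t)\<close> by (auto simp: carrier_coh_group)
    then have "rao_class t (- f) \<otimes>\<^bsub>coh_group t\<^esub> x = \<one>\<^bsub>coh_group t\<^esub>"
      by (simp add: mult_coh_group one_coh_group forms_uminus)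
    then show ?thesis using f(1) forms_uminus by (auto simp: carrier_coh_group)
  qed
qed (auto simp: carrier_coh_group mult_coh_group one_coh_group forms_add ac_simps)

lemma finprod_coh_group:
  assumes "finite E" "\<And>e. e \<in> E \<Longrightarrow> g e \<in> forms t"
  shows "(\<Otimes>\<^bsub>coh_group t\<^esub>e\<in>E. rao_class t (g e)) = rao_class t (sum g E)"
proof -
  interpret comm_group "coh_group t" by (rule comm_group_coh_group)
  show ?thesis
    using assms
  proof (induction E)
    case empty
    then show ?case by (simp add: one_coh_group)
  next
    case (insert e E)
    have "(\<Otimes>\<^bsub>coh_group t\<^esub>e\<in>insert e E. rao_class t (g e)) =
        rao_class t (g e) \<otimes>\<^bsub>coh_group t\<^esub> (\<Otimes>\<^bsub>coh_group t\<^esub>e\<in>E. rao_class t (g e))"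
      using insert.hyps insert.prems by (intro finprod_insert) (auto simp: carrier_coh_group)
    also have "\<dots> = rao_class t (g e + sum g E)"
      using insert by (simp add: mult_coh_group forms_sum)
    finally show ?case using insert.hyps by simp
  qed
qed

section \<open>The module structure and the isomorphism with the quotient ring\<close>

abbreviation "rao \<equiv> rao_module (subscheme_of inter_ideal)"

lemma rao_simps:
  "carrier rao = {u. (\<forall>t. u t \<in> carrier (coh_group t)) \<and> finite {t. u t \<noteq> \<one>\<^bsub>coh_group t\<^esub>}}"
  "add rao u v = (\<lambda>t. u t \<otimes>\<^bsub>coh_group t\<^esub> v t)"
  "\<zero>\<^bsub>rao\<^esub> = (\<lambda>t. \<one>\<^bsub>coh_group t\<^esub>)"
  "r \<odot>\<^bsub>rao\<^esub> u = (\<lambda>t. \<Otimes>\<^bsub>coh_group t\<^esub>e\<in>{e. hcomp e r \<noteq> 0}.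
     H1_scale zariski (twist (subscheme_of inter_ideal) t) (Fract (hcomp e r) 1) (u (t - e)))"
  "piece rao t = {u \<in> carrier rao. \<forall>s. s \<noteq> t \<longrightarrow> u s = \<one>\<^bsub>coh_group s\<^esub>}"
proof -
  have group: "group (coh_group t)" for t using comm_group_coh_group by (rule comm_group.axioms(2))
  show c: "carrier rao = {u. (\<forall>t. u t \<in> carrier (coh_group t)) \<and> finite {t. u t \<noteq> \<one>\<^bsub>coh_group t\<^esub>}}"
    by (simp add: rao_module_def Let_def carrier_sum_group group PiE_iff)
  show "piece rao t = {u \<in> carrier rao. \<forall>s. s \<noteq> t \<longrightarrow> u s = \<one>\<^bsub>coh_group s\<^esub>}"
    by (simp add: rao_module_def Let_def)
qed (simp_all add: rao_module_def Let_def restrict_UNIV)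

abbreviation coset :: "'k poly4 \<Rightarrow> 'k poly4 set"
  where "coset f \<equiv> all_ideal +>\<^bsub>polyring\<^esub> f"

lemma ideal_all: "ideal all_ideal (polyring :: 'k poly4 ring)"
  by (simp add: ideal_iff_subspace)

lemma coset_eq_iff: "coset f = coset g \<longleftrightarrow> f - g \<in> all_ideal"
proof -
  interpret cring "polyring :: 'k poly4 ring" ..
  show ?thesis
    using quotient_eq_iff_same_a_r_cos[OF ideal_all, of f g] by (simp add: a_minus_def)
qed

lemma quotient_simps:
  "carrier (quotient_module all_ideal) = range coset"
  "add (quotient_module all_ideal) (coset f) (coset g) = coset (f + g)"
  "r \<odot>\<^bsub>quotient_module all_ideal\<^esub> coset f = coset (r * f)"
  "piece (quotient_module all_ideal) t = coset ` forms t"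
proof -
  interpret cring "polyring :: 'k poly4 ring" ..
  interpret I: ideal all_ideal "polyring :: 'k poly4 ring" by (rule ideal_all)
  show "carrier (quotient_module all_ideal) = range coset"
    unfolding quotient_module_def FactRing_def A_RCOSETS_def' by auto
  show "add (quotient_module all_ideal) (coset f) (coset g) = coset (f + g)"
    using I.a_rcos_sum[of f g] by (simp add: quotient_module_def FactRing_def)
  show "r \<odot>\<^bsub>quotient_module all_ideal\<^esub> coset f = coset (r * f)"
    using I.rcoset_mult_add[of r f] by (simp add: quotient_module_def FactRing_def)
  show "piece (quotient_module all_ideal) t = coset ` forms t"
    by (simp add: quotient_module_def)
qed

text \<open>The choice of a representative is harmless because the ideal is homogeneous: see
  \<open>rao_map_coset\<close>.\<close>

definition rao_map :: "'k poly4 set \<Rightarrow> int \<Rightarrow> ('k poly4 set, 'k poly4 fract) cochain set"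
  where "rao_map c = (\<lambda>t. rao_class t (hcomp t (SOME f. coset f = c)))"

lemma rao_map_coset: "rao_map (coset f) = (\<lambda>t. rao_class t (hcomp t f))"
proof
  fix t
  define g where "g = (SOME g. coset g = coset f)"
  have "coset g = coset f" unfolding g_def by (rule someI[of _ f]) (rule refl)
  then have "g - f \<in> all_ideal" by (simp add: coset_eq_iff)
  then have "hcomp t (g - f) \<in> all_ideal" by (rule homogeneous_hcomp[OF homogeneous_spans(4)])
  then have "rao_class t (hcomp t g) = rao_class t (hcomp t f)"
    by (simp add: rao_class_eq_iff hcomp_diff)
  then show "rao_map (coset f) t = rao_class t (hcomp t f)" by (simp add: rao_map_def g_def)
qed

lemma rao_map_eq_iff: "rao_map (coset f) = rao_map (coset g) \<longleftrightarrow> f - g \<in> all_ideal"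
proof -
  have "rao_map (coset f) = rao_map (coset g) \<longleftrightarrow> (\<forall>t. hcomp t (f - g) \<in> all_ideal)"
    by (simp add: rao_map_coset fun_eq_iff rao_class_eq_iff hcomp_diff)
  also have "\<dots> \<longleftrightarrow> f - g \<in> all_ideal"
    using homogeneous_hcomp[OF homogeneous_spans(4)] homogeneous_memI[OF homogeneous_spans(4)] by blast
  finally show ?thesis .
qed

lemma rao_map_form:
  assumes "f \<in> forms t"
  shows "rao_map (coset f) s = (if s = t then rao_class t f else \<one>\<^bsub>coh_group s\<^esub>)"
  using assms by (simp add: rao_map_coset hcomp_form one_coh_group)

lemma rao_map_carrier: "rao_map (coset f) \<in> carrier rao"
proof -
  have "{t. rao_class t (hcomp t f) \<noteq> \<one>\<^bsub>coh_group t\<^esub>} \<subseteq> {t. hcomp t f \<noteq> 0}"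
    by (auto simp: one_coh_group)
  then have "finite {t. rao_class t (hcomp t f) \<noteq> \<one>\<^bsub>coh_group t\<^esub>}"
    using finite_degrees finite_subset by blast
  then show ?thesis by (simp add: rao_simps(1) rao_map_coset carrier_coh_group)
qed

lemma rao_map_add: "rao_map (coset (f + g)) = add rao (rao_map (coset f)) (rao_map (coset g))"
  by (simp add: rao_simps(2) rao_map_coset mult_coh_group hcomp_add)

lemma rao_map_scale: "rao_map (coset (r * f)) = r \<odot>\<^bsub>rao\<^esub> rao_map (coset f)"
proof
  fix t
  have "(r \<odot>\<^bsub>rao\<^esub> rao_map (coset f)) t = (\<Otimes>\<^bsub>coh_group t\<^esub>e\<in>{e. hcomp e r \<noteq> 0}.
      rao_class t (hcomp e r * hcomp (t - e) f))"
    by (simp add: rao_simps(4) rao_map_coset scale_coh_group)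
  also have "\<dots> = rao_class t (\<Sum>e\<in>{e. hcomp e r \<noteq> 0}. hcomp e r * hcomp (t - e) f)"
  proof (rule finprod_coh_group)
    show "hcomp e r * hcomp (t - e) f \<in> forms t" for e
      using forms_mult[OF hcomp_in_forms hcomp_in_forms, of e r "t - e" f] by simp
  qed simp
  also have "\<dots> = rao_map (coset (r * f)) t" by (simp add: rao_map_coset hcomp_mult)
  finally show "rao_map (coset (r * f)) t = (r \<odot>\<^bsub>rao\<^esub> rao_map (coset f)) t" ..
qed

text \<open>Finite support makes the sum of the representing forms a polynomial. Choosing the
  component 0 wherever \<open>u\<close> is trivial gives the second property, which later identifies
  the graded pieces.\<close>

lemma rao_map_surj:
  assumes u: "u \<in> carrier rao"
  obtains f where "u = rao_map (coset f)" "\<And>t. u t = \<one>\<^bsub>coh_group t\<^esub> \<Longrightarrow> hcomp t f = 0"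
proof -
  have "\<forall>t. \<exists>g. g \<in> forms t \<and> u t = rao_class t g"
    using u by (auto simp: rao_simps(1) carrier_coh_group)
  then obtain g where g: "\<And>t. g t \<in> forms t" "\<And>t. u t = rao_class t (g t)" by metis
  define T where "T = {t. u t \<noteq> \<one>\<^bsub>coh_group t\<^esub>}"
  have "finite T" using u by (simp add: rao_simps(1) T_def)
  define f where "f = (\<Sum>t\<in>T. g t)"
  have hf: "hcomp t f = (if t \<in> T then g t else 0)" for t
  proof -
    have "hcomp t f = (\<Sum>s\<in>T. if t = s then g s else 0)"
      by (simp add: f_def hcomp_sum hcomp_form[OF g(1)])
    then show ?thesis using \<open>finite T\<close> by (simp add: sum.delta)
  qed
  show thesis
  proof (rule that)
    show "u = rao_map (coset f)"
      using g(2) by (auto simp: rao_map_coset hf T_def one_coh_group fun_eq_iff)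
    show "hcomp t f = 0" if "u t = \<one>\<^bsub>coh_group t\<^esub>" for t using that by (simp add: hf T_def)
  qed
qed

lemma rao_map_range: "rao_map ` range coset = carrier rao"
proof (intro equalityI subsetI)
  fix u assume "u \<in> carrier rao"
  then show "u \<in> rao_map ` range coset"
  proof (rule rao_map_surj)
    fix f assume "u = rao_map (coset f)"
    then show ?thesis by blast
  qed
qed (auto simp: rao_map_carrier)

lemma zero_rao: "\<zero>\<^bsub>rao\<^esub> = rao_map (coset 0)"
  by (simp add: rao_simps(3) rao_map_coset one_coh_group)

lemma comm_group_rao: "comm_group (add_monoid rao)"
proof (rule comm_groupI)
  have add: "add rao (rao_map (coset f)) (rao_map (coset g)) = rao_map (coset (f + g))" for f g
    by (simp add: rao_map_add)
  have car: "carrier (add_monoid rao) = rao_map ` range coset" by (simp add: rao_map_range)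
  show "\<exists>y\<in>carrier (add_monoid rao). y \<otimes>\<^bsub>add_monoid rao\<^esub> x = \<one>\<^bsub>add_monoid rao\<^esub>"
    if "x \<in> carrier (add_monoid rao)" for x
  proof -
    obtain f where "x = rao_map (coset f)" using \<open>x \<in> carrier (add_monoid rao)\<close> unfolding car by blast
    then have "rao_map (coset (- f)) \<otimes>\<^bsub>add_monoid rao\<^esub> x = \<one>\<^bsub>add_monoid rao\<^esub>"
      by (simp add: add zero_rao)
    then show ?thesis unfolding car by blast
  qed
qed (auto simp: rao_map_add[symmetric] zero_rao ac_simps simp flip: rao_map_range)

lemma rao_map_graded_iso: "rao_map \<in> graded_iso (quotient_module all_ideal) rao"
  unfolding graded_iso_def
proof (intro CollectI conjI allI ballI)
  show "rao_map \<in> iso (add_monoid (quotient_module all_ideal)) (add_monoid rao)"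
  proof (rule isoI)
    show "rao_map \<in> hom (add_monoid (quotient_module all_ideal)) (add_monoid rao)"
      by (rule homI) (auto simp: quotient_simps rao_map_carrier rao_map_add)
    have "inj_on rao_map (range coset)"
      by (rule inj_onI, elim rangeE, hypsubst) (simp only: rao_map_eq_iff coset_eq_iff)
    then show "bij_betw rao_map (carrier (add_monoid (quotient_module all_ideal))) (carrier (add_monoid rao))"
      by (simp add: bij_betw_def quotient_simps rao_map_range)
  qed
  show "rao_map (r \<odot>\<^bsub>quotient_module all_ideal\<^esub> x) = r \<odot>\<^bsub>rao\<^esub> rao_map x"
    if "x \<in> carrier (quotient_module all_ideal)" for r x
    using that by (auto simp: quotient_simps rao_map_scale)
  show "rao_map ` piece (quotient_module all_ideal) t = piece rao t" for t
  proof (intro equalityI subsetI)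
    fix u assume "u \<in> rao_map ` piece (quotient_module all_ideal) t"
    then obtain f where "f \<in> forms t" "u = rao_map (coset f)" by (auto simp: quotient_simps)
    then show "u \<in> piece rao t" by (simp add: rao_simps(5) rao_map_carrier rao_map_form)
  next
    fix u assume "u \<in> piece rao t"
    then have u: "u \<in> carrier rao" "\<And>s. s \<noteq> t \<Longrightarrow> u s = \<one>\<^bsub>coh_group s\<^esub>" by (auto simp: rao_simps(5))
    obtain f where f: "u = rao_map (coset f)" "\<And>s. u s = \<one>\<^bsub>coh_group s\<^esub> \<Longrightarrow> hcomp s f = 0"
      using rao_map_surj[OF u(1)] by blast
    have "f = hcomp t f"
    proof (rule hcomp_eqI)
      fix s
      show "hcomp s f = hcomp s (hcomp t f)"
        using f(2) u(2) by (cases "s = t") (simp_all add: hcomp_form[OF hcomp_in_forms])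
    qed
    then have "f \<in> forms t" using hcomp_in_forms[of t f] by simp
    then show "u \<in> rao_map ` piece (quotient_module all_ideal) t" using f(1) by (simp add: quotient_simps)
  qed
qed

text \<open>The augmentation sends a chain of degree 0 to the image under \<open>rao_map\<close> of
  the coset of its value at the empty set. Its kernel is therefore given by the ideal, which is also
  the image of the first differential; in higher degrees the Koszul complex is exact by
  regularity.\<close>

lemma rao_resolution:
  "minimal_free_resolution (koszul_complex d [F1, F2, F3, F4]) (\<lambda>_. rao_map (coset 1)) rao"
  unfolding minimal_free_resolution_def graded_free_resolution_def
proof (intro conjI ballI allI impI)
  let ?K = "koszul_complex d [F1, F2, F3, F4]"
  have F: "set [F1, F2, F3, F4] \<subseteq> forms (int d)" using F_forms by simp
  show "graded_free ?K" using F by (rule graded_free_koszul_complex)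
  show "rao_map (coset 1) \<in> piece rao (shift ?K b)" if "b \<in> basis ?K" "hdeg ?K b = 0" for b
    using that rao_map_form[OF forms_one] by (simp add: koszul_complex_def rao_simps(5) rao_map_carrier)
  have B: "{b \<in> basis ?K. hdeg ?K b = 0} = {{}}"
  proof -
    have "S = {}" if "S \<subseteq> {..<n}" "card S = 0" for S and n :: nat
      using that finite_subset[of S "{..<n}"] by simp
    then show ?thesis unfolding koszul_complex_def by auto
  qed
  have aug: "augmentation ?K (\<lambda>_. rao_map (coset 1)) rao v = rao_map (coset (v {}))" for v
  proof -
    interpret comm_group "add_monoid rao" by (rule comm_group_rao)
    have "v {} \<odot>\<^bsub>rao\<^esub> rao_map (coset 1) = rao_map (coset (v {}))"
      using rao_map_scale[of "v {}" 1] by simp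
    moreover have r0: "add rao (rao_map (coset (v {}))) \<zero>\<^bsub>rao\<^esub> = rao_map (coset (v {}))"
      by (simp add: zero_rao flip: rao_map_add)
    ultimately show ?thesis
      unfolding augmentation_def B finsum_def
      using finprod_insert[of "{}" "{}" "\<lambda>b. v b \<odot>\<^bsub>rao\<^esub> rao_map (coset 1)"] rao_map_carrier[of "v {}"] r0
      by simp
  qed
  have const: "(\<lambda>S. if S = {} then r else 0) \<in> free_chains ?K 0" for r
    by (simp add: mem_free_chains_koszul)
  show "augmentation ?K (\<lambda>_. rao_map (coset 1)) rao ` free_chains ?K 0 = carrier rao"
  proof -
    have "rao_map (coset f) \<in> augmentation ?K (\<lambda>_. rao_map (coset 1)) rao ` free_chains ?K 0" for f
      using imageI[OF const[of f], of "augmentation ?K (\<lambda>_. rao_map (coset 1)) rao"] by (simp add: aug)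
    then show ?thesis
      unfolding rao_map_range[symmetric] by (auto simp only: aug intro: imageI rangeI)
  qed
  have "augmentation ?K (\<lambda>_. rao_map (coset 1)) rao v = \<zero>\<^bsub>rao\<^esub> \<longleftrightarrow> v {} \<in> all_ideal" for v
  proof -
    show ?thesis by (simp add: aug zero_rao rao_map_eq_iff)
  qed
  then show "{v \<in> free_chains ?K 0. augmentation ?K (\<lambda>_. rao_map (coset 1)) rao v = \<zero>\<^bsub>rao\<^esub>} =
      differential ?K ` free_chains ?K 1"
    unfolding koszul_complex_boundaries by simp
  show "{v \<in> free_chains ?K n. differential ?K v = (\<lambda>_. 0)} = differential ?K ` free_chains ?K (Suc n)"
    if "n \<ge> 1" for n
  proof -
    have "\<forall>i<length [F1, F2, F3, F4]. nzd ([F1, F2, F3, F4] ! i) (rmod.span (set (take i [F1, F2, F3, F4])))"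
      using reg1 reg2 reg3 reg4 by (simp add: All_less_Suc numeral_eq_Suc insert_commute)
    from koszul_complex_exact[OF this, of d "n - 1"] show ?thesis using that by simp
  qed
  show "diff ?K b c \<in> irrelevant_ideal" if "b \<in> basis ?K" for b c
    using diff_koszul_complex(3)[OF _ F d_pos, of b c] that by (simp add: koszul_complex_simps)
qed

end

theorem lemma2p1:
  fixes F1 F2 F3 F4 :: "'k::{alg_closed_field, field_char_0} poly4"
    and d :: nat
    and I1 I2 IC A_ideal :: "'k poly4 set"
    and C C1 C2 :: "'k sheaf"
  assumes forms: "F1 \<in> forms (int d)" "F2 \<in> forms (int d)" "F3 \<in> forms (int d)" "F4 \<in> forms (int d)"
    and regular: "regular_sequence polyring [F1, F2, F3, F4]"
    and I1: "I1 = Idl\<^bsub>polyring\<^esub> {F1, F2}"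
    and I2: "I2 = Idl\<^bsub>polyring\<^esub> {F3, F4}"
    and IC: "IC = I1 \<inter> I2"
    and A_ideal: "A_ideal = Idl\<^bsub>polyring\<^esub> {F1, F2, F3, F4}"
    and C: "C = subscheme_of IC"
    and C1: "C1 = subscheme_of I1"
    and C2: "C2 = subscheme_of I2"
  shows
    "\<comment> \<open>(a)\<close>
     (saturated IC \<and>
      C = scheme_union C1 C2 \<and>
      scheme_support C1 \<inter> scheme_support C2 = {} \<and>
      complete_intersection 2 C1 \<and> complete_intersection 2 C2)
   \<and> \<comment> \<open>(b)\<close>
     IC = I1 \<cdot>\<^bsub>polyring\<^esub> I2
   \<and> \<comment> \<open>(c)\<close>
     (minimal_free_resolution
        (tensor_complex (koszul_ideal_complex d [F1, F2]) (koszul_ideal_complex d [F3, F4]))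
        (\<lambda>(S, T). koszul_ideal_augmentation [F1, F2] S * koszul_ideal_augmentation [F3, F4] T)
        (ideal_module IC) \<and>
      (\<forall>G1 G2 G3 G4 :: 'l::{alg_closed_field, field_char_0} poly4.
         {G1, G2, G3, G4} \<subseteq> forms (int d) \<and> regular_sequence polyring [G1, G2, G3, G4] \<longrightarrow>
         hilbert_function (subscheme_of (Idl\<^bsub>polyring\<^esub> {G1, G2} \<inter> Idl\<^bsub>polyring\<^esub> {G3, G4})) =
         hilbert_function C))
   \<and> \<comment> \<open>(d)\<close>
     (\<exists>\<phi>\<in>graded_iso (quotient_module A_ideal) (rao_module C).
        minimal_free_resolution (koszul_complex d [F1, F2, F3, F4])
          (\<lambda>_. \<phi> (A_ideal +>\<^bsub>polyring\<^esub> 1)) (rao_module C))"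
proof -
  interpret regular_forms F1 F2 F3 F4 d
    using forms regular by (simp add: regular_forms_iff_regular_sequence)
  interpret x: regular_forms F3 F4 F1 F2 d by (rule regular_forms_exchange)
  \<comment> \<open>Both Hilbert functions equal the same expression in \<open>hilb\<close> and
    \<open>d\<close>, whatever the coefficient field, so sequences over \<open>'l\<close> can be
    compared with the one over \<open>'k\<close>.\<close>
  have hilbert: "hilbert_function (subscheme_of (rmod.span {G1, G2} \<inter> rmod.span {G3, G4})) =
      hilbert_function (subscheme_of inter_ideal)"
    if "{G1, G2, G3, G4} \<subseteq> forms (int d)" "regular_sequence polyring [G1, G2, G3, G4]"
    for G1 G2 G3 G4 :: "'l poly4"
  proof -
    interpret G: regular_forms G1 G2 G3 G4 d
      using that by (simp add: regular_forms_iff_regular_sequence)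
    show ?thesis by (intro ext) (simp only: hilbert_function_union G.hilbert_function_union)
  qed
  show ?thesis
    unfolding C C1 C2 IC I1 I2 A_ideal Idl_eq_span
    by (intro conjI allI impI bexI[of _ rao_map] saturated_intersection
        subscheme_of_Int[OF rmod.subspace_span rmod.subspace_span] disjoint_supports
        complete_intersection_pair x.complete_intersection_pair inter_eq_ideal_prod
        tensor_koszul_resolution rao_map_graded_iso rao_resolution hilbert) blast+
qed

end
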